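(* Let $\mathbb{F} = \mathbb{Z}/2\mathbb{Z}$. Let $G=(V,E)$ be a finite planar graph with an integer weight $m(w)$ for each vertex $w\in V$ and a sign $\pm$ for each edge $e \in E$, and let $v\in V$. Let $G-v$ denote the graph obtained from $G$ by deleting $v$ and all its incident edges, and let $G_{+1}(v)$ denote the graph obtained from $G$ by increasing the weight $m(v)$ by one. For each weighted signed graph $\Gamma$, let $(\mathcal{C}^+(\Gamma),\delta)$ be its lattice cochain complex over $\mathbb{F}$ and $\mathbb{H}^+(\Gamma)$ its lattice cohomology, as defined in the context. Then there is a short exact sequence of complexes (of $\mathbb{F}[U]$-modules) $$0 \to \mathcal{C}^+(G_{+1}(v)) \xrightarrow{A} \mathcal{C}^+(G) \xrightarrow{B} \mathcal{C}^+(G-v) \to 0,$$ which gives rise to an $\mathbb{F}[U]$-equivariant exact triangle (long exact sequence) of lattice cohomology groups $$\cdots \to \mathbb{H}^+(G_{+1}(v)) \to \mathbb{H}^+(G) \to \mathbb{H}^+(G-v) \to \mathbb{H}^+(G_{+1}(v)) \to \cdots.$$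
   Context: Throughout $\mathbb{F}=\mathbb{Z}/2\mathbb{Z}$. Let $\Gamma$ be a finite graph with vertex set $V$ (multiple edges are allowed), an integer weight $m(w)$ for each vertex $w$, and a sign $\pm$ for each edge. **Lattice.** $L=L(\Gamma)$ is the free $\mathbb{Z}$-module with basis $\{E_w : w\in V\}$, with the symmetric bilinear form $(\cdot,\cdot)$ given by $(E_w,E_w)=m(w)$ and, for $u\neq w$, $(E_u,E_w)=$ the signed number of edges between $u$ and $w$ (positive edges minus negative edges). No definiteness is assumed. **Characteristic vectors.** $Char(\Gamma)$ is the set of $K\in \mathrm{Hom}(L,\mathbb{Z})$ with $K(x)\equiv (x,x) \pmod 2$ for all $x\in L$. For $K\in Char(\Gamma)$ and $x\in L$, $K+2x\in Char(\Gamma)$ denotes the functional $y\mapsto K(y)+2(x,y)$. For $T\subset V$ put $E_T=\sum_{j\in T}E_j$. **Weights of cubes.** Formally $q(x)=-\frac18(x,x)$ (extended to $L\otimes\mathbb{R}$, where elements of $\mathrm{Hom}(L,\mathbb{Z})$ are viewed via the pairing), and for $K\in Char(\Gamma)$, $S\subset V$, $q(K,S)=\max\{q(K+2E_T) : T\subset S\}$. Only differences of values of $q$ along $K+2L$ are used, and these are computed by $$q(K+2x)-q(K)=-\tfrac12\big(K(x)+(x,x)\big)\in\mathbb{Z}\qquad(x\in L).$$ Explicitly, writing $f_K(T)=-\frac12\big(K(E_T)+(E_T,E_T)\big)$, for $w\in S$: - $q(K,S)-q(K,S-w)=\max_{T\subset S}f_K(T)-\max_{T\subset S-w}f_K(T)$,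 - $q(K,S)-q(K+2E_w,S-w)=\max_{T\subset S}f_K(T)-\max_{T\subset S-w}f_K(T\cup\{w\})$, where $S-w=S\setminus\{w\}$. Both are non-negative integers. When the form is degenerate, these formulas are taken as the definition of the left-hand sides. **The complex.** $\mathcal{T}^+_0=\mathbb{F}[U,U^{-1}]/U\cdot\mathbb{F}[U]$ as an $\mathbb{F}[U]$-module (so it has $\mathbb{F}$-basis $U^{-d}$, $d\ge 0$). With $\mathcal{P}(V)$ the power set of $V$, $\mathcal{C}^+(\Gamma)$ is the $\mathbb{F}[U]$-module of finitely supported functions $\phi: Char(\Gamma)\times\mathcal{P}(V)\to\mathcal{T}^+_0$. It is graded by $s$: $\phi$ is homogeneous of degree $s$ if it is supported on pairs $(K,S)$ with $|S|=s$. The differential $\delta$, of degree $+1$, is $$\delta(\phi)(K,S)=\sum_{w\in S}\Big(U^{q(K,S)-q(K,S-w)}\,\phi(K,S-w)+U^{q(K,S)-q(K+2E_w,S-w)}\,\phi(K+2E_w,S-w)\Big),$$ and $\delta^2=0$. The lattice cohomology $\mathbb{H}^+(\Gamma)$ is the homology of $(\mathcal{C}^+(\Gamma),\delta)$, a graded $\mathbb{F}[U]$-module. *)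

theory Defs
  imports
    "HOL-Analysis.Analysis"
    "HOL-Computational_Algebra.Polynomial"
    "HOL-Library.Z2"
    "HOL-Library.Poly_Mapping"
    "HOL-Algebra.AbelCoset"
    "HOL-Algebra.Module"
begin

section \<open>Graded modules and complexes\<close>

text \<open>
  The record of modules extends that of rings; its fields \<open>mult\<close> and \<open>one\<close> carry no meaning
  for a module and are left \<open>undefined\<close> below.
\<close>

record ('r, 'a) graded_module = "('r, 'a) module" +
  piece :: "int \<Rightarrow> 'a set"

record ('r, 'a) graded_complex = "('r, 'a) graded_module" +
  cobd :: "'a \<Rightarrow> 'a"

definition is_graded_module ::
    "('r, 'm) ring_scheme \<Rightarrow> ('r, 'a, 'n) graded_module_scheme \<Rightarrow> bool" where
  "is_graded_module R M \<longleftrightarrow>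
     Module.module R M \<and>
     (\<forall>s. submodule (piece M s) R M) \<and>
     (\<forall>x\<in>carrier M. \<exists>!c.
        (\<forall>s. c s \<in> piece M s) \<and> finite {s. c s \<noteq> \<zero>\<^bsub>M\<^esub>} \<and>
        x = (\<Oplus>\<^bsub>M\<^esub>s\<in>{s. c s \<noteq> \<zero>\<^bsub>M\<^esub>}. c s))"

definition linear_maps ::
    "('r, 'm) ring_scheme \<Rightarrow> ('r, 'a, 'n) module_scheme \<Rightarrow> ('r, 'b, 'k) module_scheme \<Rightarrow>
      ('a \<Rightarrow> 'b) set" where
  "linear_maps R M N =
     {f \<in> carrier M \<rightarrow> carrier N.
        (\<forall>x\<in>carrier M. \<forall>y\<in>carrier M. f (x \<oplus>\<^bsub>M\<^esub> y) = f x \<oplus>\<^bsub>N\<^esub> f y) \<and>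
        (\<forall>r\<in>carrier R. \<forall>x\<in>carrier M. f (r \<odot>\<^bsub>M\<^esub> x) = r \<odot>\<^bsub>N\<^esub> f x)}"

definition graded_maps ::
    "('r, 'm) ring_scheme \<Rightarrow> int \<Rightarrow> ('r, 'a, 'n) graded_module_scheme \<Rightarrow>
      ('r, 'b, 'k) graded_module_scheme \<Rightarrow> ('a \<Rightarrow> 'b) set" where
  "graded_maps R k M N =
     {f \<in> linear_maps R M N. \<forall>s. f ` piece M s \<subseteq> piece N (s + k)}"

definition is_complex ::
    "('r, 'm) ring_scheme \<Rightarrow> ('r, 'a, 'n) graded_complex_scheme \<Rightarrow> bool" where
  "is_complex R C \<longleftrightarrow>
     is_graded_module R C \<and> cobd C \<in> graded_maps R 1 C C \<and>
     (\<forall>x\<in>carrier C. cobd C (cobd C x) = \<zero>\<^bsub>C\<^esub>)"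

definition cochain_maps ::
    "('r, 'm) ring_scheme \<Rightarrow> ('r, 'a, 'n) graded_complex_scheme \<Rightarrow>
      ('r, 'b, 'k) graded_complex_scheme \<Rightarrow> ('a \<Rightarrow> 'b) set" where
  "cochain_maps R C D =
     {f \<in> graded_maps R 0 C D. \<forall>x\<in>carrier C. f (cobd C x) = cobd D (f x)}"

definition short_exact_complexes ::
    "('r, 'm) ring_scheme \<Rightarrow> ('r, 'a, 'n) graded_complex_scheme \<Rightarrow>
      ('r, 'b, 'k) graded_complex_scheme \<Rightarrow> ('r, 'c, 'l) graded_complex_scheme \<Rightarrow>
      ('a \<Rightarrow> 'b) \<Rightarrow> ('b \<Rightarrow> 'c) \<Rightarrow> bool" where
  "short_exact_complexes R C D E f g \<longleftrightarrow>
     is_complex R C \<and> is_complex R D \<and> is_complex R E \<and>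
     f \<in> cochain_maps R C D \<and> g \<in> cochain_maps R D E \<and>
     inj_on f (carrier C) \<and> f ` carrier C = a_kernel D E g \<and> g ` carrier D = carrier E"


section \<open>Homology\<close>

definition cycles :: "('r, 'a, 'n) graded_complex_scheme \<Rightarrow> 'a set" where
  "cycles C = a_kernel C C (cobd C)"

definition hclass :: "('r, 'a, 'n) graded_complex_scheme \<Rightarrow> 'a \<Rightarrow> 'a set" where
  "hclass C z = (cobd C ` carrier C) +>\<^bsub>C\<^esub> z"

text \<open>The quotient module of cycles by boundaries; its elements are cosets.\<close>

definition homology ::
    "('r, 'a, 'n) graded_complex_scheme \<Rightarrow> ('r, 'a set) graded_module" where
  "homology C =
     \<lparr>carrier = hclass C ` cycles C,
      mult = undefined,
      one = undefined,
      zero = hclass C \<zero>\<^bsub>C\<^esub>,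
      add = set_add C,
      smult = (\<lambda>r c. \<Union>z\<in>c. hclass C (r \<odot>\<^bsub>C\<^esub> z)),
      piece = (\<lambda>s. hclass C ` (cycles C \<inter> piece C s))\<rparr>"

text \<open>The union is over representatives of one class, all of which contribute the same coset.\<close>

definition induced_map ::
    "('r, 'b, 'k) graded_complex_scheme \<Rightarrow> ('a \<Rightarrow> 'b) \<Rightarrow> 'a set \<Rightarrow> 'b set" where
  "induced_map D f c = (\<Union>z\<in>c. hclass D (f z))"

text \<open>
  For \<open>0 \<rightarrow> C \<rightarrow> D \<rightarrow> E \<rightarrow> 0\<close> with maps \<open>f\<close>, \<open>g\<close>: the map \<open>h\<close> on homology classes is the one
  of the snake lemma, \<open>[z] \<mapsto> [f\<inverse> (\<delta> (g\<inverse> z))]\<close>, independently of all choices.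
\<close>

definition is_connecting_map ::
    "('r, 'a, 'n) graded_complex_scheme \<Rightarrow> ('r, 'b, 'k) graded_complex_scheme \<Rightarrow>
      ('r, 'c, 'l) graded_complex_scheme \<Rightarrow>
      ('a \<Rightarrow> 'b) \<Rightarrow> ('b \<Rightarrow> 'c) \<Rightarrow> ('c set \<Rightarrow> 'a set) \<Rightarrow> bool" where
  "is_connecting_map C D E f g h \<longleftrightarrow>
     (\<forall>z\<in>cycles E. \<forall>y\<in>carrier D. \<forall>x\<in>carrier C.
        g y = z \<and> f x = cobd D y \<longrightarrow> h (hclass E z) = hclass C x)"

text \<open>
  Exactness of the triangle \<open>M \<rightarrow> N \<rightarrow> P \<rightarrow> M\<close>, and of the long exact sequence
  \<open>\<dots> \<rightarrow> M\<^sup>s \<rightarrow> N\<^sup>s \<rightarrow> P\<^sup>s \<rightarrow> M\<^sup>s\<^sup>+\<^sup>1 \<rightarrow> \<dots>\<close> of homogeneous parts that it unrolls to.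
\<close>

definition exact_triangle ::
    "('r, 'm) ring_scheme \<Rightarrow> ('r, 'a, 'n) graded_module_scheme \<Rightarrow>
      ('r, 'b, 'k) graded_module_scheme \<Rightarrow> ('r, 'c, 'l) graded_module_scheme \<Rightarrow>
      ('a \<Rightarrow> 'b) \<Rightarrow> ('b \<Rightarrow> 'c) \<Rightarrow> ('c \<Rightarrow> 'a) \<Rightarrow> bool" where
  "exact_triangle R M N P f g h \<longleftrightarrow>
     f \<in> graded_maps R 0 M N \<and> g \<in> graded_maps R 0 N P \<and> h \<in> graded_maps R 1 P M \<and>
     f ` carrier M = a_kernel N P g \<and>
     g ` carrier N = a_kernel P M h \<and>
     h ` carrier P = a_kernel M N f \<and>
     (\<forall>s. f ` piece M s = a_kernel N P g \<inter> piece N s \<and>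
          g ` piece N s = a_kernel P M h \<inter> piece P s \<and>
          h ` piece P s = a_kernel M N f \<inter> piece M (s + 1))"


section \<open>The module \<open>\<F>[U,U\<inverse>] / U\<F>[U]\<close>\<close>

definition FU :: "bit poly ring" where
  "FU = \<lparr>carrier = UNIV, mult = (*), one = 1, zero = 0, add = (+)\<rparr>"

text \<open>Laurent polynomials over \<open>\<F>\<close>; the key \<open>i\<close> stands for \<open>U\<^sup>i\<close>.\<close>

type_synonym laurent = "int \<Rightarrow>\<^sub>0 bit"

definition laurent_of_poly :: "bit poly \<Rightarrow> laurent" where
  "laurent_of_poly p = (\<Sum>i\<le>degree p. Poly_Mapping.single (int i) (coeff p i))"

definition UFU :: "laurent set" where
  "UFU = {laurent_of_poly ([:0, 1:] * p) |p. True}"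

lemma lookup_laurent_of_poly:
  "Poly_Mapping.lookup (laurent_of_poly p) k = (if k < 0 then 0 else coeff p (nat k))"
proof -
  have "Poly_Mapping.lookup (laurent_of_poly p) k
      = (\<Sum>i\<le>degree p. if i = nat k then (if k < 0 then 0 else coeff p i) else 0)"
    unfolding laurent_of_poly_def lookup_sum
    by (intro sum.cong refl) (auto simp: lookup_single when_def)
  also have "\<dots> = (if k < 0 then 0 else coeff p (nat k))"
    by (auto simp: coeff_eq_0)
  finally show ?thesis .
qed

lemma laurent_of_poly_add: "laurent_of_poly (p + q) = laurent_of_poly p + laurent_of_poly q"
  by (rule poly_mapping_eqI) (simp add: lookup_laurent_of_poly lookup_add)

lemma laurent_of_poly_uminus: "laurent_of_poly (- p) = - laurent_of_poly p"
  by (rule poly_mapping_eqI) (simp add: lookup_laurent_of_poly)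

lemma laurent_of_poly_0 [simp]: "laurent_of_poly 0 = 0"
  by (rule poly_mapping_eqI) (simp add: lookup_laurent_of_poly)

lemma lookup_U_times:
  "Poly_Mapping.lookup (Poly_Mapping.single 1 1 * x) k = Poly_Mapping.lookup x (k - 1)"
  for x :: laurent
proof (induction x rule: update_induct)
  case const
  then show ?case by simp
next
  case (update f k' a)
  have "Poly_Mapping.update k' a f = f + Poly_Mapping.single k' a"
    using update.hyps
    by (intro poly_mapping_eqI)
      (auto simp: lookup_update lookup_add lookup_single when_def in_keys_iff)
  moreover have "Poly_Mapping.lookup (Poly_Mapping.single 1 1 * Poly_Mapping.single k' a) k
      = Poly_Mapping.lookup (Poly_Mapping.single k' a) (k - 1)"
    by (auto simp: mult_single lookup_single when_def)
  ultimately show ?case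
    using update.IH by (simp add: distrib_left lookup_add)
qed

lemma laurent_of_poly_pCons:
  "laurent_of_poly (pCons a p) =
     Poly_Mapping.single 0 a + Poly_Mapping.single 1 1 * laurent_of_poly p"
  by (rule poly_mapping_eqI)
    (auto simp: lookup_add lookup_U_times lookup_laurent_of_poly lookup_single when_def
      coeff_pCons nat_diff_distrib split: nat.split)

lemma laurent_of_poly_mult: "laurent_of_poly (p * q) = laurent_of_poly p * laurent_of_poly q"
proof (induction p)
  case 0
  then show ?case by simp
next
  case (pCons a p)
  have "laurent_of_poly (Polynomial.smult a q) = Poly_Mapping.single 0 a * laurent_of_poly q"
    by (cases "a = 0") simp_all
  then show ?case
    using pCons
    by (simp add: mult_pCons_left laurent_of_poly_add laurent_of_poly_pCons[of _ p]
        laurent_of_poly_pCons[of 0 "p * q"] ring_distribs mult.assoc)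
qed

lemma UFU_0: "0 \<in> UFU"
  unfolding UFU_def by (auto intro!: exI[of _ 0])

lemma UFU_add: "x \<in> UFU \<Longrightarrow> y \<in> UFU \<Longrightarrow> x + y \<in> UFU"
  unfolding UFU_def by (clarify, metis distrib_left laurent_of_poly_add)

lemma UFU_uminus: "x \<in> UFU \<Longrightarrow> - x \<in> UFU"
  unfolding UFU_def by (clarify, metis laurent_of_poly_uminus mult_minus_right)

lemma UFU_scale: "x \<in> UFU \<Longrightarrow> laurent_of_poly r * x \<in> UFU"
  unfolding UFU_def by (clarify, metis laurent_of_poly_mult mult.left_commute)

quotient_type tower = laurent / "\<lambda>x y. x - y \<in> UFU"
  morphisms rep_tower abs_tower
proof (rule equivpI)
  show "reflp (\<lambda>x y. x - y \<in> UFU)"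
    by (rule reflpI) (simp add: UFU_0)
  show "symp (\<lambda>x y. x - y \<in> UFU)"
    by (rule sympI) (drule UFU_uminus, simp)
  show "transp (\<lambda>x y. x - y \<in> UFU)"
  proof (rule transpI)
    fix x y z :: laurent
    assume "x - y \<in> UFU" and "y - z \<in> UFU"
    from UFU_add[OF this] show "x - z \<in> UFU" by simp
  qed
qed

instantiation tower :: ab_group_add
begin

lift_definition zero_tower :: tower is 0 .

lift_definition plus_tower :: "tower \<Rightarrow> tower \<Rightarrow> tower" is "(+)"
proof -
  fix a b c d :: laurent assume "a - b \<in> UFU" "c - d \<in> UFU"
  from UFU_add[OF this] show "a + c - (b + d) \<in> UFU" by (simp add: algebra_simps)
qed

lift_definition uminus_tower :: "tower \<Rightarrow> tower" is uminus
proof -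
  fix a b :: laurent assume "a - b \<in> UFU"
  from UFU_uminus[OF this] show "- a - - b \<in> UFU" by simp
qed

lift_definition minus_tower :: "tower \<Rightarrow> tower \<Rightarrow> tower" is "(-)"
proof -
  fix a b c d :: laurent assume "a - b \<in> UFU" "c - d \<in> UFU"
  then have "(a - b) + - (c - d) \<in> UFU" by (intro UFU_add UFU_uminus)
  then show "a - c - (b - d) \<in> UFU" by (simp add: algebra_simps)
qed

instance
proof
  fix a b c :: tower
  show "a + b + c = a + (b + c)" by transfer (simp add: UFU_0 add.assoc)
  show "a + b = b + a" by transfer (simp add: UFU_0 add.commute)
  show "0 + a = a" by transfer (simp add: UFU_0)
  show "- a + a = 0" by transfer (simp add: UFU_0)
  show "a - b = a + - b" by transfer (simp add: UFU_0)
qed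

end

lift_definition tower_smult :: "bit poly \<Rightarrow> tower \<Rightarrow> tower" is "\<lambda>p x. laurent_of_poly p * x"
proof -
  fix p and a b :: laurent assume "a - b \<in> UFU"
  from UFU_scale[OF this, of p]
  show "laurent_of_poly p * a - laurent_of_poly p * b \<in> UFU" by (simp add: right_diff_distrib)
qed

definition Upow :: "nat \<Rightarrow> tower \<Rightarrow> tower" where
  "Upow n = tower_smult (monom 1 n)"


section \<open>Weighted signed graphs\<close>

record ('v, 'e) wgraph =
  verts :: "'v set"
  edges :: "'e set"
  ends :: "'e \<Rightarrow> 'v set"
  weight :: "'v \<Rightarrow> int"
  positive :: "'e \<Rightarrow> bool"

text \<open>Multiple edges are allowed, loops are not.\<close>

definition finite_wgraph :: "('v, 'e) wgraph \<Rightarrow> bool" where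
  "finite_wgraph G \<longleftrightarrow>
     finite (verts G) \<and> finite (edges G) \<and>
     (\<forall>e\<in>edges G. ends G e \<subseteq> verts G \<and> card (ends G e) = 2)"

text \<open>
  Planar means embeddable in the plane: edges become arcs that meet the image of the vertex set
  exactly in the images of their ends, and meet each other only there.
\<close>

definition planar :: "('v, 'e) wgraph \<Rightarrow> bool" where
  "planar G \<longleftrightarrow>
     (\<exists>(pos :: 'v \<Rightarrow> real ^ 2) (\<gamma> :: 'e \<Rightarrow> real \<Rightarrow> real ^ 2).
        inj_on pos (verts G) \<and>
        (\<forall>e\<in>edges G.
           arc (\<gamma> e) \<and>
           {pathstart (\<gamma> e), pathfinish (\<gamma> e)} = pos ` ends G e \<and>
           path_image (\<gamma> e) \<inter> pos ` verts G = pos ` ends G e) \<and>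
        (\<forall>e\<in>edges G. \<forall>e'\<in>edges G. e \<noteq> e' \<longrightarrow>
           path_image (\<gamma> e) \<inter> path_image (\<gamma> e') \<subseteq> pos ` verts G))"

definition delete_vertex :: "('v, 'e) wgraph \<Rightarrow> 'v \<Rightarrow> ('v, 'e) wgraph" where
  "delete_vertex G v = G\<lparr>verts := verts G - {v}, edges := {e \<in> edges G. v \<notin> ends G e}\<rparr>"

definition raise_weight :: "('v, 'e) wgraph \<Rightarrow> 'v \<Rightarrow> ('v, 'e) wgraph" where
  "raise_weight G v = G\<lparr>weight := (weight G)(v := weight G v + 1)\<rparr>"


section \<open>The lattice cochain complex\<close>

definition lattice :: "('v, 'e) wgraph \<Rightarrow> ('v \<Rightarrow>\<^sub>0 int) set" where
  "lattice G = {x. Poly_Mapping.keys x \<subseteq> verts G}"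

definition gram :: "('v, 'e) wgraph \<Rightarrow> 'v \<Rightarrow> 'v \<Rightarrow> int" where
  "gram G u w =
     (if u = w then weight G w
      else (\<Sum>e\<in>{e \<in> edges G. ends G e = {u, w}}. if positive G e then 1 else -1))"

definition form :: "('v, 'e) wgraph \<Rightarrow> ('v \<Rightarrow>\<^sub>0 int) \<Rightarrow> ('v \<Rightarrow>\<^sub>0 int) \<Rightarrow> int" where
  "form G x y =
     (\<Sum>u\<in>verts G. \<Sum>w\<in>verts G.
        Poly_Mapping.lookup x u * Poly_Mapping.lookup y w * gram G u w)"

text \<open>
  An element of \<open>Hom(L, \<int>)\<close> is a function on the whole type which is \<open>undefined\<close> outside \<open>L\<close>
  (hence \<open>extensional\<close> and \<open>restrict\<close>), so that distinct functions are distinct homomorphisms.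
\<close>

type_synonym 'v functional = "('v \<Rightarrow>\<^sub>0 int) \<Rightarrow> int"

definition dual_lattice :: "('v, 'e) wgraph \<Rightarrow> 'v functional set" where
  "dual_lattice G =
     {K \<in> extensional (lattice G).
        \<forall>x\<in>lattice G. \<forall>y\<in>lattice G. K (x + y) = K x + K y}"

definition Char :: "('v, 'e) wgraph \<Rightarrow> 'v functional set" where
  "Char G = {K \<in> dual_lattice G. \<forall>x\<in>lattice G. K x mod 2 = form G x x mod 2}"

definition shift :: "('v, 'e) wgraph \<Rightarrow> 'v functional \<Rightarrow> ('v \<Rightarrow>\<^sub>0 int) \<Rightarrow> 'v functional" where
  "shift G K x = restrict (\<lambda>y. K y + 2 * form G x y) (lattice G)"

definition basis_vec :: "'v \<Rightarrow> ('v \<Rightarrow>\<^sub>0 int)" where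
  "basis_vec w = Poly_Mapping.single w 1"

definition basis_sum :: "'v set \<Rightarrow> ('v \<Rightarrow>\<^sub>0 int)" where
  "basis_sum T = (\<Sum>j\<in>T. basis_vec j)"

text \<open>\<open>qrel G K T\<close> is \<open>q (K + 2 E\<^sub>T) - q K\<close>; the division is exact for characteristic \<open>K\<close>.\<close>

definition qrel :: "('v, 'e) wgraph \<Rightarrow> 'v functional \<Rightarrow> 'v set \<Rightarrow> int" where
  "qrel G K T = - ((K (basis_sum T) + form G (basis_sum T) (basis_sum T)) div 2)"

text \<open>
  The differences \<open>q (K, S) - q (K, S - w)\<close> and \<open>q (K, S) - q (K + 2 E\<^sub>w, S - w)\<close>.
\<close>

definition qdiff_near :: "('v, 'e) wgraph \<Rightarrow> 'v functional \<Rightarrow> 'v set \<Rightarrow> 'v \<Rightarrow> int" where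
  "qdiff_near G K S w =
     Max (qrel G K ` Pow S) - Max (qrel G K ` Pow (S - {w}))"

definition qdiff_far :: "('v, 'e) wgraph \<Rightarrow> 'v functional \<Rightarrow> 'v set \<Rightarrow> 'v \<Rightarrow> int" where
  "qdiff_far G K S w =
     Max (qrel G K ` Pow S) - Max ((\<lambda>T. qrel G K (T \<union> {w})) ` Pow (S - {w}))"

type_synonym 'v cochain = "'v functional \<times> 'v set \<Rightarrow> tower"

definition cochains :: "('v, 'e) wgraph \<Rightarrow> 'v cochain set" where
  "cochains G =
     {\<phi>. finite {p. \<phi> p \<noteq> 0} \<and> {p. \<phi> p \<noteq> 0} \<subseteq> Char G \<times> Pow (verts G)}"

definition lattice_cobd :: "('v, 'e) wgraph \<Rightarrow> 'v cochain \<Rightarrow> 'v cochain" where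
  "lattice_cobd G \<phi> =
     (\<lambda>(K, S).
        if K \<in> Char G \<and> S \<subseteq> verts G then
          (\<Sum>w\<in>S.
             Upow (nat (qdiff_near G K S w)) (\<phi> (K, S - {w})) +
             Upow (nat (qdiff_far G K S w)) (\<phi> (shift G K (basis_vec w), S - {w})))
        else 0)"

definition lattice_complex :: "('v, 'e) wgraph \<Rightarrow> (bit poly, 'v cochain) graded_complex" where
  "lattice_complex G =
     \<lparr>carrier = cochains G,
      mult = undefined,
      one = undefined,
      zero = (\<lambda>_. 0),
      add = (\<lambda>\<phi> \<psi> p. \<phi> p + \<psi> p),
      smult = (\<lambda>r \<phi> p. tower_smult r (\<phi> p)),
      piece = (\<lambda>s. {\<phi> \<in> cochains G. \<forall>K S. \<phi> (K, S) \<noteq> 0 \<longrightarrow> int (card S) = s}),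
      cobd = lattice_cobd G\<rparr>"

abbreviation lattice_cohomology ::
    "('v, 'e) wgraph \<Rightarrow> (bit poly, 'v cochain set) graded_module" where
  "lattice_cohomology G \<equiv> homology (lattice_complex G)"

end

theory Submission
  imports Defs "HOL-Library.Function_Algebras"
begin

text \<open>
  A characteristic functional of \<open>G\<close> is its restriction to \<open>G - v\<close> together with an integer of
  fixed parity, its value on \<open>E\<^sub>v\<close>; raising the weight of \<open>v\<close> flips this parity. The map \<open>B\<close> sums
  a cochain along these fibres, and \<open>A\<close> is the blow-down map: a theta-like sum over odd shifts
  \<open>2l - 1\<close> of the value on \<open>E\<^sub>v\<close>, in which the summand at a vertex of a cube carries the weight
  \<open>U\<close> to the power \<open>l (l - 1) / 2\<close>. Up to normalisation all powers of \<open>U\<close> are differences of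
  maxima of \<open>q\<close>, so both are cochain maps by telescoping, and \<open>B \<circ> A = 0\<close> since the summands for
  \<open>l\<close> and \<open>1 - l\<close> cancel. Exactness is checked on terms with \<open>U\<close>-exponent \<open>0\<close>, which suffices
  because every element of the tower is \<open>U\<close>-torsion. There, on cubes not in direction \<open>v\<close>, \<open>A\<close>
  adds the two neighbouring values on a fibre; on cubes in direction \<open>v\<close> it is unitriangular.
\<close>

section \<open>The long exact sequence of a short exact sequence of complexes\<close>

text \<open>The shifts and weights of A come from a blow-up. Attach to v a new vertex of weight -1
  with basis element E. Then E_v + E is orthogonal to E and has square m(v) + 1, so splitting off E
  leaves the lattice of G_{+1}(v). A functional with values K(E_v) on E_v and 2l - 1 on E descends
  to one with value K(E_v) + 2l - 1 at v, and the contribution of E to q exceeds its minimum by ((2l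
  - 1)^2 - 1) / 8 = l (l - 1) / 2. The sum over l runs over all extensions of K to E. The main
  obstacle is that fibres are infinite while cochains have finite support. Finiteness is always won
  by playing exponents that grow at least like |l| against a power of U that kills the given
  cochain. The same power of U is the induction variable when terms of positive exponent have to be
  removed from the image of A. The triangular order in direction v is given by the absolute
  difference of the maxima of q over the two faces opposite in that direction, an affine coordinate
  on each fibre.\<close>

definition homog_decomp :: "('r, 'a, 'n) graded_module_scheme \<Rightarrow> 'a \<Rightarrow> (int \<Rightarrow> 'a) \<Rightarrow> bool" where
  "homog_decomp M x c \<longleftrightarrow>
     (\<forall>s. c s \<in> piece M s) \<and> finite {s. c s \<noteq> \<zero>\<^bsub>M\<^esub>} \<and>
     x = (\<Oplus>\<^bsub>M\<^esub>s\<in>{s. c s \<noteq> \<zero>\<^bsub>M\<^esub>}. c s)"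

text \<open>The projection to degree \<open>s\<close>. Degreewise exactness asks for homogeneous
  representatives, whereas a diagram chase produces representatives of mixed degree; projecting them
  repairs this.\<close>

definition hcomp :: "('r, 'a, 'n) graded_module_scheme \<Rightarrow> int \<Rightarrow> 'a \<Rightarrow> 'a" where
  "hcomp M s x = (THE c. homog_decomp M x c) s"

locale gr_module =
  fixes R :: "('r, 'm) ring_scheme" and M :: "('r, 'a, 'n) graded_module_scheme"
  assumes graded: "is_graded_module R M"
begin

sublocale module R M
  using graded by (simp add: is_graded_module_def)

lemma piece_submodule: "submodule (piece M s) R M"
  using graded by (simp add: is_graded_module_def)

lemma piece_carrier: "x \<in> piece M s \<Longrightarrow> x \<in> carrier M"
  using subgroup.subset[OF submodule.axioms(1)[OF piece_submodule, of s]] by auto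

lemma piece_zero: "\<zero>\<^bsub>M\<^esub> \<in> piece M s"
  using subgroup.one_closed[OF submodule.axioms(1)[OF piece_submodule]] by simp

lemma piece_add: "x \<in> piece M s \<Longrightarrow> y \<in> piece M s \<Longrightarrow> x \<oplus>\<^bsub>M\<^esub> y \<in> piece M s"
  using subgroup.m_closed[OF submodule.axioms(1)[OF piece_submodule]] by simp

lemma ex1_homog_decomp: "x \<in> carrier M \<Longrightarrow> \<exists>!c. homog_decomp M x c"
  using graded unfolding is_graded_module_def homog_decomp_def by blast

lemma homog_decomp_hcomp:
  assumes "x \<in> carrier M"
  shows "homog_decomp M x (\<lambda>s. hcomp M s x)"
proof -
  have "(\<lambda>s. hcomp M s x) = (THE c. homog_decomp M x c)"
    by (simp add: hcomp_def)
  then show ?thesis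
    using theI'[OF ex1_homog_decomp[OF assms]] by simp
qed

lemma hcomp_piece: "x \<in> carrier M \<Longrightarrow> hcomp M s x \<in> piece M s"
  using homog_decomp_hcomp by (simp add: homog_decomp_def)

lemma hcomp_closed: "x \<in> carrier M \<Longrightarrow> hcomp M s x \<in> carrier M"
  using hcomp_piece piece_carrier by blast

text \<open>Uniqueness of the decomposition, with any finite superset \<open>A\<close> of the
  support: two elements have different supports, and their decompositions can only be added over a
  common index set.\<close>

lemma hcomp_eqI:
  assumes c: "\<And>s. c s \<in> piece M s" and fin: "finite A"
    and zero: "\<And>s. s \<notin> A \<Longrightarrow> c s = \<zero>\<^bsub>M\<^esub>" and x: "x = (\<Oplus>\<^bsub>M\<^esub>s\<in>A. c s)"
  shows "hcomp M s x = c s"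
proof -
  have sub: "{s. c s \<noteq> \<zero>\<^bsub>M\<^esub>} \<subseteq> A"
    using zero by blast
  have "(\<Oplus>\<^bsub>M\<^esub>s\<in>{s. c s \<noteq> \<zero>\<^bsub>M\<^esub>}. c s) = (\<Oplus>\<^bsub>M\<^esub>s\<in>A. c s)"
    using fin sub c piece_carrier by (intro add.finprod_mono_neutral_cong_left) auto
  then have "homog_decomp M x c"
    using c x finite_subset[OF sub fin] by (simp add: homog_decomp_def)
  moreover have "x \<in> carrier M"
    using x c piece_carrier by (auto intro!: finsum_closed)
  ultimately have "(THE c. homog_decomp M x c) = c"
    using ex1_homog_decomp by (intro the1_equality) auto
  then show ?thesis
    by (simp add: hcomp_def)
qed

lemma hcomp_decomp:
  assumes "x \<in> carrier M"
  obtains A where "finite A" "\<And>s. s \<notin> A \<Longrightarrow> hcomp M s x = \<zero>\<^bsub>M\<^esub>"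
    "x = (\<Oplus>\<^bsub>M\<^esub>s\<in>A. hcomp M s x)"
  using homog_decomp_hcomp[OF assms] that[of "{s. hcomp M s x \<noteq> \<zero>\<^bsub>M\<^esub>}"]
  unfolding homog_decomp_def by blast

lemma hcomp_of_piece: "x \<in> piece M s \<Longrightarrow> hcomp M s x = x"
  using hcomp_eqI[of "\<lambda>t. if t = s then x else \<zero>\<^bsub>M\<^esub>" "{s}" x s]
  by (auto simp: piece_zero piece_carrier)

lemma hcomp_add:
  assumes x: "x \<in> carrier M" and y: "y \<in> carrier M"
  shows "hcomp M s (x \<oplus>\<^bsub>M\<^esub> y) = hcomp M s x \<oplus>\<^bsub>M\<^esub> hcomp M s y"
proof -
  obtain A where A: "finite A" "\<And>s. s \<notin> A \<Longrightarrow> hcomp M s x = \<zero>\<^bsub>M\<^esub>"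
    "x = (\<Oplus>\<^bsub>M\<^esub>s\<in>A. hcomp M s x)"
    using hcomp_decomp[OF x] by metis
  obtain B where B: "finite B" "\<And>s. s \<notin> B \<Longrightarrow> hcomp M s y = \<zero>\<^bsub>M\<^esub>"
    "y = (\<Oplus>\<^bsub>M\<^esub>s\<in>B. hcomp M s y)"
    using hcomp_decomp[OF y] by metis
  have "(\<Oplus>\<^bsub>M\<^esub>s\<in>A \<union> B. hcomp M s x) = (\<Oplus>\<^bsub>M\<^esub>s\<in>A. hcomp M s x)"
    using A(1,2) B(1) x
    by (intro add.finprod_mono_neutral_cong_right) (auto simp: hcomp_closed)
  moreover have "(\<Oplus>\<^bsub>M\<^esub>s\<in>A \<union> B. hcomp M s y) = (\<Oplus>\<^bsub>M\<^esub>s\<in>B. hcomp M s y)"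
    using A(1) B(1,2) y
    by (intro add.finprod_mono_neutral_cong_right) (auto simp: hcomp_closed)
  moreover have "(\<Oplus>\<^bsub>M\<^esub>s\<in>A \<union> B. hcomp M s x \<oplus>\<^bsub>M\<^esub> hcomp M s y)
      = (\<Oplus>\<^bsub>M\<^esub>s\<in>A \<union> B. hcomp M s x) \<oplus>\<^bsub>M\<^esub> (\<Oplus>\<^bsub>M\<^esub>s\<in>A \<union> B. hcomp M s y)"
    using x y by (intro finsum_addf) (auto simp: hcomp_closed)
  ultimately have "x \<oplus>\<^bsub>M\<^esub> y = (\<Oplus>\<^bsub>M\<^esub>s\<in>A \<union> B. hcomp M s x \<oplus>\<^bsub>M\<^esub> hcomp M s y)"
    using A(3) B(3) by simp
  then show ?thesis
    using A B x y
    by (intro hcomp_eqI[of "\<lambda>s. hcomp M s x \<oplus>\<^bsub>M\<^esub> hcomp M s y" "A \<union> B"])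
      (auto intro: piece_add hcomp_piece)
qed

end

lemma linear_map_finsum:
  assumes M: "abelian_group M" and N: "abelian_group N"
    and f: "f \<in> linear_maps R M N" and A: "finite A" "\<And>i. i \<in> A \<Longrightarrow> c i \<in> carrier M"
    and zero: "f \<zero>\<^bsub>M\<^esub> = \<zero>\<^bsub>N\<^esub>"
  shows "f (\<Oplus>\<^bsub>M\<^esub>i\<in>A. c i) = (\<Oplus>\<^bsub>N\<^esub>i\<in>A. f (c i))"
proof -
  interpret M: abelian_group M by (rule M)
  interpret N: abelian_group N by (rule N)
  have fc: "f x \<in> carrier N" if "x \<in> carrier M" for x
    using f that by (auto simp: linear_maps_def)
  show ?thesis
    using A
  proof (induction A)
    case empty
    then show ?case by (simp add: zero)
  next
    case (insert i A)
    then have "(\<Oplus>\<^bsub>M\<^esub>i\<in>insert i A. c i) = c i \<oplus>\<^bsub>M\<^esub> (\<Oplus>\<^bsub>M\<^esub>i\<in>A. c i)"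
      by (intro M.finsum_insert) auto
    moreover have "(\<Oplus>\<^bsub>M\<^esub>i\<in>A. c i) \<in> carrier M"
      using insert by (intro M.finsum_closed) auto
    ultimately show ?case
      using insert f fc by (simp add: linear_maps_def N.finsum_insert)
  qed
qed

locale gr_map =
  M: gr_module R M + N: gr_module R N
  for R :: "('r, 'm) ring_scheme" and M :: "('r, 'a, 'n) graded_module_scheme"
    and N :: "('r, 'b, 'k) graded_module_scheme" +
  fixes d :: int and f
  assumes graded_map: "f \<in> graded_maps R d M N"
begin

lemma linear: "f \<in> linear_maps R M N"
  using graded_map by (simp add: graded_maps_def)

lemma closed: "x \<in> carrier M \<Longrightarrow> f x \<in> carrier N"
  using linear by (auto simp: linear_maps_def)

lemma map_add: "x \<in> carrier M \<Longrightarrow> y \<in> carrier M \<Longrightarrow> f (x \<oplus>\<^bsub>M\<^esub> y) = f x \<oplus>\<^bsub>N\<^esub> f y"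
  using linear by (auto simp: linear_maps_def)

lemma map_smult: "r \<in> carrier R \<Longrightarrow> x \<in> carrier M \<Longrightarrow> f (r \<odot>\<^bsub>M\<^esub> x) = r \<odot>\<^bsub>N\<^esub> f x"
  using linear by (auto simp: linear_maps_def)

lemma map_piece: "x \<in> piece M s \<Longrightarrow> f x \<in> piece N (s + d)"
  using graded_map by (auto simp: graded_maps_def)

lemma map_zero: "f \<zero>\<^bsub>M\<^esub> = \<zero>\<^bsub>N\<^esub>"
  using map_add[of "\<zero>\<^bsub>M\<^esub>" "\<zero>\<^bsub>M\<^esub>"] closed[of "\<zero>\<^bsub>M\<^esub>"] by simp

lemma map_neg: "x \<in> carrier M \<Longrightarrow> f (\<ominus>\<^bsub>M\<^esub> x) = \<ominus>\<^bsub>N\<^esub> f x"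
  using map_add[of "\<ominus>\<^bsub>M\<^esub> x" x] map_zero closed
  by (intro N.minus_equality[symmetric]) (auto simp: M.l_neg)

text \<open>Applied term by term, \<open>f\<close> turns the decomposition of \<open>x\<close> into
  one of \<open>f x\<close> whose index set is moved by \<open>d\<close>; uniqueness identifies the
  components.\<close>

lemma hcomp_map:
  assumes x: "x \<in> carrier M"
  shows "hcomp N (s + d) (f x) = f (hcomp M s x)"
proof -
  obtain A where A: "finite A" "\<And>s. s \<notin> A \<Longrightarrow> hcomp M s x = \<zero>\<^bsub>M\<^esub>"
    "x = (\<Oplus>\<^bsub>M\<^esub>s\<in>A. hcomp M s x)"
    using M.hcomp_decomp[OF x] by metis
  have "f x = f (\<Oplus>\<^bsub>M\<^esub>s\<in>A. hcomp M s x)"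
    using A(3) by simp
  also have "\<dots> = (\<Oplus>\<^bsub>N\<^esub>s\<in>A. f (hcomp M s x))"
    using M.abelian_group_axioms N.abelian_group_axioms linear A(1) M.hcomp_closed[OF x] map_zero
    by (rule linear_map_finsum)
  also have "\<dots> = (\<Oplus>\<^bsub>N\<^esub>t\<in>(\<lambda>s. s + d) ` A. f (hcomp M (t - d) x))"
    using M.hcomp_closed[OF x] closed by (subst N.add.finprod_reindex) auto
  finally have eq: "f x = (\<Oplus>\<^bsub>N\<^esub>t\<in>(\<lambda>s. s + d) ` A. f (hcomp M (t - d) x))" .
  have "hcomp N (s + d) (f x) = f (hcomp M (s + d - d) x)"
  proof (rule N.hcomp_eqI[OF _ _ _ eq])
    fix t
    show "f (hcomp M (t - d) x) \<in> piece N t"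
      using map_piece[OF M.hcomp_piece[OF x], of "t - d"] by simp
    show "finite ((\<lambda>s. s + d) ` A)"
      using A(1) by simp
    assume "t \<notin> (\<lambda>s. s + d) ` A"
    then have "t - d \<notin> A" by (metis diff_add_cancel image_eqI)
    then show "f (hcomp M (t - d) x) = \<zero>\<^bsub>N\<^esub>"
      using A(2) map_zero by simp
  qed
  then show ?thesis by simp
qed

end

section \<open>Homology classes of a single complex\<close>

locale cx =
  fixes R :: "('r, 'm) ring_scheme" and C :: "('r, 'a, 'n) graded_complex_scheme"
  assumes complex: "is_complex R C"
begin

sublocale gr_module R C
  using complex by unfold_locales (simp add: is_complex_def)

sublocale cobd: gr_map R C C 1 "cobd C"
  using complex by unfold_locales (simp add: is_complex_def)

lemma cobd_cobd: "x \<in> carrier C \<Longrightarrow> cobd C (cobd C x) = \<zero>\<^bsub>C\<^esub>"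
  using complex by (simp add: is_complex_def)

lemma mem_cycles: "z \<in> cycles C \<longleftrightarrow> z \<in> carrier C \<and> cobd C z = \<zero>\<^bsub>C\<^esub>"
  by (auto simp: cycles_def a_kernel_def')

lemma mem_hclass: "x \<in> hclass C z \<longleftrightarrow> (\<exists>y\<in>carrier C. x = cobd C y \<oplus>\<^bsub>C\<^esub> z)"
  by (auto simp: hclass_def a_r_coset_def')

lemma hclass_eqI:
  assumes z: "z \<in> carrier C" and y: "y \<in> carrier C" and x: "x = cobd C y \<oplus>\<^bsub>C\<^esub> z"
  shows "hclass C x = hclass C z"
proof (rule Set.set_eqI)
  fix w
  show "w \<in> hclass C x \<longleftrightarrow> w \<in> hclass C z"
  proof
    assume "w \<in> hclass C x"
    then obtain u where u: "u \<in> carrier C" "w = cobd C u \<oplus>\<^bsub>C\<^esub> x"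
      by (auto simp: mem_hclass)
    then have "w = cobd C (u \<oplus>\<^bsub>C\<^esub> y) \<oplus>\<^bsub>C\<^esub> z"
      using assms by (simp add: cobd.map_add cobd.closed a_assoc)
    then show "w \<in> hclass C z"
      using u y unfolding mem_hclass by blast
  next
    assume "w \<in> hclass C z"
    then obtain u where u: "u \<in> carrier C" "w = cobd C u \<oplus>\<^bsub>C\<^esub> z"
      by (auto simp: mem_hclass)
    then have "w = cobd C (u \<oplus>\<^bsub>C\<^esub> \<ominus>\<^bsub>C\<^esub> y) \<oplus>\<^bsub>C\<^esub> x"
      using assms
      by (simp add: cobd.map_add cobd.closed cobd.map_neg a_assoc r_neg1)
    then show "w \<in> hclass C x"
      using u y unfolding mem_hclass by blast
  qed
qed

lemma hclass_self: "z \<in> carrier C \<Longrightarrow> z \<in> hclass C z"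
  unfolding mem_hclass by (rule bexI[of _ "\<zero>\<^bsub>C\<^esub>"]) (simp_all add: cobd.map_zero)

lemma hclass_eq_iff:
  assumes "x \<in> carrier C" "z \<in> carrier C"
  shows "hclass C x = hclass C z \<longleftrightarrow> (\<exists>y\<in>carrier C. x = cobd C y \<oplus>\<^bsub>C\<^esub> z)"
  using assms hclass_self hclass_eqI mem_hclass by metis

lemma hclass_eq_zero_iff:
  assumes "x \<in> carrier C"
  shows "hclass C x = hclass C \<zero>\<^bsub>C\<^esub> \<longleftrightarrow> (\<exists>y\<in>carrier C. x = cobd C y)"
  using assms by (subst hclass_eq_iff) (auto simp: cobd.closed)

lemma hclass_add:
  assumes z: "z \<in> carrier C" and w: "w \<in> carrier C"
  shows "set_add C (hclass C z) (hclass C w) = hclass C (z \<oplus>\<^bsub>C\<^esub> w)"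
proof (rule Set.set_eqI)
  fix x
  show "x \<in> set_add C (hclass C z) (hclass C w) \<longleftrightarrow> x \<in> hclass C (z \<oplus>\<^bsub>C\<^esub> w)"
  proof
    assume "x \<in> set_add C (hclass C z) (hclass C w)"
    then obtain a b where ab: "a \<in> carrier C" "b \<in> carrier C"
      "x = (cobd C a \<oplus>\<^bsub>C\<^esub> z) \<oplus>\<^bsub>C\<^esub> (cobd C b \<oplus>\<^bsub>C\<^esub> w)"
      by (auto simp: set_add_def' mem_hclass)
    then have "x = cobd C (a \<oplus>\<^bsub>C\<^esub> b) \<oplus>\<^bsub>C\<^esub> (z \<oplus>\<^bsub>C\<^esub> w)"
      using z w by (simp add: cobd.map_add cobd.closed a_ac)
    then show "x \<in> hclass C (z \<oplus>\<^bsub>C\<^esub> w)"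
      using ab unfolding mem_hclass by blast
  next
    assume "x \<in> hclass C (z \<oplus>\<^bsub>C\<^esub> w)"
    then obtain a where a: "a \<in> carrier C" "x = cobd C a \<oplus>\<^bsub>C\<^esub> (z \<oplus>\<^bsub>C\<^esub> w)"
      by (auto simp: mem_hclass)
    then have "x = (cobd C a \<oplus>\<^bsub>C\<^esub> z) \<oplus>\<^bsub>C\<^esub> w"
      using z w by (simp add: cobd.closed a_ac)
    moreover have "cobd C a \<oplus>\<^bsub>C\<^esub> z \<in> hclass C z"
      using a unfolding mem_hclass by blast
    ultimately show "x \<in> set_add C (hclass C z) (hclass C w)"
      using hclass_self[OF w] unfolding set_add_def' by blast
  qed
qed

text \<open>Scalar multiplication and induced maps on homology are encoded as unions over all
  representatives. The union collapses once its members agree, so only independence of the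
  representative remains to be checked.\<close>

lemma UN_hclass:
  assumes "z \<in> carrier C" and "\<And>w. w \<in> hclass C z \<Longrightarrow> F w = F z"
  shows "(\<Union>w\<in>hclass C z. F w) = F z"
  using assms hclass_self by blast

lemma homology_smult:
  assumes r: "r \<in> carrier R" and z: "z \<in> carrier C"
  shows "r \<odot>\<^bsub>homology C\<^esub> hclass C z = hclass C (r \<odot>\<^bsub>C\<^esub> z)"
proof -
  have "hclass C (r \<odot>\<^bsub>C\<^esub> w) = hclass C (r \<odot>\<^bsub>C\<^esub> z)" if w: "w \<in> hclass C z" for w
  proof -
    obtain y where y: "y \<in> carrier C" "w = cobd C y \<oplus>\<^bsub>C\<^esub> z"
      using w by (auto simp: mem_hclass)
    then have "r \<odot>\<^bsub>C\<^esub> w = cobd C (r \<odot>\<^bsub>C\<^esub> y) \<oplus>\<^bsub>C\<^esub> r \<odot>\<^bsub>C\<^esub> z"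
      using r z by (simp add: smult_r_distr cobd.closed cobd.map_smult)
    then show ?thesis
      using r y z by (intro hclass_eqI[of _ "r \<odot>\<^bsub>C\<^esub> y"]) auto
  qed
  then show ?thesis
    using UN_hclass[OF z, of "\<lambda>w. hclass C (r \<odot>\<^bsub>C\<^esub> w)"] by (simp add: homology_def)
qed

lemma homology_add:
  "z \<in> carrier C \<Longrightarrow> w \<in> carrier C \<Longrightarrow>
    hclass C z \<oplus>\<^bsub>homology C\<^esub> hclass C w = hclass C (z \<oplus>\<^bsub>C\<^esub> w)"
  by (simp add: homology_def hclass_add)

lemma carrier_homology: "carrier (homology C) = hclass C ` cycles C"
  by (simp add: homology_def)

lemma piece_homology: "piece (homology C) s = hclass C ` (cycles C \<inter> piece C s)"
  by (simp add: homology_def)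

lemma zero_homology: "\<zero>\<^bsub>homology C\<^esub> = hclass C \<zero>\<^bsub>C\<^esub>"
  by (simp add: homology_def)

lemma cycle_closed: "z \<in> cycles C \<Longrightarrow> z \<in> carrier C"
  by (simp add: mem_cycles)

lemma cycle_add: "z \<in> cycles C \<Longrightarrow> w \<in> cycles C \<Longrightarrow> z \<oplus>\<^bsub>C\<^esub> w \<in> cycles C"
  by (simp add: mem_cycles cobd.map_add)

lemma cycle_smult: "r \<in> carrier R \<Longrightarrow> z \<in> cycles C \<Longrightarrow> r \<odot>\<^bsub>C\<^esub> z \<in> cycles C"
  by (simp add: mem_cycles cobd.map_smult)

lemma hcomp_cobd: "x \<in> carrier C \<Longrightarrow> hcomp C s (cobd C x) = cobd C (hcomp C (s - 1) x)"
  using cobd.hcomp_map[of x "s - 1"] by simp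

lemma hcomp_zero: "hcomp C s \<zero>\<^bsub>C\<^esub> = \<zero>\<^bsub>C\<^esub>"
  using piece_zero hcomp_of_piece by blast

lemma hcomp_cycle: "z \<in> cycles C \<Longrightarrow> hcomp C s z \<in> cycles C \<inter> piece C s"
  using hcomp_cobd[of z "s + 1"] by (simp add: mem_cycles hcomp_zero hcomp_closed hcomp_piece)

text \<open>Projecting \<open>x = cobd C y \<oplus> z\<close> to degree \<open>s\<close> keeps
  \<open>z\<close> and replaces \<open>y\<close> by its component of degree \<open>s - 1\<close>, so
  the class survives.\<close>

lemma hclass_hcomp:
  assumes x: "x \<in> carrier C" and z: "z \<in> piece C s" and eq: "hclass C x = hclass C z"
  shows "hclass C (hcomp C s x) = hclass C z"
proof -
  have zc: "z \<in> carrier C" using z by (rule piece_carrier)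
  obtain y where y: "y \<in> carrier C" "x = cobd C y \<oplus>\<^bsub>C\<^esub> z"
    using eq x zc by (auto simp: hclass_eq_iff)
  then have "hcomp C s x = cobd C (hcomp C (s - 1) y) \<oplus>\<^bsub>C\<^esub> z"
    using z zc by (simp add: hcomp_add cobd.closed hcomp_cobd hcomp_of_piece)
  then show ?thesis
    using y zc hcomp_closed hclass_eqI by blast
qed

end

section \<open>Maps induced by cochain maps\<close>

locale cx_map =
  C: cx R C + D: cx R D
  for R :: "('r, 'm) ring_scheme" and C :: "('r, 'a, 'n) graded_complex_scheme"
    and D :: "('r, 'b, 'k) graded_complex_scheme" +
  fixes f
  assumes cochain_map: "f \<in> cochain_maps R C D"
begin

sublocale gr_map R C D 0 f
  using cochain_map by unfold_locales (simp add: cochain_maps_def)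

lemma map_cobd: "x \<in> carrier C \<Longrightarrow> f (cobd C x) = cobd D (f x)"
  using cochain_map by (simp add: cochain_maps_def)

lemma map_cycle: "z \<in> cycles C \<Longrightarrow> f z \<in> cycles D"
  using map_cobd[of z] by (simp add: C.mem_cycles D.mem_cycles closed map_zero)

lemma map_hcomp: "x \<in> carrier C \<Longrightarrow> hcomp D s (f x) = f (hcomp C s x)"
  using hcomp_map[of x s] by simp

lemma induced_hclass:
  assumes z: "z \<in> carrier C"
  shows "induced_map D f (hclass C z) = hclass D (f z)"
proof -
  have "hclass D (f w) = hclass D (f z)" if w: "w \<in> hclass C z" for w
  proof -
    obtain y where y: "y \<in> carrier C" "w = cobd C y \<oplus>\<^bsub>C\<^esub> z"
      using w by (auto simp: C.mem_hclass)
    then have "f w = cobd D (f y) \<oplus>\<^bsub>D\<^esub> f z"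
      using z by (simp add: map_add C.cobd.closed map_cobd)
    then show ?thesis
      using y z closed by (intro D.hclass_eqI[of _ "f y"]) auto
  qed
  then show ?thesis
    using C.UN_hclass[OF z, of "\<lambda>w. hclass D (f w)"] by (simp add: induced_map_def)
qed

lemma induced_graded: "induced_map D f \<in> graded_maps R 0 (homology C) (homology D)"
proof -
  have "induced_map D f (x \<oplus>\<^bsub>homology C\<^esub> y)
      = induced_map D f x \<oplus>\<^bsub>homology D\<^esub> induced_map D f y"
    if "x \<in> carrier (homology C)" "y \<in> carrier (homology C)" for x y
    using that by (auto simp: C.carrier_homology C.homology_add D.homology_add
        induced_hclass C.cycle_closed map_add closed)
  moreover have "induced_map D f (r \<odot>\<^bsub>homology C\<^esub> x) = r \<odot>\<^bsub>homology D\<^esub> induced_map D f x"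
    if "r \<in> carrier R" "x \<in> carrier (homology C)" for r x
    using that by (auto simp: C.carrier_homology C.homology_smult D.homology_smult
        induced_hclass C.cycle_closed map_smult closed)
  ultimately show ?thesis
    using map_piece
    by (force simp: graded_maps_def linear_maps_def C.carrier_homology D.carrier_homology
        C.piece_homology D.piece_homology induced_hclass C.cycle_closed
        intro!: imageI map_cycle)
qed

text \<open>Degreewise exactness costs nothing beyond ungraded exactness: if a cycle of mixed degree
  maps to a homogeneous class, its component of that degree maps to the same class.\<close>

lemma induced_piece_exact:
  assumes "induced_map D f ` carrier (homology C) = K" and "K \<subseteq> carrier (homology D)"
  shows "induced_map D f ` piece (homology C) s = K \<inter> piece (homology D) s"
proof
  show "induced_map D f ` piece (homology C) s \<subseteq> K \<inter> piece (homology D) s"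
    using assms induced_graded
    by (fastforce simp: graded_maps_def C.carrier_homology C.piece_homology)
  show "K \<inter> piece (homology D) s \<subseteq> induced_map D f ` piece (homology C) s"
  proof
    fix c assume "c \<in> K \<inter> piece (homology D) s"
    then obtain x z where x: "x \<in> cycles C" "c = induced_map D f (hclass C x)"
      and z: "z \<in> cycles D" "z \<in> piece D s" "c = hclass D z"
      using assms(1) by (auto simp: C.carrier_homology D.piece_homology)
    have xc: "x \<in> carrier C"
      using x C.cycle_closed by blast
    have "hclass D (f x) = hclass D z"
      using x z xc by (simp add: induced_hclass)
    then have "hclass D (hcomp D s (f x)) = hclass D z"
      using D.hclass_hcomp z xc closed by blast
    then have "c = induced_map D f (hclass C (hcomp C s x))"
      using z xc by (simp add: induced_hclass map_hcomp C.hcomp_closed)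
    then show "c \<in> induced_map D f ` piece (homology C) s"
      using C.hcomp_cycle[OF x(1)] by (auto simp: C.piece_homology)
  qed
qed

end

section \<open>The snake lemma and the exact triangle\<close>

locale ses =
  f: cx_map R C D f + g: cx_map R D E g
  for R :: "('r, 'm) ring_scheme" and C :: "('r, 'a, 'n) graded_complex_scheme"
    and D :: "('r, 'b, 'k) graded_complex_scheme" and E :: "('r, 'c, 'l) graded_complex_scheme"
    and f g +
  assumes inj: "inj_on f (carrier C)" and ker: "f ` carrier C = a_kernel D E g"
    and surj: "g ` carrier D = carrier E"
begin

lemma g_zero_iff: "y \<in> carrier D \<Longrightarrow> g y = \<zero>\<^bsub>E\<^esub> \<longleftrightarrow> (\<exists>x\<in>carrier C. f x = y)"
  using arg_cong[OF ker, of "\<lambda>X. y \<in> X"] by (auto simp: a_kernel_def')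

lemma g_f: "x \<in> carrier C \<Longrightarrow> g (f x) = \<zero>\<^bsub>E\<^esub>"
  using g_zero_iff f.closed by blast

text \<open>\<open>snake z x\<close>: the class of \<open>x\<close> is the image of the class of \<open>z\<close> under the connecting map.\<close>

definition snake :: "'c \<Rightarrow> 'a \<Rightarrow> bool" where
  "snake z x \<longleftrightarrow> z \<in> cycles E \<and> x \<in> carrier C \<and> (\<exists>y\<in>carrier D. g y = z \<and> f x = cobd D y)"

lemma ex_snake:
  assumes "z \<in> cycles E"
  shows "\<exists>x. snake z x"
proof -
  have z: "z \<in> carrier E" "cobd E z = \<zero>\<^bsub>E\<^esub>"
    using assms by (auto simp: g.D.mem_cycles)
  obtain y where y: "y \<in> carrier D" "g y = z"
    using surj z by (metis imageE)
  then have "g (cobd D y) = \<zero>\<^bsub>E\<^esub>"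
    using z by (simp add: g.map_cobd)
  then show ?thesis
    using y assms g_zero_iff[of "cobd D y"] f.D.cobd.closed unfolding snake_def by blast
qed

lemma snake_cycle:
  assumes "snake z x"
  shows "x \<in> cycles C"
proof -
  obtain y where x: "x \<in> carrier C" and y: "y \<in> carrier D" "f x = cobd D y"
    using assms by (auto simp: snake_def)
  have "f (cobd C x) = f \<zero>\<^bsub>C\<^esub>"
    using x y by (simp add: f.map_cobd f.D.cobd_cobd f.map_zero)
  then show ?thesis
    using inj x by (auto simp: f.C.mem_cycles f.C.cobd.closed dest: inj_onD)
qed

lemma snake_add:
  assumes "snake z x" "snake z' x'"
  shows "snake (z \<oplus>\<^bsub>E\<^esub> z') (x \<oplus>\<^bsub>C\<^esub> x')"
proof -
  obtain y y' where "y \<in> carrier D" "g y = z" "f x = cobd D y"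
    "y' \<in> carrier D" "g y' = z'" "f x' = cobd D y'"
    using assms by (auto simp: snake_def)
  then show ?thesis
    using assms unfolding snake_def
    by (auto intro!: bexI[of _ "y \<oplus>\<^bsub>D\<^esub> y'"]
        simp: g.map_add f.map_add f.D.cobd.map_add g.D.cycle_add)
qed

lemma snake_smult:
  assumes "snake z x" "r \<in> carrier R"
  shows "snake (r \<odot>\<^bsub>E\<^esub> z) (r \<odot>\<^bsub>C\<^esub> x)"
proof -
  obtain y where "y \<in> carrier D" "g y = z" "f x = cobd D y"
    using assms by (auto simp: snake_def)
  then show ?thesis
    using assms unfolding snake_def
    by (auto intro!: bexI[of _ "r \<odot>\<^bsub>D\<^esub> y"]
        simp: g.map_smult f.map_smult f.D.cobd.map_smult g.D.cycle_smult)
qed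

text \<open>Projections commute with \<open>f\<close>, \<open>g\<close> and the differential, and
  only the differential moves the degree. Hence the connecting map has degree one.\<close>

lemma snake_hcomp:
  assumes "snake z x"
  shows "snake (hcomp E s z) (hcomp C (s + 1) x)"
proof -
  obtain y where y: "y \<in> carrier D" "g y = z" "f x = cobd D y"
    using assms by (auto simp: snake_def)
  have x: "x \<in> carrier C" and z: "z \<in> cycles E"
    using assms by (auto simp: snake_def)
  have "f (hcomp C (s + 1) x) = cobd D (hcomp D s y)"
    using y x by (simp flip: f.map_hcomp add: f.D.hcomp_cobd)
  moreover have "g (hcomp D s y) = hcomp E s z"
    using y by (simp flip: g.map_hcomp)
  ultimately show ?thesis
    using x y z g.D.hcomp_cycle unfolding snake_def
    by (auto intro!: bexI[of _ "hcomp D s y"] simp: f.C.hcomp_closed f.D.hcomp_closed)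
qed

text \<open>Lifts \<open>y\<close>, \<open>y'\<close> of cohomologous cycles differ by a coboundary
  \<open>cobd D d\<close> and an element \<open>u\<close> of the kernel of \<open>g\<close>. This
  \<open>u\<close> comes from some \<open>a\<close> in \<open>C\<close>, and \<open>cobd C a\<close>
  is the difference of \<open>x\<close> and \<open>x'\<close>.\<close>

lemma snake_well_defined:
  assumes zx: "snake z x" and zx': "snake z' x'" and eq: "hclass E z = hclass E z'"
  shows "hclass C x = hclass C x'"
proof -
  obtain y where y: "y \<in> carrier D" "g y = z" "f x = cobd D y"
    using zx by (auto simp: snake_def)
  obtain y' where y': "y' \<in> carrier D" "g y' = z'" "f x' = cobd D y'"
    using zx' by (auto simp: snake_def)
  have x: "x \<in> carrier C" "x' \<in> carrier C" and z: "z \<in> carrier E" "z' \<in> carrier E"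
    using zx zx' g.D.cycle_closed by (auto simp: snake_def)
  obtain e where e: "e \<in> carrier E" "z = cobd E e \<oplus>\<^bsub>E\<^esub> z'"
    using eq z by (auto simp: g.D.hclass_eq_iff)
  obtain d where d: "d \<in> carrier D" "g d = e"
    using surj e by (metis imageE)
  define u where "u = y \<oplus>\<^bsub>D\<^esub> \<ominus>\<^bsub>D\<^esub> (cobd D d \<oplus>\<^bsub>D\<^esub> y')"
  have u: "u \<in> carrier D"
    using y y' d by (simp add: u_def f.D.cobd.closed)
  have yu: "y = u \<oplus>\<^bsub>D\<^esub> (cobd D d \<oplus>\<^bsub>D\<^esub> y')"
    using y y' d by (simp add: u_def f.D.cobd.closed f.D.a_assoc f.D.l_neg)
  have "g u = \<zero>\<^bsub>E\<^esub>"
    using y y' d e z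
    by (simp add: u_def g.map_add f.D.cobd.closed g.map_neg g.map_cobd g.D.cobd.closed g.D.r_neg)
  then obtain a where a: "a \<in> carrier C" "f a = u"
    using g_zero_iff u by blast
  have "f x = cobd D u \<oplus>\<^bsub>D\<^esub> f x'"
    using y(3) y' u d yu
    by (simp add: f.D.cobd.map_add f.D.cobd.closed f.D.cobd_cobd)
  also have "\<dots> = f (cobd C a \<oplus>\<^bsub>C\<^esub> x')"
    using a x by (simp add: f.map_add f.map_cobd f.C.cobd.closed)
  finally have "x = cobd C a \<oplus>\<^bsub>C\<^esub> x'"
    using inj x a by (auto simp: f.C.cobd.closed dest: inj_onD)
  then show ?thesis
    using x a f.C.hclass_eqI by blast
qed

text \<open>The relation \<open>snake\<close> becomes a map by choosing some related pair;
  \<open>snake_well_defined\<close> makes the outcome independent of the choice. On sets that are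
  not classes of cycles the value is arbitrary.\<close>

definition connecting :: "'c set \<Rightarrow> 'a set" where
  "connecting c = hclass C (SOME x. \<exists>z. c = hclass E z \<and> snake z x)"

lemma connecting_hclass:
  assumes "snake z x"
  shows "connecting (hclass E z) = hclass C x"
proof -
  let ?P = "\<lambda>x. \<exists>z'. hclass E z = hclass E z' \<and> snake z' x"
  have "?P (SOME x. ?P x)"
    using assms by (intro someI[of ?P x]) blast
  then obtain z' where z': "hclass E z = hclass E z'" "snake z' (SOME x. ?P x)"
    by blast
  show ?thesis
    unfolding connecting_def by (rule snake_well_defined[OF z'(2) assms z'(1)[symmetric]])
qed

lemma is_connecting: "is_connecting_map C D E f g connecting"
  unfolding is_connecting_map_def using connecting_hclass by (auto simp: snake_def)

lemma connecting_piece: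
  assumes "z \<in> cycles E" "z \<in> piece E s"
  shows "connecting (hclass E z) \<in> piece (homology C) (s + 1)"
proof -
  obtain x where x: "snake z x" using ex_snake assms by blast
  have "snake z (hcomp C (s + 1) x)"
    using snake_hcomp[OF x, of s] assms by (simp add: g.D.hcomp_of_piece)
  then show ?thesis
    using connecting_hclass f.C.hcomp_cycle[OF snake_cycle[OF x]]
    by (auto simp: f.C.piece_homology)
qed

lemma connecting_graded: "connecting \<in> graded_maps R 1 (homology E) (homology C)"
proof -
  have "connecting c \<in> carrier (homology C)" if "c \<in> carrier (homology E)" for c
    using that ex_snake connecting_hclass snake_cycle
    by (fastforce simp: g.D.carrier_homology f.C.carrier_homology)
  moreover have "connecting (c \<oplus>\<^bsub>homology E\<^esub> c')
      = connecting c \<oplus>\<^bsub>homology C\<^esub> connecting c'"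
    if c: "c \<in> carrier (homology E)" "c' \<in> carrier (homology E)" for c c'
  proof -
    obtain z z' where z: "z \<in> cycles E" "c = hclass E z" "z' \<in> cycles E" "c' = hclass E z'"
      using c by (auto simp: g.D.carrier_homology)
    obtain x x' where x: "snake z x" "snake z' x'"
      using ex_snake z by blast
    show ?thesis
      using z x snake_add[OF x] snake_cycle
      by (simp add: g.D.homology_add g.D.cycle_closed connecting_hclass f.C.homology_add
          f.C.cycle_closed)
  qed
  moreover have "connecting (r \<odot>\<^bsub>homology E\<^esub> c) = r \<odot>\<^bsub>homology C\<^esub> connecting c"
    if c: "r \<in> carrier R" "c \<in> carrier (homology E)" for r c
  proof -
    obtain z where z: "z \<in> cycles E" "c = hclass E z"
      using c by (auto simp: g.D.carrier_homology)
    obtain x where x: "snake z x"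
      using ex_snake z by blast
    show ?thesis
      using z x c snake_smult[OF x] snake_cycle
      by (simp add: g.D.homology_smult g.D.cycle_closed connecting_hclass f.C.homology_smult
          f.C.cycle_closed)
  qed
  ultimately show ?thesis
    using connecting_piece
    by (auto simp: graded_maps_def linear_maps_def g.D.piece_homology)
qed

lemma exact_at_D:
  "induced_map D f ` carrier (homology C) = a_kernel (homology D) (homology E) (induced_map E g)"
proof (intro subset_antisym subsetI)
  fix c assume "c \<in> induced_map D f ` carrier (homology C)"
  then obtain x where x: "x \<in> cycles C" "c = hclass D (f x)"
    by (auto simp: f.C.carrier_homology f.induced_hclass f.C.cycle_closed)
  then have "induced_map E g c = hclass E (g (f x))"
    by (simp add: g.induced_hclass f.closed f.C.cycle_closed)
  then show "c \<in> a_kernel (homology D) (homology E) (induced_map E g)"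
    using x f.map_cycle
    by (auto simp: a_kernel_def' f.D.carrier_homology g.D.zero_homology g_f f.C.cycle_closed)
next
  fix c assume "c \<in> a_kernel (homology D) (homology E) (induced_map E g)"
  then obtain y where y: "y \<in> cycles D" "c = hclass D y"
    and "induced_map E g (hclass D y) = hclass E \<zero>\<^bsub>E\<^esub>"
    by (auto simp: a_kernel_def' f.D.carrier_homology g.D.zero_homology)
  then have yc: "y \<in> carrier D" "cobd D y = \<zero>\<^bsub>D\<^esub>" and "hclass E (g y) = hclass E \<zero>\<^bsub>E\<^esub>"
    by (auto simp: g.induced_hclass f.D.mem_cycles)
  then obtain e where e: "e \<in> carrier E" "g y = cobd E e"
    by (auto simp: g.D.hclass_eq_zero_iff g.closed)
  obtain d where d: "d \<in> carrier D" "g d = e"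
    using surj e by (metis imageE)
  \<comment> \<open>The class of \<open>g y\<close> vanishes only up to a coboundary; subtracting
    the coboundary of a lift makes the image zero on the nose without changing the class of
    \<open>y\<close>.\<close>
  define u where "u = cobd D (\<ominus>\<^bsub>D\<^esub> d) \<oplus>\<^bsub>D\<^esub> y"
  have u: "u \<in> carrier D"
    using yc d by (simp add: u_def f.D.cobd.closed)
  have "g u = \<zero>\<^bsub>E\<^esub>"
    using yc d e
    by (simp add: u_def g.map_add f.D.cobd.closed g.map_neg g.map_cobd g.D.cobd.map_neg
        g.D.cobd.closed g.D.l_neg)
  then obtain x where x: "x \<in> carrier C" "f x = u"
    using g_zero_iff u by blast
  have "cobd D u = \<zero>\<^bsub>D\<^esub>"
    using yc d by (simp add: u_def f.D.cobd.map_add f.D.cobd.closed f.D.cobd_cobd)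
  then have "f (cobd C x) = f \<zero>\<^bsub>C\<^esub>"
    using x by (simp add: f.map_cobd f.map_zero)
  then have "x \<in> cycles C"
    using inj x by (auto simp: f.C.mem_cycles f.C.cobd.closed dest: inj_onD)
  then have "hclass C x \<in> carrier (homology C)"
    by (simp add: f.C.carrier_homology)
  moreover have "hclass D u = hclass D y"
    using yc d by (intro f.D.hclass_eqI[of _ "\<ominus>\<^bsub>D\<^esub> d"]) (auto simp: u_def)
  then have "c = induced_map D f (hclass C x)"
    using x y(2) by (simp add: f.induced_hclass)
  ultimately show "c \<in> induced_map D f ` carrier (homology C)"
    by (rule rev_image_eqI)
qed

lemma exact_at_E:
  "induced_map E g ` carrier (homology D) = a_kernel (homology E) (homology C) connecting"
proof (intro subset_antisym subsetI)
  fix c assume "c \<in> induced_map E g ` carrier (homology D)"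
  then obtain y where y: "y \<in> cycles D" "c = hclass E (g y)"
    by (auto simp: f.D.carrier_homology g.induced_hclass f.D.cycle_closed)
  have "snake (g y) \<zero>\<^bsub>C\<^esub>"
    using y g.map_cycle unfolding snake_def by (auto simp: f.D.mem_cycles f.map_zero)
  then show "c \<in> a_kernel (homology E) (homology C) connecting"
    using y g.map_cycle
    by (auto simp: a_kernel_def' g.D.carrier_homology f.C.zero_homology connecting_hclass)
next
  fix c assume "c \<in> a_kernel (homology E) (homology C) connecting"
  then obtain z where z: "z \<in> cycles E" "c = hclass E z"
    and con: "connecting (hclass E z) = hclass C \<zero>\<^bsub>C\<^esub>"
    by (auto simp: a_kernel_def' g.D.carrier_homology f.C.zero_homology)
  obtain x where "snake z x"
    using ex_snake z by blast
  moreover from this obtain y where y: "y \<in> carrier D" "g y = z" "f x = cobd D y"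
    by (auto simp: snake_def)
  ultimately have x: "x \<in> carrier C" and "hclass C x = hclass C \<zero>\<^bsub>C\<^esub>"
    using con connecting_hclass by (auto simp: snake_def)
  then obtain a where a: "a \<in> carrier C" "x = cobd C a"
    by (auto simp: f.C.hclass_eq_zero_iff)
  \<comment> \<open>Removing \<open>f a\<close> turns the lift \<open>y\<close> into a cycle and
    leaves its image under \<open>g\<close> untouched.\<close>
  define u where "u = y \<oplus>\<^bsub>D\<^esub> \<ominus>\<^bsub>D\<^esub> f a"
  have u: "u \<in> carrier D"
    using y a by (simp add: u_def f.closed)
  have "cobd D u = \<zero>\<^bsub>D\<^esub>"
    using y a
    by (simp add: u_def f.D.cobd.map_add f.D.cobd.map_neg f.closed f.map_cobd f.D.r_neg
        f.D.cobd.closed flip: y(3))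
  then have "u \<in> cycles D"
    using u by (simp add: f.D.mem_cycles)
  moreover have "g u = z"
    using y a z g.D.cycle_closed
    by (simp add: u_def g.map_add g.map_neg f.closed g_f g.D.add.inv_one)
  ultimately have "hclass D u \<in> carrier (homology D)" "c = induced_map E g (hclass D u)"
    using z(2) u by (simp_all add: f.D.carrier_homology g.induced_hclass)
  then show "c \<in> induced_map E g ` carrier (homology D)"
    by (rule rev_image_eqI)
qed

lemma exact_at_C:
  "connecting ` carrier (homology E) = a_kernel (homology C) (homology D) (induced_map D f)"
proof (intro subset_antisym subsetI)
  fix c assume "c \<in> connecting ` carrier (homology E)"
  then obtain z where z: "z \<in> cycles E" "c = connecting (hclass E z)"
    by (auto simp: g.D.carrier_homology)
  obtain x where x: "snake z x"
    using ex_snake z by blast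
  then obtain y where y: "y \<in> carrier D" "f x = cobd D y"
    by (auto simp: snake_def)
  have "hclass D (f x) = hclass D \<zero>\<^bsub>D\<^esub>"
    using y by (subst f.D.hclass_eq_zero_iff) (auto simp: f.D.cobd.closed)
  then show "c \<in> a_kernel (homology C) (homology D) (induced_map D f)"
    using z x snake_cycle[OF x]
    by (auto simp: a_kernel_def' f.C.carrier_homology f.D.zero_homology connecting_hclass
        f.induced_hclass f.C.cycle_closed)
next
  fix c assume "c \<in> a_kernel (homology C) (homology D) (induced_map D f)"
  then obtain x where x: "x \<in> cycles C" "c = hclass C x"
    and ind: "induced_map D f (hclass C x) = hclass D \<zero>\<^bsub>D\<^esub>"
    by (auto simp: a_kernel_def' f.C.carrier_homology f.D.zero_homology)
  have xc: "x \<in> carrier C"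
    using x f.C.cycle_closed by blast
  then obtain y where y: "y \<in> carrier D" "f x = cobd D y"
    using ind by (auto simp: f.induced_hclass f.D.hclass_eq_zero_iff f.closed)
  have "cobd E (g y) = \<zero>\<^bsub>E\<^esub>"
    using y xc by (simp add: g_f flip: g.map_cobd y(2))
  then have "snake (g y) x"
    using y xc unfolding snake_def by (auto simp: g.D.mem_cycles g.closed)
  then have "hclass E (g y) \<in> carrier (homology E)" "c = connecting (hclass E (g y))"
    using x(2) connecting_hclass[of "g y" x] by (simp_all add: g.D.carrier_homology snake_def)
  then show "c \<in> connecting ` carrier (homology E)"
    by (rule rev_image_eqI)
qed

text \<open>The connecting map is not induced by a cochain map, so
  \<open>induced_piece_exact\<close> does not cover it; \<open>snake_hcomp\<close> supplies the
  projection instead.\<close>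

lemma exact_piece_C:
  "connecting ` piece (homology E) s =
    a_kernel (homology C) (homology D) (induced_map D f) \<inter> piece (homology C) (s + 1)"
proof
  show "connecting ` piece (homology E) s \<subseteq>
    a_kernel (homology C) (homology D) (induced_map D f) \<inter> piece (homology C) (s + 1)"
    using connecting_piece
    by (auto simp: g.D.piece_homology g.D.carrier_homology simp flip: exact_at_C)
next
  show "a_kernel (homology C) (homology D) (induced_map D f) \<inter> piece (homology C) (s + 1)
    \<subseteq> connecting ` piece (homology E) s"
  proof
    fix c
    assume "c \<in> a_kernel (homology C) (homology D) (induced_map D f) \<inter> piece (homology C) (s + 1)"
    then obtain z w where z: "z \<in> cycles E" "c = connecting (hclass E z)"
      and w: "w \<in> piece C (s + 1)" "c = hclass C w"
      by (auto simp: f.C.piece_homology g.D.carrier_homology simp flip: exact_at_C)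
    obtain x where x: "snake z x"
      using ex_snake z by blast
    have "hclass C (hcomp C (s + 1) x) = hclass C w"
      using z w x connecting_hclass[OF x] by (intro f.C.hclass_hcomp) (auto simp: snake_def)
    then have "c = connecting (hclass E (hcomp E s z))"
      using w connecting_hclass[OF snake_hcomp[OF x]] by simp
    then show "c \<in> connecting ` piece (homology E) s"
      using g.D.hcomp_cycle[OF z(1)] by (auto simp: g.D.piece_homology)
  qed
qed

lemma triangle:
  "exact_triangle R (homology C) (homology D) (homology E)
     (induced_map D f) (induced_map E g) connecting"
  unfolding exact_triangle_def
  by (intro conjI allI f.induced_graded g.induced_graded connecting_graded exact_at_C exact_at_D
      exact_at_E exact_piece_C f.induced_piece_exact g.induced_piece_exact)
    (auto simp: a_kernel_def')

end

lemma long_exact_sequence: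
  assumes "short_exact_complexes R C D E f g"
  shows "\<exists>h. is_connecting_map C D E f g h \<and>
    exact_triangle R (homology C) (homology D) (homology E) (induced_map D f) (induced_map E g) h"
proof -
  interpret ses R C D E f g
    using assms by unfold_locales (auto simp: short_exact_complexes_def)
  show ?thesis
    using is_connecting triangle by blast
qed

section \<open>The tower\<close>

lemma tower_smult_add: "tower_smult r (x + y) = tower_smult r x + tower_smult r y"
  by transfer (simp add: UFU_0 distrib_left)

lemma tower_smult_add_left: "tower_smult (r + s) x = tower_smult r x + tower_smult s x"
  by transfer (simp add: UFU_0 laurent_of_poly_add distrib_right)

lemma tower_smult_mult: "tower_smult (r * s) x = tower_smult r (tower_smult s x)"
  by transfer (simp add: UFU_0 laurent_of_poly_mult mult.assoc)

lemma tower_smult_one [simp]: "tower_smult 1 x = x"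
proof -
  have "laurent_of_poly 1 = 1"
    using laurent_of_poly_pCons[of 1 0] by (simp add: one_pCons)
  then show ?thesis
    by transfer (simp add: UFU_0)
qed

lemma tower_smult_zero [simp]: "tower_smult r 0 = 0"
  by transfer (simp add: UFU_0)

lemma tower_double [simp]: "x + x = (0 :: tower)"
proof transfer
  fix x :: laurent
  have "a + a = 0" for a :: bit
    by (cases a) simp_all
  then have "x + x = 0"
    by (intro poly_mapping_eqI) (simp only: lookup_add lookup_zero)
  then show "x + x - 0 \<in> UFU"
    by (simp only: UFU_0 diff_0_right)
qed

lemma tower_neg [simp]: "- x = (x :: tower)"
  by (metis add_eq_0_iff tower_double)

lemma tower_add_eq_0_iff: "x + y = 0 \<longleftrightarrow> x = (y :: tower)"
  by (metis add_eq_0_iff2 tower_neg)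

lemma Upow_add: "Upow n (x + y) = Upow n x + Upow n y"
  by (simp add: Upow_def tower_smult_add)

lemma Upow_zero [simp]: "Upow n 0 = 0"
  by (simp add: Upow_def)

lemma Upow_0 [simp]: "Upow 0 x = x"
  by (simp add: Upow_def monom_0 flip: one_pCons)

lemma Upow_Upow: "Upow m (Upow n x) = Upow (m + n) x"
  by (simp add: Upow_def mult_monom flip: tower_smult_mult)

lemma Upow_smult: "Upow n (tower_smult r x) = tower_smult r (Upow n x)"
  by (simp add: Upow_def mult.commute flip: tower_smult_mult)

lemma Upow_sum: "Upow n (sum f A) = (\<Sum>i\<in>A. Upow n (f i))"
  by (induction A rule: infinite_finite_induct) (auto simp: Upow_add)

lemma Upow_eq_0_mono: "Upow m x = 0 \<Longrightarrow> m \<le> n \<Longrightarrow> Upow n x = 0"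
  using Upow_Upow[of "n - m" m x] by simp

lemma ex_Upow_eq_0: "\<exists>n. Upow n x = 0"
proof (induction x rule: tower.abs_induct)
  case (1 l)
  have "\<exists>n. laurent_of_poly (monom 1 n) * l \<in> UFU"
  proof (induction l rule: update_induct)
    case const
    then show ?case by (simp add: UFU_0)
  next
    case (update f k a)
    then obtain n where n: "laurent_of_poly (monom 1 n) * f \<in> UFU" by blast
    \<comment> \<open>The exponent \<open>k\<close> has to be raised to at least 1, since
      \<open>UFU\<close> starts with \<open>U\<close> and not with the constant 1.\<close>
    define m where "m = nat (1 - k)"
    have upd: "Poly_Mapping.update k a f = f + Poly_Mapping.single k a"
      using update.hyps
      by (intro poly_mapping_eqI)
        (auto simp: lookup_update lookup_add lookup_single when_def in_keys_iff)
    have lm: "laurent_of_poly (monom 1 i) = Poly_Mapping.single (int i) 1" for i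
      by (rule poly_mapping_eqI) (auto simp: lookup_laurent_of_poly lookup_single when_def)
    have "laurent_of_poly ([:0, 1:] * monom a (nat (int m + k) - 1))
        = laurent_of_poly (monom 1 m) * Poly_Mapping.single k a"
      unfolding lm
      by (rule poly_mapping_eqI)
        (auto simp: lookup_laurent_of_poly mult_single lookup_single when_def coeff_pCons m_def
          split: nat.splits)
    then have m: "laurent_of_poly (monom 1 m) * Poly_Mapping.single k a \<in> UFU"
      unfolding UFU_def by (metis (mono_tags, lifting) mem_Collect_eq)
    have "laurent_of_poly (monom 1 (m + n)) * Poly_Mapping.update k a f =
        laurent_of_poly (monom 1 m) * (laurent_of_poly (monom 1 n) * f) +
        laurent_of_poly (monom 1 n) * (laurent_of_poly (monom 1 m) * Poly_Mapping.single k a)"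
      by (simp add: upd lm mult_single algebra_simps flip: mult.assoc)
    then show ?case
      using UFU_add[OF UFU_scale[OF n] UFU_scale[OF m]] by metis
  qed
  then show ?case
    by (simp add: Upow_def tower_smult.abs_eq zero_tower_def tower.abs_eq_iff)
qed

text \<open>\<open>F w u\<close> and \<open>F u w\<close> cancel in characteristic 2. This takes the
  place of sign bookkeeping when the differential is squared.\<close>

lemma sum_symmetric_pairs_tower:
  fixes F :: "'a \<Rightarrow> 'a \<Rightarrow> tower"
  assumes "finite S" and "\<And>u w. u \<in> S \<Longrightarrow> w \<in> S \<Longrightarrow> F u w = F w u"
  shows "(\<Sum>w\<in>S. \<Sum>u\<in>S - {w}. F w u) = 0"
  using assms
proof (induction S)
  case (insert a S)
  have "(\<Sum>u\<in>insert a S - {w}. F w u) = F w a + (\<Sum>u\<in>S - {w}. F w u)" if "w \<in> S" for w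
  proof -
    have "insert a S - {w} = insert a (S - {w})"
      using insert that by auto
    then show ?thesis
      using insert by simp
  qed
  then have "(\<Sum>w\<in>S. \<Sum>u\<in>insert a S - {w}. F w u)
      = (\<Sum>w\<in>S. F w a) + (\<Sum>w\<in>S. \<Sum>u\<in>S - {w}. F w u)"
    by (simp add: sum.distrib)
  moreover have "(\<Sum>u\<in>insert a S - {a}. F a u) = (\<Sum>w\<in>S. F w a)"
    using insert by (intro sum.cong) auto
  ultimately show ?case
    using insert by simp
qed simp

lemma Sum_any_additive:
  fixes f :: "'b::comm_monoid_add \<Rightarrow> 'c::comm_monoid_add"
  assumes add: "\<And>x y. f (x + y) = f x + f y" and zero: "f 0 = 0" and fin: "finite {a. g a \<noteq> 0}"
  shows "f (Sum_any g) = Sum_any (\<lambda>a. f (g a))"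
proof -
  have f_sum: "f (sum g A) = (\<Sum>a\<in>A. f (g a))" for A
    by (induction A rule: infinite_finite_induct) (auto simp: add zero)
  have "Sum_any (\<lambda>a. f (g a)) = (\<Sum>a\<in>{a. g a \<noteq> 0}. f (g a))"
    using fin zero by (intro Sum_any.expand_superset) auto
  then show ?thesis
    by (simp add: f_sum Sum_any.expand_set)
qed

lemma Sum_any_sum:
  assumes "finite A" and "\<And>i. i \<in> A \<Longrightarrow> finite {a. g i a \<noteq> 0}"
  shows "Sum_any (\<lambda>a. \<Sum>i\<in>A. g i a) = (\<Sum>i\<in>A. Sum_any (g i))"
    and "finite {a. (\<Sum>i\<in>A. g i a) \<noteq> 0}"
proof -
  have "Sum_any (\<lambda>a. \<Sum>i\<in>A. g i a) = (\<Sum>i\<in>A. Sum_any (g i)) \<and> finite {a. (\<Sum>i\<in>A. g i a) \<noteq> 0}"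
    using assms
  proof (induction A)
    case (insert i A)
    then have fin: "finite {a. g i a \<noteq> 0}" "finite {a. (\<Sum>i\<in>A. g i a) \<noteq> 0}"
      by auto
    have "finite {a. g i a + (\<Sum>i\<in>A. g i a) \<noteq> 0}"
      by (rule finite_subset[OF _ finite_UnI[OF fin]]) auto
    then show ?case
      using insert fin by (simp add: Sum_any.distrib)
  qed simp
  then show "Sum_any (\<lambda>a. \<Sum>i\<in>A. g i a) = (\<Sum>i\<in>A. Sum_any (g i))"
    and "finite {a. (\<Sum>i\<in>A. g i a) \<noteq> 0}"
    by auto
qed

lemma Sum_any_translate: "Sum_any (\<lambda>i. g (i + c)) = Sum_any g" for c :: int
  by (rule Sum_any.reindex_cong[of "\<lambda>i. i + c", symmetric])
    (auto intro!: bijI injI surjI[of _ "\<lambda>i. i - c"])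

section \<open>The lattice cochain complex\<close>

lemma gram_sym: "gram G u w = gram G w u"
  by (auto simp: gram_def insert_commute)

lemma form_sym: "form G x y = form G y x"
  unfolding form_def by (subst sum.swap) (simp add: gram_sym mult.commute mult.left_commute)

lemma form_add_left: "form G (x + y) z = form G x z + form G y z"
  by (simp add: form_def lookup_add distrib_right sum.distrib)

lemma form_add_right: "form G z (x + y) = form G z x + form G z y"
  using form_add_left form_sym by metis

lemma form_zero [simp]: "form G 0 z = 0" "form G z 0 = 0"
  by (simp_all add: form_def)

lemma lattice_add: "x \<in> lattice G \<Longrightarrow> y \<in> lattice G \<Longrightarrow> x + y \<in> lattice G"
  using Poly_Mapping.keys_add[of x y] by (auto simp: lattice_def)

lemma lattice_zero: "0 \<in> lattice G"
  by (simp add: lattice_def)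

lemma basis_vec_lattice: "w \<in> verts G \<Longrightarrow> basis_vec w \<in> lattice G"
  by (simp add: lattice_def basis_vec_def)

lemma basis_sum_lattice: "T \<subseteq> verts G \<Longrightarrow> basis_sum T \<in> lattice G"
  by (induction T rule: infinite_finite_induct)
    (auto simp: basis_sum_def lattice_zero intro!: lattice_add basis_vec_lattice)

lemma basis_sum_insert:
  "finite T \<Longrightarrow> w \<notin> T \<Longrightarrow> basis_sum (insert w T) = basis_vec w + basis_sum T"
  by (simp add: basis_sum_def)

lemma basis_sum_singleton [simp]: "basis_sum {w} = basis_vec w"
  by (simp add: basis_sum_def)

lemma lookup_basis_vec: "Poly_Mapping.lookup (basis_vec u) w = (if u = w then 1 else 0)"
  by (simp add: basis_vec_def lookup_single when_def)

lemma lookup_basis_sum: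
  "finite T \<Longrightarrow> Poly_Mapping.lookup (basis_sum T) w = (if w \<in> T then 1 else 0)"
  by (simp add: basis_sum_def lookup_sum lookup_basis_vec)

lemma Char_add: "K \<in> Char G \<Longrightarrow> x \<in> lattice G \<Longrightarrow> y \<in> lattice G \<Longrightarrow> K (x + y) = K x + K y"
  by (simp add: Char_def dual_lattice_def)

lemma Char_mod: "K \<in> Char G \<Longrightarrow> x \<in> lattice G \<Longrightarrow> K x mod 2 = form G x x mod 2"
  by (simp add: Char_def)

lemma Char_ext: "K \<in> Char G \<Longrightarrow> K \<in> extensional (lattice G)"
  by (simp add: Char_def dual_lattice_def)

lemma CharI:
  assumes "K \<in> extensional (lattice G)"
    and "\<And>x y. x \<in> lattice G \<Longrightarrow> y \<in> lattice G \<Longrightarrow> K (x + y) = K x + K y"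
    and "\<And>x. x \<in> lattice G \<Longrightarrow> K x mod 2 = form G x x mod 2"
  shows "K \<in> Char G"
  using assms by (simp add: Char_def dual_lattice_def)

lemma Char_eqI:
  "K \<in> Char G \<Longrightarrow> K' \<in> extensional (lattice G) \<Longrightarrow> (\<And>x. x \<in> lattice G \<Longrightarrow> K x = K' x) \<Longrightarrow> K = K'"
  using Char_ext extensionalityI by metis

lemma Char_zero: "K \<in> Char G \<Longrightarrow> K 0 = 0"
  using Char_add[of K G 0 0] lattice_zero by force

lemma shift_apply: "y \<in> lattice G \<Longrightarrow> shift G K x y = K y + 2 * form G x y"
  by (simp add: shift_def)

lemma shift_Char:
  assumes K: "K \<in> Char G"
  shows "shift G K x \<in> Char G"
proof (rule CharI)
  fix y z assume yz: "y \<in> lattice G" "z \<in> lattice G"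
  then show "shift G K x (y + z) = shift G K x y + shift G K x z"
    by (simp add: shift_apply lattice_add Char_add[OF K] form_add_right)
next
  fix y assume "y \<in> lattice G"
  then show "shift G K x y mod 2 = form G y y mod 2"
    using Char_mod[OF K] by (simp add: shift_apply)
qed (simp add: shift_def)

lemma shift_shift: "shift G (shift G K x) y = shift G K (x + y)"
  by (auto simp: shift_def form_add_left restrict_def)

lemma shift_zero: "K \<in> Char G \<Longrightarrow> shift G K 0 = K"
  by (rule Char_eqI[symmetric]) (auto simp: shift_def)

lemma shift_commute: "shift G (shift G K x) y = shift G (shift G K y) x"
  by (simp add: shift_shift add.commute)

lemma qrel_double:
  assumes K: "K \<in> Char G" and T: "T \<subseteq> verts G"
  shows "2 * qrel G K T = - (K (basis_sum T) + form G (basis_sum T) (basis_sum T))"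
proof -
  have "even (K (basis_sum T) + form G (basis_sum T) (basis_sum T))"
    using Char_mod[OF K basis_sum_lattice[OF T]] by presburger
  then show ?thesis
    by (simp add: qrel_def)
qed

text \<open>A change of base point from K to K + 2 E_w: both sides are the same difference of values
  of q. The computation is done after doubling, where the \<open>div\<close> in \<open>qrel\<close>
  is gone.\<close>

lemma qrel_shift:
  assumes K: "K \<in> Char G" and w: "w \<in> verts G" and T: "T \<subseteq> verts G" "finite T" "w \<notin> T"
  shows "qrel G (shift G K (basis_vec w)) T = qrel G K (insert w T) - qrel G K {w}"
proof -
  note lat = basis_sum_lattice[OF T(1)] basis_vec_lattice[OF w]
  have "2 * qrel G (shift G K (basis_vec w)) T = 2 * qrel G K (insert w T) - 2 * qrel G K {w}"
    using qrel_double[OF K, of "insert w T"] qrel_double[OF K, of "{w}"] w T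
      qrel_double[OF shift_Char[OF K] T(1), of "basis_vec w"] lat
      T(2,3) form_sym[of G "basis_sum T" "basis_vec w"]
    by (simp add: shift_apply basis_sum_insert Char_add[OF K] form_add_left form_add_right)
  then show ?thesis by simp
qed

text \<open>This is q(K, S) - q(K). Absolute values of q make no sense for a degenerate form, so
  every move of \<open>K\<close> has to be paid for by a \<open>qrel\<close> term.\<close>

definition qmax :: "('v, 'e) wgraph \<Rightarrow> 'v functional \<Rightarrow> 'v set \<Rightarrow> int" where
  "qmax G K S = Max (qrel G K ` Pow S)"

lemma qdiff_near_eq: "qdiff_near G K S w = qmax G K S - qmax G K (S - {w})"
  by (simp add: qdiff_near_def qmax_def)

text \<open>In this form the exponents along a chain of faces telescope, which is what all later
  comparisons of exponents use.\<close>

lemma qdiff_far_eq: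
  assumes K: "K \<in> Char G" and S: "S \<subseteq> verts G" "finite S" and w: "w \<in> S"
  shows "qdiff_far G K S w =
    qmax G K S - qmax G (shift G K (basis_vec w)) (S - {w}) - qrel G K {w}"
proof -
  let ?K = "shift G K (basis_vec w)"
  have "(\<lambda>T. qrel G K (T \<union> {w})) ` Pow (S - {w}) = (\<lambda>T. qrel G ?K T + qrel G K {w}) ` Pow (S - {w})"
  proof (rule image_cong[OF refl])
    fix T assume "T \<in> Pow (S - {w})"
    then have "T \<subseteq> verts G" "finite T" "w \<notin> T"
      using S by (auto dest: finite_subset)
    then show "qrel G K (T \<union> {w}) = qrel G ?K T + qrel G K {w}"
      using qrel_shift[OF K, of w T] w S by auto
  qed
  moreover have "Max ((\<lambda>T. qrel G ?K T + qrel G K {w}) ` Pow (S - {w}))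
      = qmax G ?K (S - {w}) + qrel G K {w}"
    using S unfolding qmax_def by (intro Max_add_commute) auto
  ultimately show ?thesis
    by (simp add: qdiff_far_def qmax_def)
qed

lemma qdiff_near_nonneg: "finite S \<Longrightarrow> 0 \<le> qdiff_near G K S w"
  unfolding qdiff_near_def by (simp, intro Max_mono image_mono) auto

lemma qdiff_far_nonneg: "finite S \<Longrightarrow> w \<in> S \<Longrightarrow> 0 \<le> qdiff_far G K S w"
  unfolding qdiff_far_def by (simp, intro Max_mono) auto

lemma Upow_nat_Upow_nat:
  "0 \<le> a \<Longrightarrow> 0 \<le> b \<Longrightarrow> Upow (nat a) (Upow (nat b) x) = Upow (nat (a + b)) x"
  by (simp add: Upow_Upow nat_add_distrib)

text \<open>Each of the finitely many values is torsion, so a maximum of exponents works for all.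
  The uniform \<open>N\<close> later bounds the indices that can contribute to
  \<open>mapA\<close>.\<close>

lemma finite_support_bound:
  fixes \<phi> :: "'a \<Rightarrow> tower"
  assumes "finite {p. \<phi> p \<noteq> 0}"
  obtains N where "\<And>p. Upow N (\<phi> p) = 0"
proof -
  have "\<exists>N. \<forall>p\<in>A. Upow N (\<phi> p) = 0" if "finite A" for A
    using that
  proof (induction A)
    case (insert p A)
    then obtain N where N: "\<forall>p\<in>A. Upow N (\<phi> p) = 0" by blast
    obtain n where n: "Upow n (\<phi> p) = 0" using ex_Upow_eq_0 by blast
    show ?case
      using N n Upow_eq_0_mono[of _ _ "max N n"] by (intro exI[of _ "max N n"]) auto
  qed simp
  from this[OF assms] obtain N where N: "\<And>p. \<phi> p \<noteq> 0 \<Longrightarrow> Upow N (\<phi> p) = 0"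
    by auto
  show ?thesis
  proof (rule that)
    show "Upow N (\<phi> p) = 0" for p
      using N[of p] by (cases "\<phi> p = 0") auto
  qed
qed

section \<open>The graded module of cochains\<close>

lemma cochains_finite: "\<phi> \<in> cochains G \<Longrightarrow> finite {p. \<phi> p \<noteq> 0}"
  by (simp add: cochains_def)

lemma cochains_support:
  "\<phi> \<in> cochains G \<Longrightarrow> \<phi> (K, S) \<noteq> 0 \<Longrightarrow> K \<in> Char G \<and> S \<subseteq> verts G"
  by (auto simp: cochains_def)

lemma cochainsI:
  assumes "finite {p. \<phi> p \<noteq> 0}" "\<And>K S. \<phi> (K, S) \<noteq> 0 \<Longrightarrow> K \<in> Char G \<and> S \<subseteq> verts G"
  shows "\<phi> \<in> cochains G"
  using assms by (force simp: cochains_def)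

lemma cochains_zero: "0 \<in> cochains G"
  by (simp add: cochains_def)

lemma cochains_add:
  assumes "\<phi> \<in> cochains G" "\<psi> \<in> cochains G"
  shows "\<phi> + \<psi> \<in> cochains G"
proof (rule cochainsI)
  show "finite {p. (\<phi> + \<psi>) p \<noteq> 0}"
    by (rule finite_subset[OF _ finite_UnI[OF cochains_finite[OF assms(1)] cochains_finite[OF assms(2)]]])
      auto
next
  fix K S assume "(\<phi> + \<psi>) (K, S) \<noteq> 0"
  then have "\<phi> (K, S) \<noteq> 0 \<or> \<psi> (K, S) \<noteq> 0" by auto
  then show "K \<in> Char G \<and> S \<subseteq> verts G"
    using assms cochains_support by blast
qed

lemma cochains_smult:
  assumes "\<phi> \<in> cochains G"
  shows "(\<lambda>p. tower_smult r (\<phi> p)) \<in> cochains G"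
proof (rule cochainsI)
  show "finite {p. tower_smult r (\<phi> p) \<noteq> 0}"
    by (rule finite_subset[OF _ cochains_finite[OF assms]]) auto
  show "K \<in> Char G \<and> S \<subseteq> verts G" if "tower_smult r (\<phi> (K, S)) \<noteq> 0" for K S
    using cochains_support[OF assms, of K S] that by fastforce
qed

lemma bit_poly_cring: "cring FU"
proof -
  have "\<exists>y. y + x = 0" for x :: "bit poly"
    by (rule exI[of _ "- x"]) simp
  then show ?thesis
    by unfold_locales (auto simp: FU_def Units_def algebra_simps)
qed

lemma cochain_double [simp]: "\<phi> + \<phi> = (0 :: 'a \<Rightarrow> tower)"
  by (simp add: fun_eq_iff)

lemma lattice_complex_simps [simp]:
  "carrier (lattice_complex G) = cochains G"
  "\<zero>\<^bsub>lattice_complex G\<^esub> = 0"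
  "\<phi> \<oplus>\<^bsub>lattice_complex G\<^esub> \<psi> = \<phi> + \<psi>"
  "r \<odot>\<^bsub>lattice_complex G\<^esub> \<phi> = (\<lambda>p. tower_smult r (\<phi> p))"
  "cobd (lattice_complex G) = lattice_cobd G"
  "piece (lattice_complex G) s =
    {\<phi> \<in> cochains G. \<forall>K S. \<phi> (K, S) \<noteq> 0 \<longrightarrow> int (card S) = s}"
  by (auto simp: lattice_complex_def zero_fun_def plus_fun_def)

lemma lattice_complex_module: "Module.module FU (lattice_complex G)"
proof (rule moduleI)
  show "cring FU" by (rule bit_poly_cring)
  show "abelian_group (lattice_complex G)"
  proof (rule abelian_groupI)
    fix \<phi> assume "\<phi> \<in> carrier (lattice_complex G)"
    then show "\<exists>\<psi>\<in>carrier (lattice_complex G). \<psi> \<oplus>\<^bsub>lattice_complex G\<^esub> \<phi> = \<zero>\<^bsub>lattice_complex G\<^esub>"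
      by (intro bexI[of _ \<phi>]) auto
  qed (auto simp: cochains_add cochains_zero add_ac)
qed (auto simp: cochains_smult FU_def tower_smult_add_left tower_smult_add tower_smult_mult
    fun_eq_iff)

lemma finsum_lattice_complex:
  assumes "finite A" "\<And>i. i \<in> A \<Longrightarrow> c i \<in> cochains G"
  shows "(\<Oplus>\<^bsub>lattice_complex G\<^esub>i\<in>A. c i) = (\<Sum>i\<in>A. c i)"
proof -
  interpret Module.module FU "lattice_complex G" by (rule lattice_complex_module)
  show ?thesis
    using assms by (induction A) (auto simp: finsum_insert)
qed

lemma sum_fun_apply: "(\<Sum>i\<in>A. f i) x = (\<Sum>i\<in>A. f i x)"
  by (induction A rule: infinite_finite_induct) auto

lemma lattice_complex_graded: "is_graded_module FU (lattice_complex G)"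
  unfolding is_graded_module_def
proof (intro conjI allI ballI)
  interpret Module.module FU "lattice_complex G" by (rule lattice_complex_module)
  let ?C = "lattice_complex G"
  show "Module.module FU ?C" by (rule lattice_complex_module)
  show "submodule (piece ?C s) FU ?C" for s
  proof (rule submoduleI)
    fix \<phi> \<psi> assume a: "\<phi> \<in> piece ?C s" "\<psi> \<in> piece ?C s"
    have "\<phi> (K, S) \<noteq> 0 \<or> \<psi> (K, S) \<noteq> 0" if "\<phi> (K, S) + \<psi> (K, S) \<noteq> 0" for K S
      using that by auto
    then show "\<phi> \<oplus>\<^bsub>?C\<^esub> \<psi> \<in> piece ?C s"
      using a cochains_add by fastforce
  next
    fix \<phi> assume a: "\<phi> \<in> piece ?C s"
    then have "\<ominus>\<^bsub>?C\<^esub> \<phi> = \<phi>"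
      by (intro minus_equality) auto
    then show "\<ominus>\<^bsub>?C\<^esub> \<phi> \<in> piece ?C s"
      using a by simp
  next
    fix r \<phi> assume a: "\<phi> \<in> piece ?C s"
    have "\<phi> (K, S) \<noteq> 0" if "tower_smult r (\<phi> (K, S)) \<noteq> 0" for K S
      using that by auto
    then show "r \<odot>\<^bsub>?C\<^esub> \<phi> \<in> piece ?C s"
      using a cochains_smult by fastforce
  qed (auto simp: cochains_zero)
  fix \<phi> assume "\<phi> \<in> carrier ?C"
  then have \<phi>: "\<phi> \<in> cochains G" by simp
  let ?P = "\<lambda>c. (\<forall>s. c s \<in> piece ?C s) \<and> finite {s. c s \<noteq> \<zero>\<^bsub>?C\<^esub>} \<and>
    \<phi> = (\<Oplus>\<^bsub>?C\<^esub>s\<in>{s. c s \<noteq> \<zero>\<^bsub>?C\<^esub>}. c s)"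
  define c where "c = (\<lambda>s p. if int (card (snd p)) = s then \<phi> p else 0)"
  have "c' s (K, S) = (if int (card S) = s then \<phi> (K, S) else 0)" if P: "?P c'" for c' s K S
  proof -
    let ?A = "{s. c' s \<noteq> 0}"
    have hom: "c' t (K, S) \<noteq> 0 \<Longrightarrow> int (card S) = t" for t
      using P by auto
    have "\<phi> = sum c' ?A"
      using P finsum_lattice_complex[of ?A c' G] by auto
    then have "\<phi> (K, S) = (\<Sum>t\<in>?A. c' t (K, S))"
      by (simp add: sum_fun_apply)
    also have "\<dots> = (\<Sum>t\<in>?A. if t = int (card S) then c' t (K, S) else 0)"
      using hom by (intro sum.cong) auto
    \<comment> \<open>If the index \<open>int (card S)\<close> is outside the summation range,
      \<open>c'\<close> vanishes there, so both cases of the delta sum agree.\<close>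
    also have "\<dots> = c' (int (card S)) (K, S)"
      using P by (simp add: sum.delta)
    finally show ?thesis
      using hom[of s] by (auto split: if_splits)
  qed
  then have uniq: "c' = c" if "?P c'" for c'
    using that by (auto simp: c_def fun_eq_iff)
  have cc: "c s \<in> cochains G" for s
    by (rule cochainsI, rule finite_subset[OF _ cochains_finite[OF \<phi>]])
      (use cochains_support[OF \<phi>] in \<open>auto simp: c_def split: if_splits\<close>)
  have fin: "finite {s. c s \<noteq> 0}"
  proof (rule finite_subset)
    show "{s. c s \<noteq> 0} \<subseteq> (\<lambda>p. int (card (snd p))) ` {p. \<phi> p \<noteq> 0}"
    proof
      fix s assume "s \<in> {s. c s \<noteq> 0}"
      then obtain p where "c s p \<noteq> 0" by (auto simp: fun_eq_iff)
      then show "s \<in> (\<lambda>p. int (card (snd p))) ` {p. \<phi> p \<noteq> 0}"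
        by (intro image_eqI[of _ _ p]) (auto simp: c_def split: if_splits)
    qed
    show "finite ((\<lambda>p. int (card (snd p))) ` {p. \<phi> p \<noteq> 0})"
      using cochains_finite[OF \<phi>] by simp
  qed
  have "(\<Sum>s\<in>{s. c s \<noteq> 0}. c s) p = \<phi> p" for p
  proof -
    have "(\<Sum>s\<in>{s. c s \<noteq> 0}. c s p) = (\<Sum>s\<in>{s. c s \<noteq> 0}. if s = int (card (snd p)) then \<phi> p else 0)"
      by (intro sum.cong) (auto simp: c_def)
    also have "\<dots> = (if c (int (card (snd p))) = 0 then 0 else \<phi> p)"
      using fin by (simp add: sum.delta')
    also have "\<dots> = \<phi> p"
      by (auto simp: c_def dest: fun_cong[of _ _ p])
    finally show ?thesis by (simp add: sum_fun_apply)
  qed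
  then have "?P c"
    using fin cc by (auto simp: finsum_lattice_complex fun_eq_iff c_def split: if_splits)
  then show "\<exists>!c. ?P c"
    using uniq by blast
qed

section \<open>The differential\<close>

lemma lattice_cobd_apply:
  assumes "K \<in> Char G" "S \<subseteq> verts G"
  shows "lattice_cobd G \<phi> (K, S) = (\<Sum>w\<in>S.
     Upow (nat (qdiff_near G K S w)) (\<phi> (K, S - {w})) +
     Upow (nat (qdiff_far G K S w)) (\<phi> (shift G K (basis_vec w), S - {w})))"
  using assms by (simp add: lattice_cobd_def)

lemma lattice_cobd_add: "lattice_cobd G (\<phi> + \<psi>) = lattice_cobd G \<phi> + lattice_cobd G \<psi>"
  by (auto simp: lattice_cobd_def fun_eq_iff Upow_add sum.distrib add_ac)

lemma tower_smult_sum: "tower_smult r (sum f A) = (\<Sum>i\<in>A. tower_smult r (f i))"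
  by (induction A rule: infinite_finite_induct) (auto simp: tower_smult_add)

lemma lattice_cobd_smult:
  "lattice_cobd G (\<lambda>p. tower_smult r (\<phi> p)) = (\<lambda>p. tower_smult r (lattice_cobd G \<phi> p))"
  by (auto simp: lattice_cobd_def fun_eq_iff Upow_smult tower_smult_sum tower_smult_add)

lemma lattice_cobd_nonzero:
  assumes "lattice_cobd G \<phi> (K, S) \<noteq> 0"
  obtains w where "K \<in> Char G" "S \<subseteq> verts G" "w \<in> S"
    "\<phi> (K, S - {w}) \<noteq> 0 \<or> \<phi> (shift G K (basis_vec w), S - {w}) \<noteq> 0"
proof -
  have KS: "K \<in> Char G" "S \<subseteq> verts G"
    using assms by (auto simp: lattice_cobd_def split: if_splits)
  then have "(\<Sum>w\<in>S. Upow (nat (qdiff_near G K S w)) (\<phi> (K, S - {w})) +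
     Upow (nat (qdiff_far G K S w)) (\<phi> (shift G K (basis_vec w), S - {w}))) \<noteq> 0"
    using assms by (simp add: lattice_cobd_apply)
  then obtain w where "w \<in> S" "Upow (nat (qdiff_near G K S w)) (\<phi> (K, S - {w})) +
     Upow (nat (qdiff_far G K S w)) (\<phi> (shift G K (basis_vec w), S - {w})) \<noteq> 0"
    by (meson sum.neutral)
  then show ?thesis
    using KS that by force
qed

lemma lattice_cobd_closed:
  assumes V: "finite (verts G)" and \<phi>: "\<phi> \<in> cochains G"
  shows "lattice_cobd G \<phi> \<in> cochains G"
proof (rule cochainsI)
  let ?F = "{p. \<phi> p \<noteq> 0}"
  \<comment> \<open>A nonzero value on a cube stems from a nonzero value on its near or its far face
    in some direction \<open>w\<close>; \<open>?f\<close> and \<open>?g\<close> rebuild the cube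
    from that face and \<open>w\<close>.\<close>
  let ?f = "\<lambda>((K, S), w). (K, insert w S)"
  let ?g = "\<lambda>((K, S), w). (shift G K (- basis_vec w), insert w S)"
  have "{p. lattice_cobd G \<phi> p \<noteq> 0} \<subseteq> ?f ` (?F \<times> verts G) \<union> ?g ` (?F \<times> verts G)"
  proof
    fix p assume p: "p \<in> {p. lattice_cobd G \<phi> p \<noteq> 0}"
    obtain K S where [simp]: "p = (K, S)" by force
    obtain w where w: "K \<in> Char G" "S \<subseteq> verts G" "w \<in> S"
      "\<phi> (K, S - {w}) \<noteq> 0 \<or> \<phi> (shift G K (basis_vec w), S - {w}) \<noteq> 0"
      using lattice_cobd_nonzero[of G \<phi> K S] p by auto
    have "shift G (shift G K (basis_vec w)) (- basis_vec w) = K"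
      using w by (simp add: shift_shift shift_zero)
    then have "p = ?f ((K, S - {w}), w)" "p = ?g ((shift G K (basis_vec w), S - {w}), w)"
      using w by (auto simp: insert_absorb)
    then show "p \<in> ?f ` (?F \<times> verts G) \<union> ?g ` (?F \<times> verts G)"
      using w by blast
  qed
  then show "finite {p. lattice_cobd G \<phi> p \<noteq> 0}"
    using V cochains_finite[OF \<phi>] by (auto elim!: finite_subset)
next
  show "K \<in> Char G \<and> S \<subseteq> verts G" if "lattice_cobd G \<phi> (K, S) \<noteq> 0" for K S
    using that by (auto simp: lattice_cobd_def split: if_splits)
qed

lemma lattice_cobd_piece:
  assumes V: "finite (verts G)" and "\<phi> \<in> piece (lattice_complex G) s"
  shows "lattice_cobd G \<phi> \<in> piece (lattice_complex G) (s + 1)"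
proof -
  have "int (card S) = s + 1" if nz: "lattice_cobd G \<phi> (K, S) \<noteq> 0" for K S
  proof -
    obtain w where w: "S \<subseteq> verts G" "w \<in> S"
      "\<phi> (K, S - {w}) \<noteq> 0 \<or> \<phi> (shift G K (basis_vec w), S - {w}) \<noteq> 0"
      using lattice_cobd_nonzero[OF nz] by blast
    then have "int (card (S - {w})) = s"
      using assms(2) unfolding lattice_complex_simps by blast
    moreover have "card S = Suc (card (S - {w}))"
      using w V finite_subset by (metis card_Suc_Diff1)
    ultimately show ?thesis by simp
  qed
  then show ?thesis
    using assms lattice_cobd_closed by auto
qed

lemma lattice_cobd_cobd:
  assumes V: "finite (verts G)"
  shows "lattice_cobd G (lattice_cobd G \<phi>) = 0"
proof -
  have "lattice_cobd G (lattice_cobd G \<phi>) (K, S) = 0" if K: "K \<in> Char G" and S: "S \<subseteq> verts G" for K S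
  proof -
    have finS: "finite S" using S V finite_subset by blast
    let ?s = "\<lambda>K w. shift G K (basis_vec w)"
    \<comment> \<open>After telescoping, the exponents compare the cube directly with its faces of
      codimension two and forget the facet in between. Exchanging \<open>w\<close> and
      \<open>u\<close> swaps the two middle terms and fixes the outer ones.\<close>
    define F where "F = (\<lambda>w u.
      Upow (nat (qmax G K S - qmax G K (S - {w} - {u}))) (\<phi> (K, S - {w} - {u})) +
      Upow (nat (qmax G K S - qmax G (?s K u) (S - {w} - {u}) - qrel G K {u}))
        (\<phi> (?s K u, S - {w} - {u})) +
      (Upow (nat (qmax G K S - qmax G (?s K w) (S - {w} - {u}) - qrel G K {w}))
        (\<phi> (?s K w, S - {w} - {u})) +
      Upow (nat (qmax G K S - qmax G (?s (?s K w) u) (S - {w} - {u}) - qrel G K {w, u}))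
        (\<phi> (?s (?s K w) u, S - {w} - {u}))))"
    have "Upow (nat (qdiff_near G K S w)) (lattice_cobd G \<phi> (K, S - {w})) +
       Upow (nat (qdiff_far G K S w)) (lattice_cobd G \<phi> (?s K w, S - {w}))
       = (\<Sum>u\<in>S - {w}. F w u)" if w: "w \<in> S" for w
    proof -
      have S': "S - {w} \<subseteq> verts G" "finite (S - {w})" using S finS by auto
      have nonneg: "0 \<le> qdiff_near G K S w" "0 \<le> qdiff_far G K S w"
        using finS w by (auto intro: qdiff_near_nonneg qdiff_far_nonneg)
      have "Upow (nat (qdiff_near G K S w))
          (Upow (nat (qdiff_near G K (S - {w}) u)) (\<phi> (K, S - {w} - {u})) +
           Upow (nat (qdiff_far G K (S - {w}) u)) (\<phi> (?s K u, S - {w} - {u}))) +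
        Upow (nat (qdiff_far G K S w))
          (Upow (nat (qdiff_near G (?s K w) (S - {w}) u)) (\<phi> (?s K w, S - {w} - {u})) +
           Upow (nat (qdiff_far G (?s K w) (S - {w}) u)) (\<phi> (?s (?s K w) u, S - {w} - {u})))
        = F w u" if u: "u \<in> S - {w}" for u
      proof -
        have nonneg': "0 \<le> qdiff_near G K' (S - {w}) u" "0 \<le> qdiff_far G K' (S - {w}) u" for K'
          using S' u by (auto intro: qdiff_near_nonneg qdiff_far_nonneg)
        have wV: "w \<in> verts G" using w S by auto
        have "qrel G (?s K w) {u} = qrel G K {u, w} - qrel G K {w}"
          using u S wV by (subst qrel_shift[OF K]) (auto simp: insert_commute)
        then have "qdiff_near G K S w + qdiff_near G K (S - {w}) u
              = qmax G K S - qmax G K (S - {w} - {u})"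
          "qdiff_near G K S w + qdiff_far G K (S - {w}) u
              = qmax G K S - qmax G (?s K u) (S - {w} - {u}) - qrel G K {u}"
          "qdiff_far G K S w + qdiff_near G (?s K w) (S - {w}) u
              = qmax G K S - qmax G (?s K w) (S - {w} - {u}) - qrel G K {w}"
          "qdiff_far G K S w + qdiff_far G (?s K w) (S - {w}) u
              = qmax G K S - qmax G (?s (?s K w) u) (S - {w} - {u}) - qrel G K {w, u}"
          using qdiff_far_eq[OF K S finS w] qdiff_far_eq[OF K S' u]
            qdiff_far_eq[OF shift_Char[OF K] S' u]
          by (simp_all add: qdiff_near_eq insert_commute)
        then show ?thesis
          unfolding Upow_add Upow_nat_Upow_nat[OF nonneg(1) nonneg'(1)]
            Upow_nat_Upow_nat[OF nonneg(1) nonneg'(2)] Upow_nat_Upow_nat[OF nonneg(2) nonneg'(1)]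
            Upow_nat_Upow_nat[OF nonneg(2) nonneg'(2)]
          by (simp only: F_def)
      qed
      then show ?thesis
        using K S' shift_Char[OF K]
        by (simp add: lattice_cobd_apply Upow_sum flip: sum.distrib)
    qed
    then have "lattice_cobd G (lattice_cobd G \<phi>) (K, S) = (\<Sum>w\<in>S. \<Sum>u\<in>S - {w}. F w u)"
      using K S by (simp add: lattice_cobd_apply)
    moreover have "F u w = F w u" for u w
    proof -
      have "S - {u} - {w} = S - {w} - {u}" by auto
      then show ?thesis
        unfolding F_def shift_commute[of G K "basis_vec u"] insert_commute[of u]
        by (simp add: add_ac)
    qed
    ultimately show ?thesis
      using sum_symmetric_pairs_tower[OF finS, of F] by simp
  qed
  then show ?thesis
    by (auto simp: fun_eq_iff lattice_cobd_def[of G "lattice_cobd G \<phi>"])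
qed

lemma lattice_complex_is_complex:
  assumes "finite (verts G)"
  shows "is_complex FU (lattice_complex G)"
proof -
  note [simp del] = lattice_complex_simps(6)
  have "lattice_cobd G \<in> linear_maps FU (lattice_complex G) (lattice_complex G)"
    using assms by (simp add: linear_maps_def lattice_cobd_closed lattice_cobd_add lattice_cobd_smult)
  then show ?thesis
    using lattice_complex_graded[of G] lattice_cobd_piece[OF assms] lattice_cobd_cobd[OF assms]
    by (auto simp: is_complex_def graded_maps_def)
qed

section \<open>The maps of the surgery sequence\<close>

text \<open>Adds \<open>j\<close> times the coordinate functional of \<open>v\<close>. Only the
  lattice of \<open>G\<close> enters, which raising a weight does not change, so one operation
  serves both graphs.\<close>

definition bump :: "('v, 'e) wgraph \<Rightarrow> 'v \<Rightarrow> 'v functional \<Rightarrow> int \<Rightarrow> 'v functional" where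
  "bump G v K j = restrict (\<lambda>x. K x + j * Poly_Mapping.lookup x v) (lattice G)"

text \<open>Equal to ((2l - 1)^2 - 1) / 8, hence invariant under l -> 1 - l, which negates 2l -
  1.\<close>

definition tri :: "int \<Rightarrow> int" where
  "tri l = l * (l - 1) div 2"

lemma double_tri: "2 * tri l = l * (l - 1)"
  unfolding tri_def by (subst dvd_mult_div_cancel) auto

lemma tri_Suc: "tri (l + 1) = tri l + l"
  using double_tri[of "l + 1"] double_tri[of l] by (simp add: algebra_simps)

lemma tri_reflect: "tri (1 - l) = tri l"
  using double_tri[of "1 - l"] double_tri[of l] by (simp add: algebra_simps)

text \<open>Products of two consecutive integers are non-negative; expanding l (l + 1) or (l - 1)(l
  - 2) gives the bound. Linear growth is enough to cut off sums of torsion elements.\<close>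

lemma tri_ge: "\<bar>l\<bar> - 1 \<le> tri l"
proof (cases "l \<le> 0")
  case True
  then have "0 \<le> l * (l + 1)"
    by (cases "l = 0") (auto intro: mult_nonpos_nonpos)
  then show ?thesis
    using True double_tri[of l] by (simp add: algebra_simps)
next
  case False
  then have "0 \<le> (l - 1) * (l - 2)"
    by (cases "l = 1") auto
  then show ?thesis
    using False double_tri[of l] by (simp add: algebra_simps)
qed

lemma tri_nonneg: "0 \<le> tri l"
  using tri_ge[of l] by (cases "l = 0") (auto simp: tri_def)

lemma raise_weight_simps [simp]:
  "verts (raise_weight G v) = verts G" "lattice (raise_weight G v) = lattice G"
  by (simp_all add: raise_weight_def lattice_def)

lemma bump_apply: "x \<in> lattice G \<Longrightarrow> bump G v K j x = K x + j * Poly_Mapping.lookup x v"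
  by (simp add: bump_def)

lemma bump_bump: "bump G v (bump G v K i) j = bump G v K (i + j)"
  by (auto simp: bump_def restrict_def algebra_simps)

lemma bump_zero: "K \<in> Char H \<Longrightarrow> lattice H = lattice G \<Longrightarrow> bump G v K 0 = K"
  by (rule Char_eqI[of K H, symmetric]) (auto simp: bump_def)

lemma bump_shift: "shift G (bump G v K j) x = bump G v (shift G K x) j"
  by (auto simp: bump_def shift_def restrict_def)

text \<open>Two graphs \<open>H\<close>, \<open>H'\<close> on the lattice of \<open>G\<close> are
  allowed so that all four combinations of parity and weight are instances.\<close>

lemma bump_CharI:
  assumes K: "K \<in> Char H" and "lattice H = lattice G" "lattice H' = lattice G"
    and "\<And>x. x \<in> lattice G \<Longrightarrow> (form H x x + j * Poly_Mapping.lookup x v) mod 2 = form H' x x mod 2"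
  shows "bump G v K j \<in> Char H'"
proof (rule CharI)
  fix x assume "x \<in> lattice H'"
  then have "bump G v K j x mod 2 = (K x mod 2 + j * Poly_Mapping.lookup x v) mod 2"
    using assms(3) by (simp add: bump_apply mod_simps)
  also have "\<dots> = (form H x x + j * Poly_Mapping.lookup x v) mod 2"
    using Char_mod[OF K, of x] \<open>x \<in> lattice H'\<close> assms(2,3) by (simp add: mod_simps)
  finally show "bump G v K j x mod 2 = form H' x x mod 2"
    using assms(3,4) \<open>x \<in> lattice H'\<close> by simp
qed (use assms in \<open>auto simp: bump_def lattice_add lookup_add Char_add[OF K] algebra_simps\<close>)

section \<open>Raising the weight of a vertex, and the map A\<close>

locale vertex_graph =
  fixes G :: "('v, 'e) wgraph" and v :: 'v
  assumes finV: "finite (verts G)" and v: "v \<in> verts G"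
begin

abbreviation "G1 \<equiv> raise_weight G v"
abbreviation "G0 \<equiv> delete_vertex G v"
abbreviation "b \<equiv> bump G v"

lemma finS: "S \<subseteq> verts G \<Longrightarrow> finite S"
  using finV finite_subset by blast

lemma form_raise:
  "form G1 x y = form G x y + Poly_Mapping.lookup x v * Poly_Mapping.lookup y v"
proof -
  let ?x = "Poly_Mapping.lookup x" and ?y = "Poly_Mapping.lookup y"
  have "gram G1 u w = gram G u w + (if u = v then if w = v then 1 else 0 else 0)" for u w
    by (auto simp: gram_def raise_weight_def)
  then have "form G1 x y = form G x y +
      (\<Sum>u\<in>verts G. \<Sum>w\<in>verts G. ?x u * ?y w * (if u = v then if w = v then 1 else 0 else 0))"
    by (simp add: form_def distrib_left sum.distrib)
  also have "(\<Sum>u\<in>verts G. \<Sum>w\<in>verts G. ?x u * ?y w * (if u = v then if w = v then 1 else 0 else 0))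
      = (\<Sum>u\<in>verts G. if u = v then \<Sum>w\<in>verts G. if w = v then ?x u * ?y w else 0 else 0)"
    by (intro sum.cong) (auto intro!: sum.cong)
  also have "\<dots> = ?x v * ?y v"
    using finV v by (simp add: sum.delta)
  finally show ?thesis .
qed

lemma bump_odd: "K \<in> Char G \<Longrightarrow> odd j \<Longrightarrow> b K j \<in> Char G1"
  by (rule bump_CharI[of K G]) (auto simp: form_raise mod2_eq_if)

lemma bump_odd': "K \<in> Char G1 \<Longrightarrow> odd j \<Longrightarrow> b K j \<in> Char G"
  by (rule bump_CharI[of K G1]) (auto simp: form_raise mod2_eq_if)

lemma bump_even: "K \<in> Char G \<Longrightarrow> even j \<Longrightarrow> b K j \<in> Char G"
  by (rule bump_CharI[of K G]) (auto simp: mod2_eq_if)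

lemma bump_even': "K \<in> Char G1 \<Longrightarrow> even j \<Longrightarrow> b K j \<in> Char G1"
  by (rule bump_CharI[of K G1]) (auto simp: mod2_eq_if)

lemma bump_0 [simp]: "K \<in> Char G \<Longrightarrow> b K 0 = K" "K \<in> Char G1 \<Longrightarrow> b K 0 = K"
  by (auto intro: bump_zero)

lemma bump_inj: "b K i = b K j \<longleftrightarrow> i = j"
proof
  assume "b K i = b K j"
  then have "b K i (basis_vec v) = b K j (basis_vec v)" by simp
  then show "i = j"
    using v by (simp add: bump_apply basis_vec_lattice lookup_basis_vec)
qed simp

text \<open>The raised form pairs \<open>x\<close> with an additional multiple of the coordinate at
  \<open>v\<close>. For \<open>basis_vec v\<close> the far face therefore carries the index
  \<open>l + 1\<close> in place of \<open>l\<close>.\<close>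

lemma bump_shift_raise: "shift G1 (b K j) x = b (shift G K x) (j + 2 * Poly_Mapping.lookup x v)"
  by (auto simp: bump_def shift_def restrict_def form_raise algebra_simps)

text \<open>If \<open>v\<close> lies in \<open>T\<close>, the functional gains 2l - 1 and the form
  gains 1. The sum 2l is even, so halving gives the loss \<open>l\<close> exactly.\<close>

lemma qrel_bump:
  assumes K: "K \<in> Char G" and T: "T \<subseteq> verts G"
  shows "qrel G1 (b K (2 * l - 1)) T = qrel G K T - (if v \<in> T then l else 0)"
proof -
  have "b K (2 * l - 1) \<in> Char G1"
    using K by (rule bump_odd) simp
  then have "2 * qrel G1 (b K (2 * l - 1)) T = 2 * (qrel G K T - (if v \<in> T then l else 0))"
    using qrel_double[of "b K (2 * l - 1)" G1 T] qrel_double[OF K T] T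
    by (simp add: form_raise bump_apply basis_sum_lattice lookup_basis_sum finS)
  then show ?thesis by simp
qed

lemma qrel_bump_raise:
  assumes K: "K \<in> Char G1" and T: "T \<subseteq> verts G"
  shows "qrel G1 (b K (2 * i)) T = qrel G1 K T - (if v \<in> T then i else 0)"
proof -
  have "b K (2 * i) \<in> Char G1"
    using K by (rule bump_even') simp
  then have "2 * qrel G1 (b K (2 * i)) T = 2 * (qrel G1 K T - (if v \<in> T then i else 0))"
    using qrel_double[of "b K (2 * i)" G1 T] qrel_double[OF K, of T] T
    by (simp add: bump_apply basis_sum_lattice lookup_basis_sum finS)
  then show ?thesis by simp
qed

text \<open>For a single vertex \<open>T\<close> in place of the two maxima, this difference is
  \<open>tri l\<close>, or \<open>tri l + l = tri (l + 1)\<close> if \<open>v\<close> lies in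
  \<open>T\<close>: the same theta weight with its index moved by one. The maxima carry this over to
  cubes.\<close>

definition aexp :: "int \<Rightarrow> 'v functional \<Rightarrow> 'v set \<Rightarrow> int" where
  "aexp l K S = tri l + qmax G K S - qmax G1 (b K (2 * l - 1)) S"

text \<open>At a \<open>T\<close> that attains the maximum for \<open>G1\<close>, the exponent is at
  least \<open>tri l\<close> or \<open>tri l + l = tri (- l)\<close>. The first bound controls
  supports, the second makes \<open>nat\<close> faithful.\<close>

lemma aexp_ge:
  assumes K: "K \<in> Char G" and S: "S \<subseteq> verts G"
  shows "\<bar>l\<bar> - 1 \<le> aexp l K S" "0 \<le> aexp l K S"
proof -
  have "qmax G1 (b K (2 * l - 1)) S \<in> qrel G1 (b K (2 * l - 1)) ` Pow S"
    unfolding qmax_def using finS[OF S] by (intro Max_in) auto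
  then obtain T where T: "T \<subseteq> S" "qmax G1 (b K (2 * l - 1)) S = qrel G1 (b K (2 * l - 1)) T"
    by auto
  have "qrel G K T \<le> qmax G K S"
    unfolding qmax_def using finS[OF S] T by (intro Max_ge) auto
  then have "tri l + (if v \<in> T then l else 0) \<le> aexp l K S"
    using T S qrel_bump[OF K, of T l] by (simp add: aexp_def)
  moreover have "tri l + l = tri (- l)"
    using tri_Suc[of l] tri_reflect[of "- l"] by (simp add: add.commute)
  ultimately show "\<bar>l\<bar> - 1 \<le> aexp l K S" "0 \<le> aexp l K S"
    using tri_ge[of l] tri_ge[of "- l"] tri_nonneg[of l] tri_nonneg[of "- l"]
    by (auto split: if_splits)
qed

text \<open>\<open>Sum_any\<close> is zero on families of infinite support, so it is meaningful only
  because a finitely supported \<phi> meets each fibre in finitely many points.\<close>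

definition mapA :: "'v cochain \<Rightarrow> 'v cochain" where
  "mapA \<phi> = (\<lambda>(K, S). if K \<in> Char G \<and> S \<subseteq> verts G then
     Sum_any (\<lambda>l. Upow (nat (aexp l K S)) (\<phi> (b K (2 * l - 1), S))) else 0)"

lemma mapA_apply:
  "K \<in> Char G \<Longrightarrow> S \<subseteq> verts G \<Longrightarrow>
    mapA \<phi> (K, S) = Sum_any (\<lambda>l. Upow (nat (aexp l K S)) (\<phi> (b K (2 * l - 1), S)))"
  by (simp add: mapA_def)

lemma finite_fibre:
  assumes "finite {p. \<phi> p \<noteq> 0}" and "inj h"
  shows "finite {l. \<phi> (b K (h l), S) \<noteq> 0}"
  using finite_vimageI[OF assms(1), of "\<lambda>l. (b K (h l), S)"] assms(2)
  by (auto simp: vimage_def bump_inj inj_def)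

lemma finite_fibre_Upow:
  assumes "finite {p. \<phi> p \<noteq> 0}" and "inj h"
  shows "finite {l. Upow (f l) (\<phi> (b K (h l), S)) \<noteq> 0}"
  by (rule finite_subset[OF _ finite_fibre[OF assms, of K S]]) auto

lemma mapA_add:
  assumes "\<phi> \<in> cochains G1" "\<psi> \<in> cochains G1"
  shows "mapA (\<phi> + \<psi>) = mapA \<phi> + mapA \<psi>"
proof -
  have "Sum_any (\<lambda>l. Upow (nat (aexp l K S)) (\<phi> (b K (2 * l - 1), S)) +
      Upow (nat (aexp l K S)) (\<psi> (b K (2 * l - 1), S)))
    = Sum_any (\<lambda>l. Upow (nat (aexp l K S)) (\<phi> (b K (2 * l - 1), S))) +
      Sum_any (\<lambda>l. Upow (nat (aexp l K S)) (\<psi> (b K (2 * l - 1), S)))" for K S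
    using assms[THEN cochains_finite]
    by (intro Sum_any.distrib finite_fibre_Upow) (auto intro: injI)
  then show ?thesis
    by (auto simp: mapA_def fun_eq_iff Upow_add)
qed

lemma mapA_smult:
  assumes "\<phi> \<in> cochains G1"
  shows "mapA (\<lambda>p. tower_smult r (\<phi> p)) = (\<lambda>p. tower_smult r (mapA \<phi> p))"
proof -
  have "tower_smult r (Sum_any (\<lambda>l. Upow (nat (aexp l K S)) (\<phi> (b K (2 * l - 1), S))))
    = Sum_any (\<lambda>l. tower_smult r (Upow (nat (aexp l K S)) (\<phi> (b K (2 * l - 1), S))))" for K S
    using assms[THEN cochains_finite]
    by (intro Sum_any_additive finite_fibre_Upow) (auto intro: injI simp: tower_smult_add)
  then show ?thesis
    by (auto simp: mapA_def fun_eq_iff Upow_smult)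
qed

lemma mapA_nonzero:
  assumes "mapA \<phi> (K, S) \<noteq> 0"
  obtains l where "K \<in> Char G" "S \<subseteq> verts G" "Upow (nat (aexp l K S)) (\<phi> (b K (2 * l - 1), S)) \<noteq> 0"
proof -
  have KS: "K \<in> Char G" "S \<subseteq> verts G"
    using assms by (auto simp: mapA_def split: if_splits)
  then show ?thesis
    using assms that by (auto simp: mapA_apply elim: Sum_any.not_neutral_obtains_not_neutral)
qed

text \<open>A single value of \<phi> could spread over an infinite fibre. With \<open>N\<close> as
  torsion bound, the growth of the exponents leaves only indices with |l| at most
  \<open>N\<close>.\<close>

lemma mapA_closed:
  assumes \<phi>: "\<phi> \<in> cochains G1"
  shows "mapA \<phi> \<in> cochains G"
proof (rule cochainsI)
  let ?F = "{p. \<phi> p \<noteq> 0}"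
  let ?f = "\<lambda>((K, S), l). (b K (1 - 2 * l), S)"
  obtain N where N: "\<And>p. Upow N (\<phi> p) = 0"
    using finite_support_bound[OF cochains_finite[OF \<phi>]] by blast
  have "{p. mapA \<phi> p \<noteq> 0} \<subseteq> ?f ` (?F \<times> {- int N..int N})"
  proof
    fix p assume p: "p \<in> {p. mapA \<phi> p \<noteq> 0}"
    obtain K S where [simp]: "p = (K, S)" by force
    obtain l where KS: "K \<in> Char G" "S \<subseteq> verts G"
      and l: "Upow (nat (aexp l K S)) (\<phi> (b K (2 * l - 1), S)) \<noteq> 0"
      using p mapA_nonzero[of \<phi> K S] by auto
    have "nat (aexp l K S) < N"
      using Upow_eq_0_mono[OF N, of "nat (aexp l K S)"] l by force
    then have "l \<in> {- int N..int N}"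
      using aexp_ge[OF KS, of l] by auto
    moreover have "\<phi> (b K (2 * l - 1), S) \<noteq> 0"
      using l by auto
    moreover have "p = ?f ((b K (2 * l - 1), S), l)"
      using KS by (simp add: bump_bump)
    ultimately show "p \<in> ?f ` (?F \<times> {- int N..int N})"
      by blast
  qed
  then show "finite {p. mapA \<phi> p \<noteq> 0}"
    using cochains_finite[OF \<phi>] by (auto elim!: finite_subset)
next
  show "K \<in> Char G \<and> S \<subseteq> verts G" if "mapA \<phi> (K, S) \<noteq> 0" for K S
    using that by (auto simp: mapA_def split: if_splits)
qed

lemma mapA_piece:
  assumes "\<phi> \<in> piece (lattice_complex G1) s"
  shows "mapA \<phi> \<in> piece (lattice_complex G) s"
proof -
  have "int (card S) = s" if "mapA \<phi> (K, S) \<noteq> 0" for K S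
  proof -
    obtain l where "Upow (nat (aexp l K S)) (\<phi> (b K (2 * l - 1), S)) \<noteq> 0"
      using mapA_nonzero[OF \<open>mapA \<phi> (K, S) \<noteq> 0\<close>] by blast
    then have "\<phi> (b K (2 * l - 1), S) \<noteq> 0" by auto
    then show ?thesis
      using assms unfolding lattice_complex_simps by blast
  qed
  then show ?thesis
    using assms mapA_closed by simp
qed

lemma mapA_cobd:
  assumes \<phi>: "\<phi> \<in> cochains G1"
  shows "mapA (lattice_cobd G1 \<phi>) = lattice_cobd G (mapA \<phi>)"
proof -
  have "mapA (lattice_cobd G1 \<phi>) (K, S) = lattice_cobd G (mapA \<phi>) (K, S)"
    if K: "K \<in> Char G" and S: "S \<subseteq> verts G" for K S
  proof -
    note [simp] = finS[OF S]
    let ?s = "\<lambda>w. shift G K (basis_vec w)"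
    \<comment> \<open>The index shift caused by the far face in the raised graph; it occurs in
      direction \<open>v\<close> only.\<close>
    define e :: "'v \<Rightarrow> int" where "e = (\<lambda>w. if w = v then 1 else 0)"
    \<comment> \<open>\<open>P\<close> and \<open>Q\<close> are the near and far contributions with
      telescoped exponents, from the cube in \<open>G\<close> directly to a face in
      \<open>G1\<close>. Both composites are reduced to them.\<close>
    define P where "P = (\<lambda>w l. Upow (nat (tri l + qmax G K S - qmax G1 (b K (2 * l - 1)) (S - {w})))
      (\<phi> (b K (2 * l - 1), S - {w})))"
    define Q where "Q = (\<lambda>w l. Upow (nat (tri l + qmax G K S
      - qmax G1 (b (?s w) (2 * l - 1)) (S - {w}) - qrel G K {w}))
      (\<phi> (b (?s w) (2 * l - 1), S - {w})))"
    have finP: "finite {l. P w l \<noteq> 0}" for w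
      unfolding P_def using cochains_finite[OF \<phi>] by (intro finite_fibre_Upow) (auto intro: injI)
    have finQ: "finite {l. Q w l \<noteq> 0}" for w
      unfolding Q_def using cochains_finite[OF \<phi>] by (intro finite_fibre_Upow) (auto intro: injI)
    have finQ': "finite {l. Q w (l + c) \<noteq> 0}" for w c
      unfolding Q_def using cochains_finite[OF \<phi>]
      by (intro finite_fibre_Upow[where h = "\<lambda>l. 2 * (l + c) - 1"]) (auto intro: injI)
    have "Upow (nat (aexp l K S)) (lattice_cobd G1 \<phi> (b K (2 * l - 1), S))
      = (\<Sum>w\<in>S. P w l + Q w (l + e w))" for l
    proof -
      let ?K = "b K (2 * l - 1)"
      have K1: "?K \<in> Char G1" using K by (rule bump_odd) simp
      have "Upow (nat (aexp l K S)) (Upow (nat (qdiff_near G1 ?K S w)) (\<phi> (?K, S - {w})))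
        = P w l" for w
        using aexp_ge(2)[OF K S, of l] qdiff_near_nonneg[of S G1 ?K w]
        by (simp add: Upow_nat_Upow_nat P_def aexp_def qdiff_near_eq algebra_simps)
      moreover have "Upow (nat (aexp l K S)) (Upow (nat (qdiff_far G1 ?K S w))
        (\<phi> (shift G1 ?K (basis_vec w), S - {w}))) = Q w (l + e w)" if w: "w \<in> S" for w
      proof -
        have sh: "shift G1 ?K (basis_vec w) = b (?s w) (2 * (l + e w) - 1)"
          by (simp add: bump_shift_raise lookup_basis_vec e_def)
        \<comment> \<open>For \<open>w = v\<close> the value of \<open>qrel\<close> differs by
          \<open>l\<close> between the two graphs, which is exactly
          \<open>tri (l + 1) - tri l\<close>. This identity forces the quadratic weights.\<close>
        have "aexp l K S + qdiff_far G1 ?K S w = tri (l + e w) + qmax G K S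
          - qmax G1 (b (?s w) (2 * (l + e w) - 1)) (S - {w}) - qrel G K {w}"
          using qdiff_far_eq[OF K1, of S w] S w qrel_bump[OF K, of "{w}" l] tri_Suc[of l]
          by (auto simp: sh aexp_def e_def)
        then show ?thesis
          using aexp_ge(2)[OF K S, of l] qdiff_far_nonneg[of S w G1 ?K] w
          by (simp add: Upow_nat_Upow_nat Q_def sh)
      qed
      ultimately show ?thesis
        using K1 S by (simp add: lattice_cobd_apply Upow_sum Upow_add)
    qed
    then have "mapA (lattice_cobd G1 \<phi>) (K, S) = Sum_any (\<lambda>l. \<Sum>w\<in>S. P w l + Q w (l + e w))"
      using K S by (simp add: mapA_apply)
    also have "\<dots> = (\<Sum>w\<in>S. Sum_any (\<lambda>l. P w l + Q w (l + e w)))"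
    proof (intro Sum_any_sum)
      show "finite {l. P w l + Q w (l + e w) \<noteq> 0}" for w
        by (rule finite_subset[OF _ finite_UnI[OF finP[of w] finQ'[of w "e w"]]]) auto
    qed simp
    \<comment> \<open>The summation runs over all integers, so it absorbs the shift
      \<open>e w\<close>.\<close>
    also have "\<dots> = (\<Sum>w\<in>S. Sum_any (P w) + Sum_any (Q w))"
      by (simp add: Sum_any.distrib[OF finP finQ'] Sum_any_translate)
    also have "\<dots> = (\<Sum>w\<in>S. Upow (nat (qdiff_near G K S w)) (mapA \<phi> (K, S - {w})) +
        Upow (nat (qdiff_far G K S w)) (mapA \<phi> (?s w, S - {w})))"
    proof (rule sum.cong[OF refl])
      fix w assume w: "w \<in> S"
      have S': "S - {w} \<subseteq> verts G" using S by auto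
      have "Upow (nat (qdiff_near G K S w)) (mapA \<phi> (K, S - {w}))
        = Sum_any (\<lambda>l. Upow (nat (qdiff_near G K S w)) (Upow (nat (aexp l K (S - {w}))) (\<phi> (b K (2 * l - 1), S - {w}))))"
        unfolding mapA_apply[OF K S'] using cochains_finite[OF \<phi>]
        by (intro Sum_any_additive finite_fibre_Upow) (auto intro: injI simp: Upow_add)
      also have "\<dots> = Sum_any (P w)"
        using aexp_ge(2)[OF K S'] qdiff_near_nonneg[of S G K w]
        by (simp add: Upow_nat_Upow_nat P_def aexp_def qdiff_near_eq algebra_simps)
      finally have near: "Upow (nat (qdiff_near G K S w)) (mapA \<phi> (K, S - {w})) = Sum_any (P w)" .
      have "Upow (nat (qdiff_far G K S w)) (mapA \<phi> (?s w, S - {w}))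
        = Sum_any (\<lambda>l. Upow (nat (qdiff_far G K S w)) (Upow (nat (aexp l (?s w) (S - {w}))) (\<phi> (b (?s w) (2 * l - 1), S - {w}))))"
        unfolding mapA_apply[OF shift_Char[OF K] S'] using cochains_finite[OF \<phi>]
        by (intro Sum_any_additive finite_fibre_Upow) (auto intro: injI simp: Upow_add)
      also have "\<dots> = Sum_any (Q w)"
      proof -
        have "qdiff_far G K S w + aexp l (?s w) (S - {w}) = tri l + qmax G K S
          - qmax G1 (b (?s w) (2 * l - 1)) (S - {w}) - qrel G K {w}" for l
          using qdiff_far_eq[OF K S, of w] w by (simp add: aexp_def)
        then show ?thesis
          using aexp_ge(2)[OF shift_Char[OF K] S'] qdiff_far_nonneg[of S w G K] w
          by (simp add: Upow_nat_Upow_nat Q_def)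
      qed
      finally show "Sum_any (P w) + Sum_any (Q w) = Upow (nat (qdiff_near G K S w)) (mapA \<phi> (K, S - {w})) +
        Upow (nat (qdiff_far G K S w)) (mapA \<phi> (?s w, S - {w}))"
        using near by simp
    qed
    also have "\<dots> = lattice_cobd G (mapA \<phi>) (K, S)"
      using K S by (simp add: lattice_cobd_apply)
    finally show ?thesis .
  qed
  then show ?thesis
    by (auto simp: fun_eq_iff mapA_def[of "lattice_cobd G1 \<phi>"] lattice_cobd_def[of G])
qed

lemma mapA_cochain_map: "mapA \<in> cochain_maps FU (lattice_complex G1) (lattice_complex G)"
proof -
  note [simp del] = lattice_complex_simps(6)
  show ?thesis
    using mapA_piece
    by (auto simp: cochain_maps_def graded_maps_def linear_maps_def mapA_closed mapA_add
        mapA_smult mapA_cobd)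
qed

section \<open>Restriction to G - v and the map B\<close>

definition proj :: "('v \<Rightarrow>\<^sub>0 int) \<Rightarrow> ('v \<Rightarrow>\<^sub>0 int)" where
  "proj x = x - Poly_Mapping.single v (Poly_Mapping.lookup x v)"

definition res :: "'v functional \<Rightarrow> 'v functional" where
  "res K = restrict K (lattice G0)"

text \<open>A section of \<open>res\<close>: on E_v it takes the weight of \<open>v\<close>, a
  canonical value of the required parity.\<close>

definition sec :: "'v functional \<Rightarrow> 'v functional" where
  "sec k = restrict (\<lambda>x. k (proj x) + Poly_Mapping.lookup x v * weight G v) (lattice G)"

lemma verts_delete [simp]: "verts G0 = verts G - {v}"
  by (simp add: delete_vertex_def)

lemma lattice_delete: "lattice G0 = {x \<in> lattice G. Poly_Mapping.lookup x v = 0}"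
  by (auto simp: lattice_def in_keys_iff)

lemma lookup_proj: "Poly_Mapping.lookup (proj x) w = (if w = v then 0 else Poly_Mapping.lookup x w)"
  by (auto simp: proj_def lookup_minus lookup_single when_def)

lemma proj_lattice: "x \<in> lattice G \<Longrightarrow> proj x \<in> lattice G0"
  by (auto simp: lattice_def in_keys_iff lookup_proj split: if_splits)

lemma proj_id: "x \<in> lattice G0 \<Longrightarrow> proj x = x"
  by (simp add: lattice_delete proj_def)

lemma proj_add: "proj (x + y) = proj x + proj y"
  by (simp add: proj_def lookup_add single_add)

lemma proj_decomp: "x = proj x + Poly_Mapping.single v (Poly_Mapping.lookup x v)"
  by (simp add: proj_def)

lemma form_delete:
  assumes "x \<in> lattice G0" "y \<in> lattice G0"
  shows "form G0 x y = form G x y"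
proof -
  have xy: "Poly_Mapping.lookup x v = 0" "Poly_Mapping.lookup y v = 0"
    using assms by (auto simp: lattice_delete)
  have "gram G0 u w = gram G u w" if "u \<noteq> v" "w \<noteq> v" for u w
  proof -
    have "{e \<in> edges G0. ends G0 e = {u, w}} = {e \<in> edges G. ends G e = {u, w}}"
      using that by (auto simp: delete_vertex_def)
    then show ?thesis
      by (simp add: gram_def delete_vertex_def)
  qed
  then have "form G0 x y = (\<Sum>u\<in>verts G - {v}. \<Sum>w\<in>verts G - {v}.
      Poly_Mapping.lookup x u * Poly_Mapping.lookup y w * gram G u w)"
    by (simp add: form_def)
  then show ?thesis
    using xy finV v by (simp add: form_def sum.remove[of "verts G" v])
qed

lemma form_single: "form G (Poly_Mapping.single v m) (Poly_Mapping.single v n) = m * n * weight G v"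
proof -
  have "form G (Poly_Mapping.single v m) (Poly_Mapping.single v n)
    = (\<Sum>u\<in>verts G. if u = v then (\<Sum>w\<in>verts G. if w = v then m * n * gram G u w else 0) else 0)"
    unfolding form_def
    by (intro sum.cong) (auto simp: lookup_single when_def intro!: sum.cong)
  then show ?thesis
    using finV v by (simp add: sum.delta gram_def)
qed

lemma single_lattice: "Poly_Mapping.single v n \<in> lattice G"
  using v by (simp add: lattice_def)

lemma Char_single:
  assumes K: "K \<in> Char G"
  shows "K (Poly_Mapping.single v n) = n * K (basis_vec v)"
proof (induction n rule: int_induct[where k = 0])
  case base
  then show ?case using Char_zero[OF K] by simp
next
  case (step1 i)
  then show ?case
    using Char_add[OF K single_lattice[of i] single_lattice[of 1]]
    by (simp add: basis_vec_def algebra_simps flip: single_add)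
next
  case (step2 i)
  then show ?case
    using Char_add[OF K single_lattice[of "i - 1"] single_lattice[of 1]]
    by (simp add: basis_vec_def algebra_simps flip: single_add)
qed

lemma sec_Char:
  assumes k: "k \<in> Char G0"
  shows "sec k \<in> Char G"
proof (rule CharI)
  fix x y assume "x \<in> lattice G" "y \<in> lattice G"
  then show "sec k (x + y) = sec k x + sec k y"
    by (simp add: sec_def lattice_add proj_add Char_add[OF k] proj_lattice lookup_add algebra_simps)
next
  fix x assume x: "x \<in> lattice G"
  let ?s = "Poly_Mapping.single v (Poly_Mapping.lookup x v)"
  have "form G x x = form G (proj x + ?s) (proj x + ?s)"
    using proj_decomp[of x] by simp
  also have "\<dots> = form G (proj x) (proj x) + 2 * form G (proj x) ?s
      + Poly_Mapping.lookup x v * Poly_Mapping.lookup x v * weight G v"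
    using form_sym[of G ?s "proj x"] by (simp add: form_add_left form_add_right form_single)
  \<comment> \<open>The cross term is even, and the square of the coordinate at \<open>v\<close> has
    the parity of the coordinate itself.\<close>
  also have "\<dots> mod 2 = (k (proj x) + Poly_Mapping.lookup x v * weight G v) mod 2"
    using Char_mod[OF k proj_lattice[OF x]] proj_lattice[OF x]
    by (simp add: form_delete mod2_eq_if split: if_splits)
  finally show "sec k x mod 2 = form G x x mod 2"
    using x by (simp add: sec_def)
qed (simp add: sec_def)

lemma res_Char:
  assumes K: "K \<in> Char G"
  shows "res K \<in> Char G0"
proof (rule CharI)
  fix x y assume xy: "x \<in> lattice G0" "y \<in> lattice G0"
  then have "x \<in> lattice G" "y \<in> lattice G"
    by (auto simp: lattice_delete)
  then show "res K (x + y) = res K x + res K y"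
    using xy by (simp add: res_def lattice_add Char_add[OF K])
next
  fix x assume "x \<in> lattice G0"
  moreover from this have "x \<in> lattice G"
    by (simp add: lattice_delete)
  ultimately show "res K x mod 2 = form G0 x x mod 2"
    using Char_mod[OF K] by (simp add: res_def form_delete)
qed (simp add: res_def)

lemma res_sec: "k \<in> Char G0 \<Longrightarrow> res (sec k) = k"
  by (rule Char_eqI[symmetric])
    (auto simp: res_def sec_def proj_id lattice_delete)

lemma res_bump: "res (b K j) = res K"
  by (auto simp: res_def bump_def restrict_def lattice_delete)

lemma res_shift: "x \<in> lattice G0 \<Longrightarrow> res (shift G K x) = shift G0 (res K) x"
  unfolding res_def shift_def restrict_def
  by (auto simp: form_delete fun_eq_iff lattice_delete)

text \<open>\<open>K\<close> is determined by its restriction and its value on E_v. This value has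
  the parity of the weight, so half the difference from the section is an integral index.\<close>

lemma fibre:
  assumes K: "K \<in> Char G"
  obtains i where "K = b (sec (res K)) (2 * i)"
proof
  let ?i = "(K (basis_vec v) - weight G v) div 2"
  have "K (basis_vec v) mod 2 = weight G v mod 2"
    using Char_mod[OF K basis_vec_lattice[OF v]] form_single[of 1 1] by (simp add: basis_vec_def)
  then have "even (K (basis_vec v) - weight G v)"
    by presburger
  then have i: "2 * ?i = K (basis_vec v) - weight G v"
    by simp
  show "K = b (sec (res K)) (2 * ?i)"
  proof (rule Char_eqI[OF K])
    fix x assume x: "x \<in> lattice G"
    then have "proj x \<in> lattice G"
      using proj_lattice by (auto simp: lattice_delete)
    then have "K (proj x + Poly_Mapping.single v (Poly_Mapping.lookup x v))
      = K (proj x) + Poly_Mapping.lookup x v * K (basis_vec v)"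
      using single_lattice Char_add[OF K] Char_single[OF K] by simp
    then have "K x = K (proj x) + Poly_Mapping.lookup x v * K (basis_vec v)"
      using proj_decomp[of x] by simp
    then show "K x = b (sec (res K)) (2 * ?i) x"
      unfolding i using x proj_lattice[OF x]
      by (simp add: bump_apply sec_def res_def algebra_simps)
  qed (simp add: bump_def)
qed

lemma qrel_res:
  assumes "T \<subseteq> verts G0"
  shows "qrel G0 (res K) T = qrel G K T"
  using basis_sum_lattice[OF assms] by (simp add: qrel_def res_def form_delete)

text \<open>All vertices of a cube without direction \<open>v\<close> avoid \<open>v\<close>, so its
  exponents depend on the restriction alone. This is why \<open>mapB\<close> needs no powers of
  \<open>U\<close>.\<close>

lemma qdiff_res:
  assumes "S \<subseteq> verts G0" "w \<in> S"
  shows "qdiff_near G0 (res K) S w = qdiff_near G K S w"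
    and "qdiff_far G0 (res K) S w = qdiff_far G K S w"
proof -
  have "qrel G0 (res K) ` Pow S' = qrel G K ` Pow S'" if "S' \<subseteq> S" for S'
    using assms that by (intro image_cong refl qrel_res) auto
  moreover have "(\<lambda>T. qrel G0 (res K) (T \<union> {w})) ` Pow (S - {w}) = (\<lambda>T. qrel G K (T \<union> {w})) ` Pow (S - {w})"
    using assms by (intro image_cong refl qrel_res) auto
  ultimately show "qdiff_near G0 (res K) S w = qdiff_near G K S w"
    "qdiff_far G0 (res K) S w = qdiff_far G K S w"
    by (simp_all add: qdiff_near_def qdiff_far_def)
qed

text \<open>Values on cubes in direction \<open>v\<close> are dropped. The differential allows this:
  on a cube it only reads faces, and faces of a cube without direction \<open>v\<close> lack that
  direction too.\<close>

definition mapB :: "'v cochain \<Rightarrow> 'v cochain" where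
  "mapB \<phi> = (\<lambda>(k, S). if k \<in> Char G0 \<and> S \<subseteq> verts G0 then
     Sum_any (\<lambda>i. \<phi> (b (sec k) (2 * i), S)) else 0)"

lemma mapB_apply:
  "k \<in> Char G0 \<Longrightarrow> S \<subseteq> verts G0 \<Longrightarrow> mapB \<phi> (k, S) = Sum_any (\<lambda>i. \<phi> (b (sec k) (2 * i), S))"
  by (simp add: mapB_def)

lemma finite_fibre_even:
  assumes "\<phi> \<in> cochains G"
  shows "finite {i. \<phi> (b K (2 * i), S) \<noteq> 0}"
  using finite_fibre[OF cochains_finite[OF assms], of "\<lambda>i. 2 * i"]
  by (auto intro: injI)

lemma mapB_add:
  assumes "\<phi> \<in> cochains G" "\<psi> \<in> cochains G"
  shows "mapB (\<phi> + \<psi>) = mapB \<phi> + mapB \<psi>"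
  using assms[THEN finite_fibre_even]
  by (auto simp: mapB_def fun_eq_iff Sum_any.distrib)

lemma mapB_smult:
  assumes "\<phi> \<in> cochains G"
  shows "mapB (\<lambda>p. tower_smult r (\<phi> p)) = (\<lambda>p. tower_smult r (mapB \<phi> p))"
  using Sum_any_additive[of "tower_smult r", OF tower_smult_add tower_smult_zero finite_fibre_even[OF assms]]
  by (auto simp: mapB_def fun_eq_iff)

lemma mapB_nonzero:
  assumes "mapB \<phi> (k, S) \<noteq> 0"
  obtains i where "k \<in> Char G0" "S \<subseteq> verts G0" "\<phi> (b (sec k) (2 * i), S) \<noteq> 0"
proof -
  have kS: "k \<in> Char G0" "S \<subseteq> verts G0"
    using assms by (auto simp: mapB_def split: if_splits)
  then show ?thesis
    using assms that by (auto simp: mapB_apply elim: Sum_any.not_neutral_obtains_not_neutral)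
qed

lemma mapB_closed:
  assumes \<phi>: "\<phi> \<in> cochains G"
  shows "mapB \<phi> \<in> cochains G0"
proof (rule cochainsI)
  have "{p. mapB \<phi> p \<noteq> 0} \<subseteq> (\<lambda>(K, S). (res K, S)) ` {p. \<phi> p \<noteq> 0}"
  proof
    fix p assume "p \<in> {p. mapB \<phi> p \<noteq> 0}"
    moreover obtain k S where [simp]: "p = (k, S)" by force
    ultimately obtain i where k: "k \<in> Char G0" and i: "\<phi> (b (sec k) (2 * i), S) \<noteq> 0"
      using mapB_nonzero[of \<phi> k S] by auto
    have "p = (\<lambda>(K, S). (res K, S)) (b (sec k) (2 * i), S)"
      using k by (simp add: res_bump res_sec)
    then show "p \<in> (\<lambda>(K, S). (res K, S)) ` {p. \<phi> p \<noteq> 0}"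
      using i by blast
  qed
  then show "finite {p. mapB \<phi> p \<noteq> 0}"
    using cochains_finite[OF \<phi>] by (auto elim!: finite_subset)
next
  show "k \<in> Char G0 \<and> S \<subseteq> verts G0" if "mapB \<phi> (k, S) \<noteq> 0" for k S
    using that by (auto simp: mapB_def split: if_splits)
qed

lemma mapB_piece:
  assumes "\<phi> \<in> piece (lattice_complex G) s"
  shows "mapB \<phi> \<in> piece (lattice_complex G0) s"
proof -
  have "int (card S) = s" if "mapB \<phi> (k, S) \<noteq> 0" for k S
    using mapB_nonzero[OF that] assms unfolding lattice_complex_simps by blast
  then show ?thesis
    using assms mapB_closed by simp
qed

lemma mapB_cobd:
  assumes \<phi>: "\<phi> \<in> cochains G"
  shows "mapB (lattice_cobd G \<phi>) = lattice_cobd G0 (mapB \<phi>)"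
proof -
  have "mapB (lattice_cobd G \<phi>) (k, S) = lattice_cobd G0 (mapB \<phi>) (k, S)"
    if k: "k \<in> Char G0" and S: "S \<subseteq> verts G0" for k S
  proof -
    have SG: "S \<subseteq> verts G" using S by auto
    let ?s = "\<lambda>w. shift G0 k (basis_vec w)"
    have lat: "basis_vec w \<in> lattice G0" if "w \<in> S" for w
      using that S by (intro basis_vec_lattice) auto
    \<comment> \<open>A shift by a neighbour of \<open>v\<close> also moves the value on E_v, so
      \<open>sec\<close> commutes with shifts only up to an even bump. The sum over the fibre
      absorbs it.\<close>
    have "\<exists>c. shift G (sec k) (basis_vec w) = b (sec (?s w)) (2 * c)" if w: "w \<in> S" for w
      using fibre[OF shift_Char[OF sec_Char[OF k]], of "basis_vec w"] res_shift[OF lat[OF w]]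
        res_sec[OF k] by metis
    then obtain c where c: "\<And>w. w \<in> S \<Longrightarrow> shift G (sec k) (basis_vec w) = b (sec (?s w)) (2 * c w)"
      by metis
    define P where "P = (\<lambda>w i. Upow (nat (qdiff_near G0 k S w)) (\<phi> (b (sec k) (2 * i), S - {w})))"
    define Q where "Q = (\<lambda>w i. Upow (nat (qdiff_far G0 k S w)) (\<phi> (b (sec (?s w)) (2 * i), S - {w})))"
    have finP: "finite {i. P w i \<noteq> 0}" for w
      unfolding P_def using cochains_finite[OF \<phi>] by (intro finite_fibre_Upow) (auto intro: injI)
    have finQ: "finite {i. Q w (i + d) \<noteq> 0}" for w d
      unfolding Q_def using cochains_finite[OF \<phi>]
      by (intro finite_fibre_Upow[where h = "\<lambda>i. 2 * (i + d)"]) (auto intro: injI)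
    have "lattice_cobd G \<phi> (b (sec k) (2 * i), S) = (\<Sum>w\<in>S. P w i + Q w (i + c w))" for i
    proof -
      let ?K = "b (sec k) (2 * i)"
      have K: "?K \<in> Char G"
        using sec_Char[OF k] by (rule bump_even) simp
      have "res ?K = k"
        using k by (simp add: res_bump res_sec)
      then have "qdiff_near G ?K S w = qdiff_near G0 k S w" "qdiff_far G ?K S w = qdiff_far G0 k S w"
        if "w \<in> S" for w
        using qdiff_res[OF S that, of ?K] by simp_all
      moreover have "shift G ?K (basis_vec w) = b (sec (?s w)) (2 * (i + c w))" if "w \<in> S" for w
        using c[OF that] by (simp add: bump_shift bump_bump algebra_simps)
      ultimately show ?thesis
        using K SG by (simp add: lattice_cobd_apply P_def Q_def)
    qed
    then have "mapB (lattice_cobd G \<phi>) (k, S) = Sum_any (\<lambda>i. \<Sum>w\<in>S. P w i + Q w (i + c w))"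
      using k S by (simp add: mapB_apply)
    also have "\<dots> = (\<Sum>w\<in>S. Sum_any (\<lambda>i. P w i + Q w (i + c w)))"
    proof (intro Sum_any_sum finS[OF SG])
      show "finite {i. P w i + Q w (i + c w) \<noteq> 0}" for w
        by (rule finite_subset[OF _ finite_UnI[OF finP[of w] finQ[of w "c w"]]]) auto
    qed
    also have "\<dots> = (\<Sum>w\<in>S. Sum_any (P w) + Sum_any (Q w))"
      by (simp add: Sum_any.distrib[OF finP finQ] Sum_any_translate)
    also have "\<dots> = (\<Sum>w\<in>S. Upow (nat (qdiff_near G0 k S w)) (mapB \<phi> (k, S - {w})) +
        Upow (nat (qdiff_far G0 k S w)) (mapB \<phi> (?s w, S - {w})))"
    proof (rule sum.cong[OF refl])
      fix w assume w: "w \<in> S"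
      have S': "S - {w} \<subseteq> verts G0" using S by auto
      have U: "Upow n (Sum_any (\<lambda>i. \<phi> (b K (2 * i), S'))) = Sum_any (\<lambda>i. Upow n (\<phi> (b K (2 * i), S')))"
        for n K S'
        using finite_fibre_even[OF \<phi>] by (intro Sum_any_additive) (auto simp: Upow_add)
      show "Sum_any (P w) + Sum_any (Q w) = Upow (nat (qdiff_near G0 k S w)) (mapB \<phi> (k, S - {w})) +
        Upow (nat (qdiff_far G0 k S w)) (mapB \<phi> (?s w, S - {w}))"
        unfolding mapB_apply[OF k S'] mapB_apply[OF shift_Char[OF k] S'] U
        by (simp add: P_def Q_def)
    qed
    also have "\<dots> = lattice_cobd G0 (mapB \<phi>) (k, S)"
      using k S by (simp add: lattice_cobd_apply)
    finally show ?thesis .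
  qed
  then show ?thesis
    by (auto simp: fun_eq_iff mapB_def[of "lattice_cobd G \<phi>"] lattice_cobd_def[of G0])
qed

lemma mapB_cochain_map: "mapB \<in> cochain_maps FU (lattice_complex G) (lattice_complex G0)"
proof -
  note [simp del] = lattice_complex_simps(6)
  show ?thesis
    using mapB_piece
    by (auto simp: cochain_maps_def graded_maps_def linear_maps_def mapB_closed mapB_add
        mapB_smult mapB_cobd)
qed

text \<open>Each prescribed fibre sum is realised by a single term, placed on the section; this
  keeps the support finite.\<close>

lemma mapB_surj:
  assumes \<xi>: "\<xi> \<in> cochains G0"
  shows "\<exists>\<phi>\<in>cochains G. mapB \<phi> = \<xi>"
proof
  define \<phi> where "\<phi> = (\<lambda>(K, S). if K \<in> Char G \<and> K = sec (res K) then \<xi> (res K, S) else 0)"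
  show "\<phi> \<in> cochains G"
  proof (rule cochainsI)
    have "{p. \<phi> p \<noteq> 0} \<subseteq> (\<lambda>(k, S). (sec k, S)) ` {p. \<xi> p \<noteq> 0}"
      by (force simp: \<phi>_def split: if_splits)
    then show "finite {p. \<phi> p \<noteq> 0}"
      using cochains_finite[OF \<xi>] by (auto elim!: finite_subset)
    show "K \<in> Char G \<and> S \<subseteq> verts G" if "\<phi> (K, S) \<noteq> 0" for K S
      using that cochains_support[OF \<xi>, of "res K" S] by (auto simp: \<phi>_def split: if_splits)
  qed
  have "mapB \<phi> (k, S) = \<xi> (k, S)" if k: "k \<in> Char G0" and S: "S \<subseteq> verts G0" for k S
  proof -
    have "b (sec k) (2 * i) = sec k \<longleftrightarrow> i = 0" for i
      using bump_inj[of "sec k" "2 * i" 0] sec_Char[OF k] by simp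
    moreover have "b (sec k) (2 * i) \<in> Char G" for i
      using sec_Char[OF k] by (rule bump_even) simp
    ultimately have "\<phi> (b (sec k) (2 * i), S) = (if i = 0 then \<xi> (k, S) else 0)" for i
      using k sec_Char[OF k] by (auto simp: \<phi>_def res_bump res_sec)
    then show ?thesis
      using k S by (simp add: mapB_apply)
  qed
  moreover have "\<xi> (k, S) = 0" if "\<not> (k \<in> Char G0 \<and> S \<subseteq> verts G0)" for k S
    using cochains_support[OF \<xi>] that by blast
  ultimately show "mapB \<phi> = \<xi>"
    by (force simp: mapB_def)
qed

end

section \<open>Exactness of the surgery sequence\<close>

definition delta :: "'a \<Rightarrow> tower \<Rightarrow> 'a \<Rightarrow> tower" where
  "delta p t = (\<lambda>q. if q = p then t else 0)"

lemma delta_closed: "K \<in> Char G \<Longrightarrow> S \<subseteq> verts G \<Longrightarrow> delta (K, S) t \<in> cochains G"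
  by (rule cochainsI) (auto simp: delta_def split: if_splits)

lemma cochain_cancel: "(\<phi> + \<psi>) + (\<psi> + \<xi>) = (\<phi> + \<xi> :: 'a \<Rightarrow> tower)"
proof -
  have "(\<phi> + \<psi>) + (\<psi> + \<xi>) = \<phi> + (\<psi> + \<psi>) + \<xi>"
    by (simp only: add.assoc)
  then show ?thesis by simp
qed

text \<open>The range is a union of orbits of l -> 1 - l, which has no integral fixed point, so all
  terms cancel in pairs.\<close>

lemma sum_tower_reflect:
  fixes f :: "int \<Rightarrow> tower"
  assumes "\<And>l. f (1 - l) = f l"
  shows "(\<Sum>l = 1 - int N..int N. f l) = 0"
proof (induction N)
  case (Suc N)
  have "{1 - int (Suc N)..int (Suc N)} = insert (int (Suc N)) (insert (- int N) {1 - int N..int N})"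
    by auto
  moreover have "f (int (Suc N)) = f (- int N)"
    using assms[of "- int N"] by (simp add: add.commute)
  ultimately show ?case
    using Suc by (simp add: add.assoc[symmetric])
qed simp

context vertex_graph
begin

section \<open>The indices at which the exponent of A vanishes\<close>

lemma aexp_notin:
  assumes K: "K \<in> Char G" and S: "S \<subseteq> verts G" and vS: "v \<notin> S"
  shows "aexp l K S = tri l"
proof -
  have "qrel G1 (b K (2 * l - 1)) ` Pow S = qrel G K ` Pow S"
  proof (rule image_cong[OF refl])
    fix T assume "T \<in> Pow S"
    then have "T \<subseteq> verts G" "v \<notin> T" using S vS by auto
    then show "qrel G1 (b K (2 * l - 1)) T = qrel G K T"
      using qrel_bump[OF K] by simp
  qed
  then show ?thesis
    by (simp add: aexp_def qmax_def)
qed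

text \<open>
  For \<open>v \<in> S\<close> the exponents of \<open>A\<close> on a fibre are governed by the difference \<open>gap\<close> of the maxima
  over the two opposite faces of the cube in direction \<open>v\<close>.
\<close>

definition gap :: "'v functional \<Rightarrow> 'v set \<Rightarrow> int" where
  "gap K S = Max (qrel G1 K ` Pow (S - {v})) - Max ((\<lambda>T. qrel G1 K (insert v T)) ` Pow (S - {v}))"

lemma Max_Pow_split:
  fixes f :: "'v set \<Rightarrow> int"
  assumes "finite S" "v \<in> S"
  shows "Max (f ` Pow S) = max (Max (f ` Pow (S - {v}))) (Max ((\<lambda>T. f (insert v T)) ` Pow (S - {v})))"
  proof -
  have "Pow S = Pow (S - {v}) \<union> insert v ` Pow (S - {v})"
    using assms(2) Pow_insert[of v "S - {v}"] by (simp add: insert_absorb)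
  then have "f ` Pow S = f ` Pow (S - {v}) \<union> (\<lambda>T. f (insert v T)) ` Pow (S - {v})"
    by (simp add: image_Un image_image)
  moreover have "finite (Pow (S - {v}))" "Pow (S - {v}) \<noteq> {}"
    using assms(1) by auto
  ultimately show ?thesis
    by (simp add: Max_Un)
qed

text \<open>From \<open>G1\<close> to \<open>G\<close> the maximum over the face without
  \<open>v\<close> stays and that over the face with \<open>v\<close> rises by \<open>l\<close>.
  Subtracting the latter's value in \<open>G1\<close> from both cube maxima leaves the gap as the
  only parameter.\<close>

lemma aexp_in:
  assumes K: "K \<in> Char G" and S: "S \<subseteq> verts G" and vS: "v \<in> S"
  shows "aexp l K S = tri l + max (gap (b K (2 * l - 1)) S) l - max (gap (b K (2 * l - 1)) S) 0"
proof -
  let ?K = "b K (2 * l - 1)"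
  note fin = finS[OF S]
  have sub: "T \<subseteq> verts G \<and> v \<notin> T \<and> insert v T \<subseteq> verts G" if "T \<in> Pow (S - {v})" for T
    using that S v by auto
  have "qrel G K ` Pow (S - {v}) = qrel G1 ?K ` Pow (S - {v})"
    using sub qrel_bump[OF K, of _ l] by (intro image_cong refl) simp
  moreover have "(\<lambda>T. qrel G K (insert v T)) ` Pow (S - {v})
    = (\<lambda>T. qrel G1 ?K (insert v T) + l) ` Pow (S - {v})"
    using sub qrel_bump[OF K, of _ l] by (intro image_cong refl) simp
  moreover have "Max ((\<lambda>T. qrel G1 ?K (insert v T) + l) ` Pow (S - {v}))
    = Max ((\<lambda>T. qrel G1 ?K (insert v T)) ` Pow (S - {v})) + l"
    using fin by (intro Max_add_commute) auto
  ultimately show ?thesis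
    by (simp add: aexp_def qmax_def Max_Pow_split[OF fin vS] gap_def)
qed

text \<open>The gap is an affine coordinate of slope one on each fibre, so its absolute value can
  order the points for the triangularity argument.\<close>

lemma gap_bump:
  assumes K: "K \<in> Char G1" and S: "S \<subseteq> verts G"
  shows "gap (b K (2 * i)) S = gap K S + i"
proof -
  note fin = finS[OF S]
  have sub: "T \<subseteq> verts G \<and> v \<notin> T \<and> insert v T \<subseteq> verts G" if "T \<in> Pow (S - {v})" for T
    using that S v by auto
  have "qrel G1 (b K (2 * i)) ` Pow (S - {v}) = qrel G1 K ` Pow (S - {v})"
    using sub qrel_bump_raise[OF K, of _ i] by (intro image_cong refl) simp
  moreover have "(\<lambda>T. qrel G1 (b K (2 * i)) (insert v T)) ` Pow (S - {v})
    = (\<lambda>T. qrel G1 K (insert v T) + (- i)) ` Pow (S - {v})"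
    using sub qrel_bump_raise[OF K, of _ i] by (intro image_cong refl) simp
  moreover have "Max ((\<lambda>T. qrel G1 K (insert v T) + (- i)) ` Pow (S - {v}))
    = Max ((\<lambda>T. qrel G1 K (insert v T)) ` Pow (S - {v})) + (- i)"
    using fin by (intro Max_add_commute) auto
  ultimately show ?thesis
    by (simp add: gap_def)
qed

lemma tri_ge_1: "l \<noteq> 0 \<Longrightarrow> l \<noteq> 1 \<Longrightarrow> 1 \<le> tri l"
  using tri_ge[of l] by (cases "l = -1") (auto simp: tri_def)

lemma aexp_eq_0_notin:
  assumes "K \<in> Char G" "S \<subseteq> verts G" "v \<notin> S"
  shows "{l. aexp l K S = 0} = {0, 1}"
  using tri_ge_1 by (force simp: aexp_notin[OF assms] tri_def)

text \<open>Seen from the source \<open>M = b K (2 * l - 1)\<close>: the target \<open>b M 1\<close>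
  always has exponent 0, and there is one further such target, \<open>b M (-1)\<close> for positive
  and \<open>b M 3\<close> for negative gap of \<open>M\<close>. If a target \<open>K\<close> is
  labelled by the gap of \<open>b K (-1)\<close>, the first has the label of \<open>M\<close> and
  the second is one step closer to 0. This is the triangularity.\<close>

lemma aexp_eq_0_in:
  assumes K: "K \<in> Char G" and S: "S \<subseteq> verts G" and vS: "v \<in> S"
  shows "aexp l K S = 0 \<longleftrightarrow> l = 0 \<or> l = 1 \<and> 1 \<le> gap (b K (2 * l - 1)) S
    \<or> l = -1 \<and> gap (b K (2 * l - 1)) S \<le> -1"
proof -
  let ?y = "gap (b K (2 * l - 1)) S"
  have eq: "aexp l K S = tri l + max ?y l - max ?y 0"
    using assms by (rule aexp_in)
  consider "l = 0" | "l = 1" | "l = -1" | "l \<ge> 2" | "l \<le> -2" by linarith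
  then show ?thesis
  proof cases
    case 4
    then show ?thesis using eq tri_ge_1[of l] by auto
  next
    case 5
    \<comment> \<open>For negative \<open>l\<close> the difference of the two maxima is at least
      \<open>l\<close>, so \<open>tri l + l\<close> bounds the exponent from below.\<close>
    have "tri l + l = tri (- l)"
      using tri_Suc[of l] tri_reflect[of "- l"] by (simp add: add.commute)
    then have "1 \<le> tri l + l"
      using 5 tri_ge_1[of "- l"] by simp
    then show ?thesis using eq 5 by auto
  qed (use eq in \<open>auto simp: tri_def max_def split: if_splits\<close>)
qed

section \<open>Injectivity of A, starting from the socle (the part killed by U)\<close>

lemma mapA_socle:
  assumes U: "\<And>p. Upow 1 (\<phi> p) = 0" and K: "K \<in> Char G" and S: "S \<subseteq> verts G"
    and Z: "finite Z" "{l. aexp l K S = 0} \<subseteq> Z"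
  shows "mapA \<phi> (K, S) = (\<Sum>l\<in>Z. if aexp l K S = 0 then \<phi> (b K (2 * l - 1), S) else 0)"
proof -
  have "Upow (nat (aexp l K S)) (\<phi> (b K (2 * l - 1), S))
    = (if aexp l K S = 0 then \<phi> (b K (2 * l - 1), S) else 0)" for l
    using Upow_eq_0_mono[OF U, of "nat (aexp l K S)"] aexp_ge(2)[OF K S, of l] by auto
  moreover have "Sum_any (\<lambda>l. if aexp l K S = 0 then \<phi> (b K (2 * l - 1), S) else 0)
    = (\<Sum>l\<in>Z. if aexp l K S = 0 then \<phi> (b K (2 * l - 1), S) else 0)"
    using Z by (intro Sum_any.expand_superset) (auto split: if_splits)
  ultimately show ?thesis
    by (simp add: mapA_apply[OF K S])
qed

lemma mapA_socle_notin:
  assumes "\<And>p. Upow 1 (\<phi> p) = 0" and "K \<in> Char G" and "S \<subseteq> verts G" "v \<notin> S"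
  shows "mapA \<phi> (K, S) = \<phi> (b K (-1), S) + \<phi> (b K 1, S)"
proof -
  have "aexp 0 K S = 0" "aexp 1 K S = 0"
    using aexp_eq_0_notin[OF assms(2-4)] by auto
  then show ?thesis
    using assms aexp_eq_0_notin[OF assms(2-4)] by (subst mapA_socle[where Z = "{0, 1}"]) auto
qed

lemma mapA_socle_in:
  assumes "\<And>p. Upow 1 (\<phi> p) = 0" and K: "K \<in> Char G" and S: "S \<subseteq> verts G" "v \<in> S"
    and y: "y = gap (b K (-1)) S"
  shows "mapA \<phi> (K, S) = \<phi> (b K (-1), S) + ((if 0 \<le> y then \<phi> (b K 1, S) else 0)
    + (if y \<le> 0 then \<phi> (b K (-3), S) else 0))"
proof -
  have K': "b K (-1) \<in> Char G1"
    using K by (rule bump_odd) simp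
  have g: "gap (b K 1) S = y + 1" "gap (b K (-3)) S = y - 1"
    using gap_bump[OF K' S(1), of 1] gap_bump[OF K' S(1), of "-1"] by (simp_all add: bump_bump y)
  have "{l. aexp l K S = 0} \<subseteq> {0, 1, -1}"
    using aexp_eq_0_in[OF K S] by auto
  moreover have "aexp 0 K S = 0" "aexp 1 K S = 0 \<longleftrightarrow> 0 \<le> y" "aexp (-1) K S = 0 \<longleftrightarrow> y \<le> 0"
    using aexp_eq_0_in[OF K S, of 0] aexp_eq_0_in[OF K S, of 1] aexp_eq_0_in[OF K S, of "-1"]
    by (auto simp: g)
  ultimately show ?thesis
    using assms by (subst mapA_socle[where Z = "{0, 1, -1}"]) auto
qed

lemma mapA_socle_inj:
  assumes \<phi>: "\<phi> \<in> cochains G1" and U: "\<And>p. Upow 1 (\<phi> p) = 0" and A: "mapA \<phi> = 0"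
  shows "\<phi> = 0"
proof (rule ccontr)
  assume "\<phi> \<noteq> 0"
  then obtain K S where nz: "\<phi> (K, S) \<noteq> 0"
    by (auto simp: fun_eq_iff)
  then have K: "K \<in> Char G1" and S: "S \<subseteq> verts G"
    using cochains_support[OF \<phi>] by auto
  have A0: "mapA \<phi> q = 0" for q
    using A by simp
  show False
  proof (cases "v \<in> S")
    case False
    \<comment> \<open>Vanishing of the sum of neighbours makes \<phi> constant along a ray in the
      fibre, which contradicts finite support.\<close>
    have const: "\<phi> (b K (2 * int n), S) = \<phi> (K, S)" for n
    proof (induction n)
      case 0
      then show ?case using K by simp
    next
      case (Suc n)
      have "b K (2 * int n + 1) \<in> Char G"
        using K by (rule bump_odd') simp
      from mapA_socle_notin[of \<phi>, OF U this S False]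
      have "\<phi> (b K (2 * int n), S) + \<phi> (b K (2 + 2 * int n), S) = 0"
        by (simp add: bump_bump A0)
      then show ?case
        using Suc by (simp add: tower_add_eq_0_iff algebra_simps)
    qed
    have "finite {l. \<phi> (b K (2 * l), S) \<noteq> 0}"
      using finite_fibre[OF cochains_finite[OF \<phi>], of "\<lambda>i. 2 * i"] by (auto intro: injI)
    moreover have "range int \<subseteq> {l. \<phi> (b K (2 * l), S) \<noteq> 0}"
      using const nz by auto
    ultimately have "finite (range int)"
      by (rule finite_subset[rotated])
    then show False
      using range_inj_infinite[of int] by (simp add: inj_def)
  next
    case True
    let ?X = "{K. \<phi> (K, S) \<noteq> 0}"
    have "?X \<subseteq> fst ` {p. \<phi> p \<noteq> 0}"
      by force
    then have "finite ?X"
      using cochains_finite[OF \<phi>] by (auto elim!: finite_subset)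
    then have fin: "finite ((\<lambda>M. \<bar>gap M S\<bar>) ` ?X)"
      by simp
    have "Max ((\<lambda>M. \<bar>gap M S\<bar>) ` ?X) \<in> (\<lambda>M. \<bar>gap M S\<bar>) ` ?X"
      using fin nz by (intro Max_in) auto
    \<comment> \<open>An extremal point: evaluated at \<open>b M 1\<close>, the image consists of
      the value at \<open>M\<close> and of values at points of strictly larger absolute gap, which
      vanish by maximality.\<close>
    then obtain M where M: "\<phi> (M, S) \<noteq> 0" "\<bar>gap M S\<bar> = Max ((\<lambda>M. \<bar>gap M S\<bar>) ` ?X)"
      by auto
    have max: "\<bar>gap M' S\<bar> \<le> \<bar>gap M S\<bar>" if "\<phi> (M', S) \<noteq> 0" for M'
      unfolding M(2) using fin that by (intro Max_ge) auto
    have MC: "M \<in> Char G1"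
      using M(1) cochains_support[OF \<phi>] by auto
    have K': "b M 1 \<in> Char G"
      using MC by (rule bump_odd') simp
    have up: "\<phi> (b M 2, S) = 0" if "0 \<le> gap M S"
      using max[of "b M 2"] gap_bump[OF MC S, of 1] that by auto
    have down: "\<phi> (b M (-2), S) = 0" if "gap M S \<le> 0"
      using max[of "b M (-2)"] gap_bump[OF MC S, of "-1"] that by auto
    show False
      using mapA_socle_in[of \<phi>, OF U K' S True refl] M(1) MC up down
      by (simp add: bump_bump A0 split: if_splits)
  qed
qed

lemma mapA_zero: "mapA 0 = 0"
  by (auto simp: mapA_def fun_eq_iff)

text \<open>A nonzero torsion kernel would meet the socle. If the power \<open>Suc n\<close> of
  \<open>U\<close> kills \<phi>, then \<open>U\<close> to the power \<open>n\<close> times \<phi> is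
  a socle element of the kernel, hence zero; now descend on \<open>n\<close>.\<close>

lemma mapA_inj: "inj_on mapA (cochains G1)"
proof -
  have zero: "\<phi> = 0" if \<phi>: "\<phi> \<in> cochains G1" and A: "mapA \<phi> = 0" for \<phi>
  proof -
    obtain N where N: "\<And>p. Upow N (\<phi> p) = 0"
      using finite_support_bound[OF cochains_finite[OF \<phi>]] by blast
    have "(\<And>p. Upow n (\<phi> p) = 0) \<Longrightarrow> \<phi> = 0" for n
    proof (induction n)
      case 0
      then show ?case by (simp add: fun_eq_iff)
    next
      case (Suc n)
      let ?\<psi> = "\<lambda>p. tower_smult (monom 1 n) (\<phi> p)"
      have "Upow 1 (?\<psi> p) = 0" for p
        using Suc.prems[of p] Upow_Upow[of 1 n "\<phi> p"] by (simp add: Upow_def)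
      moreover have "mapA ?\<psi> = 0"
        using A by (simp add: mapA_smult[OF \<phi>] fun_eq_iff)
      ultimately have "?\<psi> = 0"
        using mapA_socle_inj cochains_smult[OF \<phi>] by blast
      then have "Upow n (\<phi> p) = 0" for p
        by (simp add: Upow_def fun_eq_iff del: split_paired_All)
      then show ?case
        by (rule Suc.IH)
    qed
    then show ?thesis using N by blast
  qed
  show ?thesis
  proof (rule inj_onI)
    fix \<phi> \<psi> assume a: "\<phi> \<in> cochains G1" "\<psi> \<in> cochains G1" "mapA \<phi> = mapA \<psi>"
    then have "\<phi> + \<psi> \<in> cochains G1" "mapA (\<phi> + \<psi>) = 0"
      by (simp_all add: cochains_add mapA_add)
    then have "\<phi> + \<psi> = 0"
      by (rule zero)
    then have "(\<phi> + \<psi>) p = 0" for p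
      by simp
    then show "\<phi> = \<psi>"
      by (intro ext) (simp add: tower_add_eq_0_iff)
  qed
qed

lemma mapB_mapA:
  assumes \<phi>: "\<phi> \<in> cochains G1"
  shows "mapB (mapA \<phi>) = 0"
proof -
  have "Sum_any (\<lambda>i. mapA \<phi> (b (sec k) (2 * i), S)) = 0"
    if k: "k \<in> Char G0" and S: "S \<subseteq> verts G0" for k S
  proof -
    have SG: "S \<subseteq> verts G" "v \<notin> S" using S by auto
    obtain N where N: "\<And>p. Upow N (\<phi> p) = 0"
      using finite_support_bound[OF cochains_finite[OF \<phi>]] by blast
    define g where "g = (\<lambda>i. \<phi> (b (sec k) (2 * i - 1), S))"
    have fin: "finite {i. f (g (i + l)) \<noteq> 0}" if "f 0 = 0" for f :: "tower \<Rightarrow> tower" and l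
    proof (rule finite_subset)
      show "{i. f (g (i + l)) \<noteq> 0} \<subseteq> {i. \<phi> (b (sec k) (2 * (i + l) - 1), S) \<noteq> 0}"
        using that by (auto simp: g_def)
      show "finite {i. \<phi> (b (sec k) (2 * (i + l) - 1), S) \<noteq> 0}"
        using cochains_finite[OF \<phi>] by (rule finite_fibre) (auto intro: injI)
    qed
    \<comment> \<open>Symmetric under l -> 1 - l, and outside this range \<open>tri l\<close> is at
      least \<open>N\<close>, so nothing is lost.\<close>
    let ?L = "{1 - int (N + 1)..int (N + 1)}"
    have "mapA \<phi> (b (sec k) (2 * i), S) = (\<Sum>l\<in>?L. Upow (nat (tri l)) (g (i + l)))" for i
    proof -
      have K: "b (sec k) (2 * i) \<in> Char G"
        using sec_Char[OF k] by (rule bump_even) simp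
      have "mapA \<phi> (b (sec k) (2 * i), S) = Sum_any (\<lambda>l. Upow (nat (tri l)) (g (i + l)))"
        using K SG by (simp add: mapA_apply aexp_notin bump_bump g_def algebra_simps)
      also have "\<dots> = (\<Sum>l\<in>?L. Upow (nat (tri l)) (g (i + l)))"
      proof (rule Sum_any.expand_superset)
        show "{l. Upow (nat (tri l)) (g (i + l)) \<noteq> 0} \<subseteq> ?L"
        proof
          fix l assume "l \<in> {l. Upow (nat (tri l)) (g (i + l)) \<noteq> 0}"
          then have "nat (tri l) < N"
            using Upow_eq_0_mono[OF N, of "nat (tri l)"] by (force simp: g_def)
          then show "l \<in> ?L"
            using tri_ge[of l] tri_ge[of "1 - l"] tri_reflect[of l] by auto
        qed
      qed simp
      finally show ?thesis .
    qed
    then have "Sum_any (\<lambda>i. mapA \<phi> (b (sec k) (2 * i), S))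
      = Sum_any (\<lambda>i. \<Sum>l\<in>?L. Upow (nat (tri l)) (g (i + l)))" by simp
    also have "\<dots> = (\<Sum>l\<in>?L. Sum_any (\<lambda>i. Upow (nat (tri l)) (g (i + l))))"
      by (intro Sum_any_sum fin) auto
    \<comment> \<open>Once the sums are exchanged, every \<open>l\<close> sees the same fibre total,
      since translation by \<open>l\<close> does not change it. What remains depends on
      \<open>l\<close> through \<open>tri l\<close> alone.\<close>
    also have "\<dots> = (\<Sum>l\<in>?L. Upow (nat (tri l)) (Sum_any g))"
    proof (rule sum.cong[OF refl])
      fix l
      have "Sum_any (\<lambda>i. Upow (nat (tri l)) (g (i + l))) = Sum_any (\<lambda>i. Upow (nat (tri l)) (g i))"
        by (rule Sum_any_translate[of "\<lambda>i. Upow (nat (tri l)) (g i)"])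
      also have "\<dots> = Upow (nat (tri l)) (Sum_any g)"
        using fin[of "\<lambda>x. x" 0] by (intro Sum_any_additive[symmetric]) (auto simp: Upow_add)
      finally show "Sum_any (\<lambda>i. Upow (nat (tri l)) (g (i + l))) = Upow (nat (tri l)) (Sum_any g)" .
    qed
    also have "\<dots> = 0"
      by (rule sum_tower_reflect) (simp add: tri_reflect)
    finally show ?thesis .
  qed
  then show ?thesis
    by (auto simp: mapB_def fun_eq_iff)
qed

section \<open>The kernel of B lies in the image of A\<close>

abbreviation "im \<equiv> mapA ` cochains G1"

lemma im_zero: "0 \<in> im"
  using mapA_zero cochains_zero by (metis image_eqI)

lemma im_add: "\<phi> \<in> im \<Longrightarrow> \<psi> \<in> im \<Longrightarrow> \<phi> + \<psi> \<in> im"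
  using mapA_add cochains_add by (smt (verit, best) imageE image_eqI)

lemma im_sum: "(\<And>i. i \<in> I \<Longrightarrow> f i \<in> im) \<Longrightarrow> sum f I \<in> im"
  by (induction I rule: infinite_finite_induct) (auto simp: im_zero intro: im_add)

lemma im_cancel: "\<phi> + \<psi> \<in> im \<Longrightarrow> \<psi> \<in> im \<Longrightarrow> \<phi> \<in> im"
  using im_add[of "\<phi> + \<psi>" \<psi>] by (simp add: add.assoc)

text \<open>\<open>mapA\<close> is defined by its rows; this is a column. The target that reads
  \<open>K\<close> with index \<open>l\<close> is found by undoing the bump.\<close>

lemma mapA_delta:
  assumes K: "K \<in> Char G1" and S: "S \<subseteq> verts G" and L: "finite L"
    and zero: "\<And>l. l \<notin> L \<Longrightarrow> Upow (nat (aexp l (b K (1 - 2 * l)) S)) t = 0"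
  shows "mapA (delta (K, S) t)
    = (\<Sum>l\<in>L. delta (b K (1 - 2 * l), S) (Upow (nat (aexp l (b K (1 - 2 * l)) S)) t))"
proof
  fix p :: "'v functional \<times> 'v set"
  obtain M S' where p: "p = (M, S')" by force
  let ?r = "\<lambda>l. delta (b K (1 - 2 * l), S) (Upow (nat (aexp l (b K (1 - 2 * l)) S)) t) p"
  show "mapA (delta (K, S) t) p =
    (\<Sum>l\<in>L. delta (b K (1 - 2 * l), S) (Upow (nat (aexp l (b K (1 - 2 * l)) S)) t)) p"
  proof (cases "M \<in> Char G \<and> S' \<subseteq> verts G")
    case True
    have iff: "b M (2 * l - 1) = K \<longleftrightarrow> b K (1 - 2 * l) = M" for l
      using True K by (auto simp: bump_bump)
    have "mapA (delta (K, S) t) p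
      = Sum_any (\<lambda>l. Upow (nat (aexp l M S')) (delta (K, S) t (b M (2 * l - 1), S')))"
      using True by (simp add: p mapA_apply)
    also have "\<dots> = Sum_any ?r"
      by (intro Sum_any.cong) (auto simp: delta_def p iff)
    also have "\<dots> = sum ?r L"
      using L zero by (intro Sum_any.expand_superset) (auto simp: delta_def)
    finally show ?thesis
      by (simp add: sum_fun_apply)
  next
    case False
    have "b K (1 - 2 * l) \<in> Char G" for l
      using K by (rule bump_odd') simp
    then have "?r l = 0" for l
      using False S by (auto simp: delta_def p)
    then have "sum ?r L = 0"
      by simp
    moreover have "mapA (delta (K, S) t) p = 0"
      using False by (auto simp: mapA_def p)
    ultimately show ?thesis
      by (simp add: sum_fun_apply)
  qed
qed

lemma delta_zero [simp]: "delta p 0 = 0"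
  by (auto simp: delta_def)

text \<open>
  Modulo the image of elements of lower \<open>U\<close>-order, only the terms of exponent \<open>0\<close> matter.
\<close>

lemma im_leading_terms:
  assumes K: "K \<in> Char G1" and S: "S \<subseteq> verts G" and t: "Upow (Suc n) t = 0"
    and IH: "\<And>t K. Upow n t = 0 \<Longrightarrow> K \<in> Char G \<Longrightarrow> delta (K, S) t \<in> im"
    and Z: "{l. aexp l (b K (1 - 2 * l)) S = 0} = Z"
  shows "(\<Sum>l\<in>Z. delta (b K (1 - 2 * l), S) t) \<in> im"
proof -
  have C: "b K (1 - 2 * l) \<in> Char G" for l
    using K by (rule bump_odd') simp
  let ?e = "\<lambda>l. aexp l (b K (1 - 2 * l)) S"
  \<comment> \<open>By the linear bound on exponents, every term outside this range is killed, and
    every index of exponent 0 lies inside.\<close>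
  let ?L = "{- int (Suc n) - 1..int (Suc n) + 1}"
  let ?f = "\<lambda>l. delta (b K (1 - 2 * l), S) (Upow (nat (?e l)) t)"
  have A: "mapA (delta (K, S) t) = sum ?f ?L"
  proof (rule mapA_delta[OF K S])
    fix l assume "l \<notin> ?L"
    then have "Suc n \<le> nat (?e l)"
      using aexp_ge(1)[OF C[of l] S, of l] by auto
    then show "Upow (nat (?e l)) t = 0"
      using Upow_eq_0_mono[OF t] by blast
  qed simp
  have L: "sum ?f ?L \<in> im"
    unfolding A[symmetric] using S by (intro imageI delta_closed[OF K]) simp
  have ZL: "Z \<subseteq> ?L"
  proof
    fix l assume "l \<in> Z"
    then have "?e l = 0" using Z by blast
    then show "l \<in> ?L" using aexp_ge(1)[OF C[of l] S, of l] by auto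
  qed
  have rest: "sum ?f (?L - Z) \<in> im"
  proof (rule im_sum)
    fix l assume "l \<in> ?L - Z"
    then have "0 < ?e l"
      using aexp_ge(2)[OF C[of l] S, of l] Z by (auto simp: order_less_le)
    then have "Suc n \<le> n + nat (?e l)" by simp
    then have "Upow n (Upow (nat (?e l)) t) = 0"
      unfolding Upow_Upow by (rule Upow_eq_0_mono[OF t])
    then show "?f l \<in> im"
      using IH C by blast
  qed
  have split: "sum ?f ?L = sum ?f Z + sum ?f (?L - Z)"
    using ZL by (simp add: add.commute sum.subset_diff)
  have "sum ?f Z \<in> im"
    using im_cancel[OF L[unfolded split] rest] .
  moreover have "sum ?f Z = (\<Sum>l\<in>Z. delta (b K (1 - 2 * l), S) t)"
    using Z by (intro sum.cong) auto
  ultimately show ?thesis by simp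
qed

text \<open>Inversion of a unitriangular map by a double induction. The outer one, on the torsion
  order of \<open>t\<close>, disposes of positive exponents. The inner one, on the absolute gap of
  \<open>b K (-1)\<close>, disposes of the second leading term, which lies one step closer to gap 0;
  at gap 0 there is none.\<close>

lemma delta_in_im:
  assumes S: "S \<subseteq> verts G" and vS: "v \<in> S"
  shows "Upow n t = 0 \<Longrightarrow> K \<in> Char G \<Longrightarrow> delta (K, S) t \<in> im"
proof (induction n arbitrary: t K)
  case 0
  then have zero: "delta (K, S) t = 0" by simp
  show ?case unfolding zero by (rule im_zero)
next
  case (Suc n)
  note lead = im_leading_terms[OF _ S Suc.prems(1) Suc.IH]
  have zero_iff: "aexp l (b M (1 - 2 * l)) S = 0 \<longleftrightarrow>
      l = 0 \<or> l = 1 \<and> 1 \<le> gap M S \<or> l = -1 \<and> gap M S \<le> -1" if M: "M \<in> Char G1" for M l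
  proof -
    have "b M (1 - 2 * l) \<in> Char G"
      using M by (rule bump_odd') simp
    from aexp_eq_0_in[OF this S vS, of l] show ?thesis
      using M by (simp add: bump_bump)
  qed
  have step: "K \<in> Char G \<Longrightarrow> nat \<bar>gap (b K (-1)) S\<bar> = m \<Longrightarrow> delta (K, S) t \<in> im" for m K
  proof (induction m arbitrary: K)
    case 0
    have K': "b K (-1) \<in> Char G1"
      using 0(1) by (rule bump_odd) simp
    show ?case
      using lead[OF K', of "{0}"] zero_iff[OF K'] 0 by (auto simp: bump_bump)
  next
    case (Suc m)
    have K': "b K (-1) \<in> Char G1"
      using Suc(2) by (rule bump_odd) simp
    have C: "b K (2 * i) \<in> Char G" for i
      using Suc(2) by (rule bump_even) simp
    have g: "gap (b (b K (2 * i)) (-1)) S = gap (b K (-1)) S + i" for i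
      using gap_bump[OF K' S, of i] by (simp add: bump_bump algebra_simps)
    show ?case
    proof (cases "1 \<le> gap (b K (-1)) S")
      case True
      have "delta (K, S) t + delta (b K (-2), S) t \<in> im"
        using lead[OF K', of "{0, 1}"] zero_iff[OF K'] True Suc(2) by (auto simp: bump_bump)
      moreover have "delta (b K (-2), S) t \<in> im"
        using Suc.IH[of "b K (-2)"] C[of "-1"] g[of "-1"] True Suc.prems(2) by simp
      ultimately show ?thesis by (rule im_cancel)
    next
      case False
      then have neg: "gap (b K (-1)) S \<le> -1"
        using Suc.prems(2) by auto
      have "delta (K, S) t + delta (b K 2, S) t \<in> im"
        using lead[OF K', of "{0, -1}"] zero_iff[OF K'] neg Suc(2) by (auto simp: bump_bump)
      moreover have "delta (b K 2, S) t \<in> im"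
        using Suc.IH[of "b K 2"] C[of 1] g[of 1] neg Suc.prems(2) by simp
      ultimately show ?thesis by (rule im_cancel)
    qed
  qed
  show ?case
    using step[OF Suc.prems(2) refl] .
qed

text \<open>Without direction \<open>v\<close> only differences along a fibre can be hit, as B kills
  the image. The terms \<open>l\<close> and \<open>1 - l\<close> of a column have equal weight and
  form such a pair, at distance \<open>2 * (2 * l - 1)\<close>. The induction therefore needs pairs
  at any even distance, although each step produces neighbours first.\<close>

lemma delta_pair_in_im:
  assumes S: "S \<subseteq> verts G" and vS: "v \<notin> S"
  shows "Upow n t = 0 \<Longrightarrow> K \<in> Char G \<Longrightarrow> delta (K, S) t + delta (b K (2 * i), S) t \<in> im"
proof (induction n arbitrary: t K i)
  case 0
  then have zero: "delta (K, S) t + delta (b K (2 * i), S) t = 0" by simp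
  show ?case unfolding zero by (rule im_zero)
next
  case (Suc n)
  have adj: "delta (b M 1, S) t + delta (b M (-1), S) t \<in> im" if M: "M \<in> Char G1" for M
  proof -
    have C: "b M j \<in> Char G" if "odd j" for j
      using M that by (rule bump_odd')
    have a: "aexp l (b M (1 - 2 * l)) S = tri l" for l
      using C S vS by (intro aexp_notin) auto
    define f where "f = (\<lambda>l. delta (b M (1 - 2 * l), S) (Upow (nat (tri l)) t))"
    \<comment> \<open>Here \<open>l = j + 1\<close> is matched with
      \<open>1 - l = - j\<close>.\<close>
    have pairs: "(\<Sum>l = 1 - int k..int k. f l) = (\<Sum>j<k. f (int j + 1) + f (- int j))" for k
    proof (induction k)
      case (Suc k)
      have "{1 - int (Suc k)..int (Suc k)} = insert (int k + 1) (insert (- int k) {1 - int k..int k})"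
        by auto
      then show ?case
        using Suc by (simp add: add_ac)
    qed simp
    have A: "mapA (delta (M, S) t) = (\<Sum>l = 1 - int (n + 2)..int (n + 2). f l)"
      unfolding f_def a[symmetric]
    proof (rule mapA_delta[OF M S])
      fix l assume "l \<notin> {1 - int (n + 2)..int (n + 2)}"
      then have "Suc n \<le> nat (tri l)"
        using tri_ge[of l] by auto
      then show "Upow (nat (aexp l (b M (1 - 2 * l)) S)) t = 0"
        unfolding a using Upow_eq_0_mono[OF Suc.prems(1)] by blast
    qed simp
    have I: "mapA (delta (M, S) t) \<in> im"
      using S by (intro imageI delta_closed[OF M]) simp
    have total: "(\<Sum>j<n + 2. f (int j + 1) + f (- int j)) \<in> im"
      using I unfolding A pairs .
    have split: "(\<Sum>j<n + 2. f (int j + 1) + f (- int j))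
      = (f 1 + f 0) + (\<Sum>j<n + 1. f (int (Suc j) + 1) + f (- int (Suc j)))"
      using sum.lessThan_Suc_shift[of "\<lambda>j. f (int j + 1) + f (- int j)" "n + 1"] by simp
    \<comment> \<open>All pairs except the innermost have positive weight, which lowers the torsion
      order, so the induction hypothesis removes them.\<close>
    have rest: "(\<Sum>j<n + 1. f (int (Suc j) + 1) + f (- int (Suc j))) \<in> im"
    proof (rule im_sum)
      fix j assume "j \<in> {..<n + 1}"
      define l where "l = int (Suc j) + 1"
      have "1 \<le> tri l"
        unfolding l_def by (rule tri_ge_1) auto
      then have "Suc n \<le> n + nat (tri l)" by simp
      then have "Upow n (Upow (nat (tri l)) t) = 0"
        unfolding Upow_Upow by (rule Upow_eq_0_mono[OF Suc.prems(1)])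
      note IH = Suc.IH[OF this C[of "1 - 2 * l"], of "2 * l - 1"]
      have f1: "f (int (Suc j) + 1) = delta (b M (1 - 2 * l), S) (Upow (nat (tri l)) t)"
        by (simp add: f_def l_def)
      have f2: "f (- int (Suc j))
        = delta (b (b M (1 - 2 * l)) (2 * (2 * l - 1)), S) (Upow (nat (tri l)) t)"
        using tri_reflect[of l] by (simp add: f_def l_def bump_bump)
      show "f (int (Suc j) + 1) + f (- int (Suc j)) \<in> im"
        unfolding f1 f2 by (rule IH) simp
    qed
    have "f 1 + f 0 \<in> im"
      using im_cancel[OF total[unfolded split] rest] .
    moreover have "f 0 = delta (b M 1, S) t" "f 1 = delta (b M (-1), S) t"
      by (simp_all add: f_def tri_def)
    ultimately show ?thesis
      by (simp only: add.commute)
  qed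
  have adj': "delta (M, S) t + delta (b M 2, S) t \<in> im" if M: "M \<in> Char G" for M
    using adj[of "b M 1"] bump_odd[OF M, of 1] M by (simp add: bump_bump add.commute)
  have C: "b K (2 * i) \<in> Char G" for i
    using Suc.prems(2) by (rule bump_even) simp
  show ?case
  proof (induction i rule: int_induct[where k = 0])
    case base
    have zero: "delta (K, S) t + delta (b K (2 * 0), S) t = 0"
      using Suc.prems(2) by simp
    show ?case unfolding zero by (rule im_zero)
  next
    case (step1 i)
    have "delta (b K (2 * i), S) t + delta (b K (2 * (i + 1)), S) t \<in> im"
      using adj'[OF C[of i]] by (simp add: bump_bump algebra_simps)
    from im_add[OF step1(2) this] show ?case
      unfolding cochain_cancel .
  next
    case (step2 i)
    have "delta (b K (2 * i), S) t + delta (b K (2 * (i - 1)), S) t \<in> im"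
      using adj'[OF C[of "i - 1"]] by (simp add: bump_bump algebra_simps)
    from im_add[OF step2(2) this] show ?case
      unfolding cochain_cancel .
  qed
qed

text \<open>Induction on the size of the support: an element of the image is added that clears one
  point and creates no new one. In direction \<open>v\<close> this is a single \<open>delta\<close>;
  otherwise it is a pair whose second point already lies in the support.\<close>

lemma mapB_kernel_subset:
  assumes "\<phi> \<in> cochains G" "mapB \<phi> = 0"
  shows "\<phi> \<in> im"
  using assms
proof (induction "card {p. \<phi> p \<noteq> 0}" arbitrary: \<phi> rule: less_induct)
  case less
  note \<phi> = less.prems(1)
  have reduce: "\<phi> \<in> im" if \<psi>: "\<psi> \<in> im" and sub: "{p. (\<phi> + \<psi>) p \<noteq> 0} \<subset> {p. \<phi> p \<noteq> 0}" for \<psi>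
  proof -
    have \<psi>c: "\<psi> \<in> cochains G" "mapB \<psi> = 0"
      using \<psi> mapA_closed mapB_mapA by auto
    have "\<phi> + \<psi> \<in> im"
    proof (rule less.hyps)
      show "card {p. (\<phi> + \<psi>) p \<noteq> 0} < card {p. \<phi> p \<noteq> 0}"
        using psubset_card_mono[OF cochains_finite[OF \<phi>] sub] .
      show "\<phi> + \<psi> \<in> cochains G" "mapB (\<phi> + \<psi>) = 0"
        using \<phi> \<psi>c less.prems(2) by (simp_all add: cochains_add mapB_add)
    qed
    then show ?thesis using \<psi> by (rule im_cancel)
  qed
  show ?case
  proof (cases "\<phi> = 0")
    case True
    then show ?thesis by (simp add: im_zero)
  next
    case False
    then obtain K S where nz: "\<phi> (K, S) \<noteq> 0"
      by (auto simp: fun_eq_iff)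
    then have K: "K \<in> Char G" and S: "S \<subseteq> verts G"
      using cochains_support[OF \<phi>] by auto
    define t where "t = \<phi> (K, S)"
    obtain n where n: "Upow n t = 0" using ex_Upow_eq_0 by blast
    show ?thesis
    proof (cases "v \<in> S")
      case True
      show ?thesis
      proof (rule reduce)
        show "delta (K, S) t \<in> im"
          using delta_in_im[OF S True n K] .
        show "{p. (\<phi> + delta (K, S) t) p \<noteq> 0} \<subset> {p. \<phi> p \<noteq> 0}"
          using nz by (auto simp: delta_def t_def)
      qed
    next
      case False
      have k: "res K \<in> Char G0" and S0: "S \<subseteq> verts G0"
        using res_Char[OF K] S False by auto
      obtain i where i: "K = b (sec (res K)) (2 * i)"
        using fibre[OF K] by blast
      \<comment> \<open>A fibre sum equal to zero cannot have exactly one nonzero term; the second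
        one is where \<open>t\<close> can be moved.\<close>
      have "\<exists>j. j \<noteq> i \<and> \<phi> (b (sec (res K)) (2 * j), S) \<noteq> 0"
      proof (rule ccontr)
        assume "\<not> ?thesis"
        then have "\<phi> (b (sec (res K)) (2 * j), S) = (if j = i then t else 0)" for j
          using i by (auto simp: t_def)
        then have "mapB \<phi> (res K, S) = t"
          using k S0 by (simp add: mapB_apply)
        then show False
          using less.prems(2) nz by (simp add: t_def)
      qed
      then obtain j where j: "j \<noteq> i" "\<phi> (b (sec (res K)) (2 * j), S) \<noteq> 0" by blast
      define M where "M = b (sec (res K)) (2 * j)"
      have "b K (2 * (j - i)) = b (b (sec (res K)) (2 * i)) (2 * (j - i))"
        using i by simp
      then have M: "M = b K (2 * (j - i))"
        by (simp add: M_def bump_bump algebra_simps)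
      have "M \<noteq> K"
        using bump_inj[of K "2 * (j - i)" 0] j K M by simp
      show ?thesis
      proof (rule reduce)
        show "delta (K, S) t + delta (M, S) t \<in> im"
          unfolding M using delta_pair_in_im[OF S False n K] .
        show "{p. (\<phi> + (delta (K, S) t + delta (M, S) t)) p \<noteq> 0} \<subset> {p. \<phi> p \<noteq> 0}"
          using nz j \<open>M \<noteq> K\<close> by (auto simp: delta_def t_def M_def split: if_splits)
      qed
    qed
  qed
qed

lemma short_exact:
  "short_exact_complexes FU (lattice_complex G1) (lattice_complex G) (lattice_complex G0) mapA mapB"
proof -
  have "mapA ` cochains G1 = a_kernel (lattice_complex G) (lattice_complex G0) mapB"
    using mapB_kernel_subset mapA_closed mapB_mapA by (auto simp: a_kernel_def')
  moreover have "mapB ` cochains G = cochains G0"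
    using mapB_closed mapB_surj by force
  ultimately show ?thesis
    using finV mapA_cochain_map mapB_cochain_map mapA_inj
    by (simp add: short_exact_complexes_def lattice_complex_is_complex)
qed

end

theorem theorem3p1:
  fixes G :: "('v, 'e) wgraph" and v :: 'v
  assumes "finite_wgraph G" and "planar G" and "v \<in> verts G"
  shows "\<exists>A B.
    short_exact_complexes FU
      (lattice_complex (raise_weight G v)) (lattice_complex G)
      (lattice_complex (delete_vertex G v)) A B \<and>
    (\<exists>D.
      is_connecting_map
        (lattice_complex (raise_weight G v)) (lattice_complex G)
        (lattice_complex (delete_vertex G v)) A B D \<and>
      exact_triangle FU
        (lattice_cohomology (raise_weight G v)) (lattice_cohomology G)
        (lattice_cohomology (delete_vertex G v))
        (induced_map (lattice_complex G) A)
        (induced_map (lattice_complex (delete_vertex G v)) B) D)"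
proof -
  interpret vertex_graph G v
    using assms by unfold_locales (auto simp: finite_wgraph_def)
  show ?thesis
    using short_exact long_exact_sequence[OF short_exact] by blast
qed

end
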